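(* Let $k$ be a field, let $d>1$ and $n>1$ be integers, let $\mathfrak n=(x_1,\ldots,x_d)\subset k[x_1,\ldots,x_d]$, and set $R_{d,n}:=k[x_1,\ldots,x_d]/\mathfrak n^n$. If $M$ is a finitely generated nonfree $R_{d,n}$-module, then $$\beta_{i+1}(M)-\beta_i(M)\geq d-1\qquad\text{for all } i\geq 2 .$$
   Context: $R_{d,n}$ is an artinian local ring with residue field $k$. For a finitely generated module $M$ over a local ring $R$ with residue field $k$, $\beta_i(M)=\dim_k\operatorname{Tor}^R_i(k,M)$ is the $i$-th Betti number of $M$ over $R$; here Betti numbers are taken over $R_{d,n}$. *)

theory Defs
  imports
    "HOL-Library.Poly_Mapping"
    "HOL-Algebra.Ideal_Product"
    "HOL-Algebra.QuotRing"
    "Jordan_Normal_Form.Missing_VectorSpace"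
begin

section \<open>The ring \<open>k[x\<^sub>1, \<dots>, x\<^sub>d] / \<nn>\<^sup>n\<close>\<close>

text \<open>A monomial is a finitely supported exponent function on variable indices, and a polynomial
  is a finitely supported coefficient function on monomials. The variables
  \<open>x\<^sub>1, \<dots>, x\<^sub>d\<close> carry the indices \<open>0, \<dots>, d - 1\<close>.\<close>

definition mpoly_ring :: "nat \<Rightarrow> ((nat \<Rightarrow>\<^sub>0 nat) \<Rightarrow>\<^sub>0 'k::field) ring" where
  "mpoly_ring d = \<lparr>carrier = {p. \<forall>m\<in>Poly_Mapping.keys p. Poly_Mapping.keys m \<subseteq> {..<d}},
     mult = (*), one = 1, zero = 0, add = (+)\<rparr>"

definition mpoly_var :: "nat \<Rightarrow> ((nat \<Rightarrow>\<^sub>0 nat) \<Rightarrow>\<^sub>0 'k::field)" where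
  "mpoly_var i = Poly_Mapping.single (Poly_Mapping.single i 1) 1"

definition vars_ideal :: "nat \<Rightarrow> ((nat \<Rightarrow>\<^sub>0 nat) \<Rightarrow>\<^sub>0 'k::field) set" where
  "vars_ideal d = Idl\<^bsub>mpoly_ring d\<^esub> (mpoly_var ` {..<d})"

text \<open>The power is taken in the multiplicative monoid of ideals of the polynomial ring.\<close>

definition trunc_poly_ring :: "nat \<Rightarrow> nat \<Rightarrow> ((nat \<Rightarrow>\<^sub>0 nat) \<Rightarrow>\<^sub>0 'k::field) set ring" where
  "trunc_poly_ring d n =
     mpoly_ring d Quot (vars_ideal d [^]\<^bsub>ideals_set (mpoly_ring d)\<^esub> n)"


section \<open>Modules\<close>

text \<open>The record type of modules extends that of rings; its fields \<open>mult\<close> and \<open>one\<close> play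
  no role for modules and are left unspecified below.\<close>

definition fin_gen_module :: "('a, 'r) ring_scheme \<Rightarrow> ('a, 'b, 'm) module_scheme \<Rightarrow> bool" where
  "fin_gen_module R M \<longleftrightarrow> module R M \<and>
     (\<exists>A. finite A \<and> A \<subseteq> carrier M \<and> module.span R M A = carrier M)"

definition free_module :: "('a, 'r) ring_scheme \<Rightarrow> ('a, 'b, 'm) module_scheme \<Rightarrow> bool" where
  "free_module R M \<longleftrightarrow> module R M \<and>
     (\<exists>B. B \<subseteq> carrier M \<and> \<not> module.lin_dep R M B \<and> module.span R M B = carrier M)"

definition quot_module :: "('a, 'b, 'm) module_scheme \<Rightarrow> 'b set \<Rightarrow> ('a, 'b set) module" where
  "quot_module M N = \<lparr>carrier = a_rcosets\<^bsub>M\<^esub> N, mult = undefined, one = undefined,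
     zero = N, add = set_add M,
     smult = (\<lambda>r X. \<Union>x\<in>X. N +>\<^bsub>M\<^esub> (r \<odot>\<^bsub>M\<^esub> x))\<rparr>"

text \<open>The free \<open>R\<close>-module with basis \<open>S\<close>, as finitely supported functions.\<close>

definition free_mod_on :: "('a, 'r) ring_scheme \<Rightarrow> 's set \<Rightarrow> ('a, 's \<Rightarrow> 'a) module" where
  "free_mod_on R S = \<lparr>carrier = {c. (\<forall>s\<in>S. c s \<in> carrier R) \<and> (\<forall>s. s \<notin> S \<longrightarrow> c s = \<zero>\<^bsub>R\<^esub>) \<and>
       finite {s. c s \<noteq> \<zero>\<^bsub>R\<^esub>}},
     mult = undefined, one = undefined,
     zero = (\<lambda>s. \<zero>\<^bsub>R\<^esub>), add = (\<lambda>c c' s. c s \<oplus>\<^bsub>R\<^esub> c' s),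
     smult = (\<lambda>r c s. r \<otimes>\<^bsub>R\<^esub> c s)\<rparr>"

definition basis_elt :: "('a, 'r) ring_scheme \<Rightarrow> 's \<Rightarrow> 's \<Rightarrow> 'a" where
  "basis_elt R s = (\<lambda>t. if t = s then \<one>\<^bsub>R\<^esub> else \<zero>\<^bsub>R\<^esub>)"


section \<open>Tensor products\<close>

definition tensor_rels ::
  "('a, 'r) ring_scheme \<Rightarrow> ('a, 'b) module \<Rightarrow> ('a, 'c) module \<Rightarrow> ('b \<times> 'c \<Rightarrow> 'a) set" where
  "tensor_rels R M N =
     (let C = free_mod_on R (carrier M \<times> carrier N); e = basis_elt R in
       {e (x \<oplus>\<^bsub>M\<^esub> x', y) \<ominus>\<^bsub>C\<^esub> (e (x, y) \<oplus>\<^bsub>C\<^esub> e (x', y)) | x x' y.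
          x \<in> carrier M \<and> x' \<in> carrier M \<and> y \<in> carrier N} \<union>
       {e (x, y \<oplus>\<^bsub>N\<^esub> y') \<ominus>\<^bsub>C\<^esub> (e (x, y) \<oplus>\<^bsub>C\<^esub> e (x, y')) | x y y'.
          x \<in> carrier M \<and> y \<in> carrier N \<and> y' \<in> carrier N} \<union>
       {e (r \<odot>\<^bsub>M\<^esub> x, y) \<ominus>\<^bsub>C\<^esub> r \<odot>\<^bsub>C\<^esub> e (x, y) | r x y.
          r \<in> carrier R \<and> x \<in> carrier M \<and> y \<in> carrier N} \<union>
       {e (x, r \<odot>\<^bsub>N\<^esub> y) \<ominus>\<^bsub>C\<^esub> r \<odot>\<^bsub>C\<^esub> e (x, y) | r x y.
          r \<in> carrier R \<and> x \<in> carrier M \<and> y \<in> carrier N})"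

definition tensor_null ::
  "('a, 'r) ring_scheme \<Rightarrow> ('a, 'b) module \<Rightarrow> ('a, 'c) module \<Rightarrow> ('b \<times> 'c \<Rightarrow> 'a) set" where
  "tensor_null R M N =
     module.span R (free_mod_on R (carrier M \<times> carrier N)) (tensor_rels R M N)"

definition tensor_module ::
  "('a, 'r) ring_scheme \<Rightarrow> ('a, 'b) module \<Rightarrow> ('a, 'c) module
     \<Rightarrow> ('a, ('b \<times> 'c \<Rightarrow> 'a) set) module" where
  "tensor_module R M N =
     quot_module (free_mod_on R (carrier M \<times> carrier N)) (tensor_null R M N)"

text \<open>The map \<open>id\<^sub>M \<otimes> f : M \<otimes> N \<rightarrow> M \<otimes> N'\<close> induced by \<open>f : N \<rightarrow> N'\<close>. A representative
  \<open>c\<close> of a coset \<open>X\<close> is sent to the coset of \<open>\<Sum> c\<^bsub>(x, y)\<^esub> (x, f y)\<close>.\<close>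

definition tensor_map ::
  "('a, 'r) ring_scheme \<Rightarrow> ('a, 'b) module \<Rightarrow> ('a, 'd) module \<Rightarrow> ('c \<Rightarrow> 'd)
     \<Rightarrow> ('b \<times> 'c \<Rightarrow> 'a) set \<Rightarrow> ('b \<times> 'd \<Rightarrow> 'a) set" where
  "tensor_map R M N' f X =
     (let C' = free_mod_on R (carrier M \<times> carrier N') in
       \<Union>c\<in>X. tensor_null R M N' +>\<^bsub>C'\<^esub>
         (\<Oplus>\<^bsub>C'\<^esub> s\<in>{s. c s \<noteq> \<zero>\<^bsub>R\<^esub>}. c s \<odot>\<^bsub>C'\<^esub> basis_elt R (fst s, f (snd s))))"


section \<open>Homology, free resolutions and Tor\<close>

text \<open>A chain complex is given by modules \<open>C 0, C 1, \<dots>\<close> and differentials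
  \<open>\<delta> i : C (Suc i) \<rightarrow> C i\<close>; it is zero in negative degrees.\<close>

definition cycles ::
  "(nat \<Rightarrow> ('a, 'b) module) \<Rightarrow> (nat \<Rightarrow> 'b \<Rightarrow> 'b) \<Rightarrow> nat \<Rightarrow> 'b set" where
  "cycles C \<delta> i = (case i of 0 \<Rightarrow> carrier (C 0)
     | Suc j \<Rightarrow> {x \<in> carrier (C (Suc j)). \<delta> j x = \<zero>\<^bsub>C j\<^esub>})"

definition boundaries ::
  "(nat \<Rightarrow> ('a, 'b) module) \<Rightarrow> (nat \<Rightarrow> 'b \<Rightarrow> 'b) \<Rightarrow> nat \<Rightarrow> 'b set" where
  "boundaries C \<delta> i = \<delta> i ` carrier (C (Suc i))"

definition homology_module ::
  "(nat \<Rightarrow> ('a, 'b) module) \<Rightarrow> (nat \<Rightarrow> 'b \<Rightarrow> 'b) \<Rightarrow> nat \<Rightarrow> ('a, 'b set) module" where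
  "homology_module C \<delta> i = quot_module ((C i)\<lparr>carrier := cycles C \<delta> i\<rparr>) (boundaries C \<delta> i)"

text \<open>Resolutions \<open>\<dots> \<rightarrow> R\<^bsup>b 1\<^esup> \<rightarrow> R\<^bsup>b 0\<^esup> \<rightarrow> M \<rightarrow> 0\<close> by free modules of finite rank, which
  exist for every finitely generated module over a noetherian ring.\<close>

definition free_resolution ::
  "('a, 'r) ring_scheme \<Rightarrow> ('a, 'b, 'm) module_scheme
     \<Rightarrow> (nat \<Rightarrow> nat) \<times> (nat \<Rightarrow> (nat \<Rightarrow> 'a) \<Rightarrow> nat \<Rightarrow> 'a) \<times> ((nat \<Rightarrow> 'a) \<Rightarrow> 'b) \<Rightarrow> bool" where
  "free_resolution R M = (\<lambda>(b, \<delta>, \<epsilon>).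
     let F = (\<lambda>i. free_mod_on R {..<b i}) in
       (\<forall>i. \<delta> i \<in> module_hom R (F (Suc i)) (F i)) \<and>
       \<epsilon> \<in> module_hom R (F 0) M \<and>
       \<epsilon> ` carrier (F 0) = carrier M \<and>
       boundaries F \<delta> 0 = {x \<in> carrier (F 0). \<epsilon> x = \<zero>\<^bsub>M\<^esub>} \<and>
       (\<forall>i. boundaries F \<delta> (Suc i) = cycles F \<delta> (Suc i)))"

text \<open>\<open>Tor\<^sub>i(N, M)\<close>, computed by a free resolution of \<open>M\<close>; up to isomorphism the result does
  not depend on the one that is chosen.\<close>

definition Tor_module ::
  "('a, 'r) ring_scheme \<Rightarrow> ('a, 'c) module \<Rightarrow> ('a, 'b, 'm) module_scheme \<Rightarrow> nat
     \<Rightarrow> ('a, ('c \<times> (nat \<Rightarrow> 'a) \<Rightarrow> 'a) set set) module" where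
  "Tor_module R N M i =
     (let (b, \<delta>, \<epsilon>) = (SOME F. free_resolution R M F);
          F = (\<lambda>j. free_mod_on R {..<b j})
      in homology_module (\<lambda>j. tensor_module R N (F j))
           (\<lambda>j. tensor_map R N (F j) (\<delta> j)) i)"


section \<open>Betti numbers over a local ring\<close>

definition local_max_ideal :: "('a, 'r) ring_scheme \<Rightarrow> 'a set" where
  "local_max_ideal R = (THE I. maximalideal I R)"

definition residue_field :: "('a, 'r) ring_scheme \<Rightarrow> 'a set ring" where
  "residue_field R = R Quot local_max_ideal R"

text \<open>The residue field with its \<open>R\<close>-module structure.\<close>

definition residue_module :: "('a, 'r) ring_scheme \<Rightarrow> ('a, 'a set) module" where
  "residue_module R = \<lparr>carrier = carrier (residue_field R),
     mult = mult (residue_field R), one = one (residue_field R),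
     zero = zero (residue_field R), add = add (residue_field R),
     smult = (\<lambda>r X. (local_max_ideal R +>\<^bsub>R\<^esub> r) \<otimes>\<^bsub>residue_field R\<^esub> X)\<rparr>"

text \<open>An \<open>R\<close>-module annihilated by the maximal ideal, such as \<open>Tor\<^sub>i(k, M)\<close>, viewed as a vector
  space over the residue field: a residue class acts through any of its representatives.\<close>

definition residue_space :: "('a, 'b) module \<Rightarrow> ('a set, 'b) module" where
  "residue_space V = \<lparr>carrier = carrier V, mult = mult V, one = one V, zero = zero V,
     add = add V, smult = (\<lambda>X v. (SOME r. r \<in> X) \<odot>\<^bsub>V\<^esub> v)\<rparr>"

definition betti :: "('a, 'r) ring_scheme \<Rightarrow> ('a, 'b, 'm) module_scheme \<Rightarrow> nat \<Rightarrow> nat" where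
  "betti R M i = vectorspace.dim (residue_field R)
     (residue_space (Tor_module R (residue_module R) M i))"

end

theory Submission
  imports Defs "HOL.Vector_Spaces" "HOL-Library.Function_Algebras"
begin

text \<open>Write \<open>Q = k[x\<^sub>1, \<dots>, x\<^sub>d]\<close>, \<open>R = Q / \<nn>\<^sup>t\<close>, and let \<open>h\<^sub>a\<close> be the number of monomials of degree \<open>a\<close>
  in \<open>d\<close> variables. A free resolution of \<open>M\<close> over \<open>R\<close>, minimal or not, is lifted to a sequence of
  matrices \<open>A\<^sub>i\<close> over \<open>Q\<close>, and exactness over \<open>R\<close> becomes a statement about orders of vanishing
  (\<open>exact_mod\<close>). Tensoring with \<open>k\<close> replaces \<open>A\<^sub>i\<close> by its matrix of constant terms, so that
  \<open>\<beta>\<^sub>i\<close> is the dimension of the kernel of the constant part of \<open>A\<^bsub>i-1\<^esub>\<close> minus the dimension of the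
  image of the constant part of \<open>A\<^sub>i\<close>. Two estimates for \<open>i \<ge> 1\<close> carry the proof.

  Lower estimate, \<open>\<beta>\<^bsub>i+2\<^esub> \<ge> h\<^sub>t \<beta>\<^sub>i\<close> (\<open>betti_growth_lower\<close>). The product of two consecutive
  matrices vanishes over \<open>R\<close>, so its entries over \<open>Q\<close> have order at least \<open>t\<close>, and their parts of
  degree \<open>t\<close> carry information that \<open>R\<close> does not see. For a class \<open>z\<close> of the \<open>i\<close>-th homology and a
  monomial \<open>\<mu>\<close> of degree \<open>t\<close> there is a cycle two steps higher that this leading part sends to
  \<open>\<mu> z\<close>; hence these cycles are linearly independent modulo boundaries.

  Upper estimate, \<open>\<beta>\<^bsub>i+1\<^esub> \<le> h\<^bsub>t-1\<^esub> \<beta>\<^sub>i\<close> (\<open>betti_growth_upper\<close>). After the part of the differential that is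
  invertible modulo \<open>\<nn>\<close> is split off, \<open>\<beta>\<^bsub>i+1\<^esub>\<close> is at most the number of generators of a syzygy
  module \<open>N\<close>. A single variable \<open>x\<close> suffices to bound that number: it is at most the dimension of
  \<open>N / x N\<close>, hence of the kernel of \<open>x\<close> on \<open>N\<close>, and a vector killed by \<open>x\<close> is homogeneous
  of degree \<open>t - 1\<close> with cycles as coefficients.

  Multiplication by a variable and the pure powers of the other variables show
  \<open>h\<^sub>t - h\<^bsub>t-1\<^esub> \<ge> d - 1\<close> (\<open>card_monoms_Suc\<close>), so for \<open>i \<ge> 2\<close> the difference \<open>\<beta>\<^bsub>i+1\<^esub> - \<beta>\<^sub>i\<close> is at least
  \<open>(d - 1) \<beta>\<^bsub>i-1\<^esub>\<close>. It remains to see that no Betti number of positive index vanishes. The two estimates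
  propagate this from \<open>\<beta>\<^sub>1\<close>, and if \<open>\<beta>\<^sub>1 = 0\<close>, then the presentation of \<open>M\<close> splits and \<open>M\<close> is
  free (\<open>split_of_ker_subset_im\<close>, \<open>free_of_betti_1_zero\<close>).

  The link to the definition of the Betti numbers is that \<open>k \<otimes> R\<^sup>b\<close>, a quotient of the free module on
  all pairs, is \<open>k\<^sup>b\<close>: a formal combination of pairs has coordinates in \<open>k\<^sup>b\<close>, and the
  relations of the tensor product are exactly the combinations with coordinates zero
  (\<open>tensor_null_eq\<close>).\<close>

section \<open>Dimensions of subspaces\<close>

context vector_space
begin

lemma independent_subset_span_finite:
  assumes "independent B" "B \<subseteq> span F" "finite F"
  shows "finite B \<and> card B \<le> card F"
  using independent_span_bound[OF assms(3,1,2)] .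

lemma finite_basis_of:
  assumes "V \<subseteq> span F" "finite F"
  obtains B where "B \<subseteq> V" "finite B" "independent B" "V \<subseteq> span B" "card B = dim V"
proof -
  obtain B where B: "B \<subseteq> V" "independent B" "V \<subseteq> span B" "card B = dim V"
    using basis_exists by blast
  moreover have "finite B"
    using independent_subset_span_finite[OF B(2) _ assms(2)] B(1) assms(1) by blast
  ultimately show ?thesis using that by blast
qed

lemma dim_eq_dim_plus_complement:
  assumes "subspace U" "subspace V" "U \<subseteq> V" "V \<subseteq> span F" "finite F"
  obtains W B where "finite W" "W \<subseteq> V" "card W + dim U = dim V" "finite B" "B \<subseteq> U" "span B = U"
    "B \<inter> W = {}" "independent (B \<union> W)" "span (B \<union> W) = V"
proof -
  obtain B where B: "B \<subseteq> U" "finite B" "independent B" "U \<subseteq> span B" "card B = dim U"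
    using finite_basis_of[of U F] assms by blast
  obtain C where C: "B \<subseteq> C" "C \<subseteq> V" "independent C" "V \<subseteq> span C"
    using maximal_independent_subset_extend[of B V] B assms by blast
  have fC: "finite C" using independent_subset_span_finite[OF C(3) _ assms(5)] C(2) assms(4) by blast
  have "card C = dim V" using basis_card_eq_dim[OF C(2) C(4) C(3)] .
  moreover have "card (C - B) = card C - card B" using B C by (simp add: card_Diff_subset)
  moreover have "card B \<le> card C" using C fC card_mono by blast
  moreover have "span B = U" using B assms(1) span_minimal by blast
  moreover have "B \<union> (C - B) = C" using C by blast
  moreover have "span C = V" using C assms(2) span_minimal by blast
  ultimately show ?thesis using that[of "C - B" B] B C fC by auto
qed

lemma dim_mono_finite:
  assumes "V \<subseteq> W" "W \<subseteq> span F" "finite F"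
  shows "dim V \<le> dim W"
proof -
  obtain B where B: "B \<subseteq> V" "finite B" "independent B" "V \<subseteq> span B" "card B = dim V"
    using finite_basis_of[of V F] assms by blast
  obtain C where C: "C \<subseteq> W" "finite C" "independent C" "W \<subseteq> span C" "card C = dim W"
    using finite_basis_of[of W F] assms by blast
  show ?thesis using independent_subset_span_finite[OF B(3), of C] B C assms by force
qed

lemma dim_le_of_span_modulo:
  assumes "V \<subseteq> span (W \<union> U)" "finite W" "U \<subseteq> span F" "finite F"
  shows "dim V \<le> card W + dim U"
proof -
  obtain B where B: "B \<subseteq> U" "finite B" "independent B" "U \<subseteq> span B" "card B = dim U"
    using finite_basis_of[of U F] assms by blast
  have "span (W \<union> U) \<subseteq> span (W \<union> B)"
    using B by (intro span_minimal) (auto intro: span_base subsetD[OF span_mono, of B])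
  then have "dim V \<le> card (W \<union> B)" using assms B by (intro dim_le_card) auto
  also have "\<dots> \<le> card W + card B" by (rule card_Un_le)
  finally show ?thesis using B by simp
qed

lemma independent_modulo_span:
  assumes ind: "independent (B \<union> W)" and disj: "B \<inter> W = {}" and fin: "finite B" "finite W"
    and c: "(\<Sum>w\<in>W. scale (c w) w) \<in> span B"
  shows "\<forall>w\<in>W. c w = 0"
proof
  fix z assume z: "z \<in> W"
  obtain f where f: "(\<Sum>w\<in>W. scale (c w) w) = (\<Sum>x\<in>B. scale (f x) x)"
    using c span_finite[OF fin(1)] by auto
  let ?g = "\<lambda>x. if x \<in> B then - f x else c x"
  have "(\<Sum>x\<in>B \<union> W. scale (?g x) x) = (\<Sum>x\<in>B. scale (?g x) x) + (\<Sum>x\<in>W. scale (?g x) x)"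
    using fin disj by (intro sum.union_disjoint)
  also have "(\<Sum>x\<in>W. scale (?g x) x) = (\<Sum>x\<in>W. scale (c x) x)"
    using disj by (intro sum.cong) auto
  also have "(\<Sum>x\<in>B. scale (?g x) x) = (\<Sum>x\<in>B. - scale (f x) x)" by (intro sum.cong) simp_all
  finally have "(\<Sum>x\<in>B \<union> W. scale (?g x) x) = 0" unfolding f sum_negf by (rule trans) simp
  moreover have "finite (B \<union> W)" using fin by simp
  moreover have "z \<in> B \<union> W" "z \<notin> B" using z disj by auto
  ultimately have "?g z = 0" by (intro independentD[OF ind _ subset_refl])
  with \<open>z \<notin> B\<close> show "c z = 0" by simp
qed

lemma card_plus_dim_le_of_independent_modulo:
  assumes U: "subspace U" and V: "subspace V" "U \<subseteq> V" "V \<subseteq> span F" "finite F"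
    and I: "finite I" "\<And>i. i \<in> I \<Longrightarrow> w i \<in> V"
    and ind: "\<And>c. (\<Sum>i\<in>I. scale (c i) (w i)) \<in> U \<Longrightarrow> \<forall>i\<in>I. c i = 0"
  shows "card I + dim U \<le> dim V"
proof -
  obtain B where B: "B \<subseteq> U" "finite B" "independent B" "U \<subseteq> span B" "card B = dim U"
    using finite_basis_of[of U F] V by blast
  have inj: "inj_on w I"
  proof (rule inj_onI, rule ccontr)
    fix i j assume ij: "i \<in> I" "j \<in> I" "w i = w j" "i \<noteq> j"
    let ?c = "\<lambda>k. if k = i then 1 else if k = j then - 1 else (0::'a)"
    have "(\<Sum>k\<in>I. scale (?c k) (w k)) = (\<Sum>k\<in>{i,j}. scale (?c k) (w k))"
      using I ij by (intro sum.mono_neutral_right) auto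
    also have "\<dots> = 0" using ij by simp
    finally have "?c i = 0" using ind[of ?c] ij subspace_0[OF U] by force
    then show False by simp
  qed
  have disj: "B \<inter> w ` I = {}"
  proof (rule ccontr)
    assume "\<not> ?thesis"
    then obtain i where i: "i \<in> I" "w i \<in> B" by blast
    let ?c = "\<lambda>k. if k = i then 1 else (0::'a)"
    have "(\<Sum>k\<in>I. scale (?c k) (w k)) = (\<Sum>k\<in>{i}. scale (?c k) (w k))"
      using I i by (intro sum.mono_neutral_right) auto
    also have "\<dots> \<in> U" using i B by auto
    finally have "?c i = 0" using ind[of ?c] i by blast
    then show False by simp
  qed
  have "independent (B \<union> w ` I)"
  proof (rule independent_if_scalars_zero)
    show "finite (B \<union> w ` I)" using B I by simp
    fix f x assume s: "(\<Sum>x\<in>B \<union> w ` I. scale (f x) x) = 0" and x: "x \<in> B \<union> w ` I"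
    have s2: "(\<Sum>x\<in>B. scale (f x) x) + (\<Sum>i\<in>I. scale (f (w i)) (w i)) = 0"
      using s B I disj inj by (simp add: sum.union_disjoint sum.reindex)
    then have "(\<Sum>i\<in>I. scale (f (w i)) (w i)) = - (\<Sum>x\<in>B. scale (f x) x)"
      by (simp add: add_eq_0_iff)
    moreover have "(\<Sum>x\<in>B. scale (f x) x) \<in> U"
      using B U by (intro subspace_sum subspace_scale) auto
    ultimately have "(\<Sum>i\<in>I. scale (f (w i)) (w i)) \<in> U" using U subspace_neg by metis
    then have z: "\<forall>i\<in>I. f (w i) = 0" using ind[of "\<lambda>i. f (w i)"] by blast
    then have "(\<Sum>x\<in>B. scale (f x) x) = 0" using s2 by simp
    then have "\<forall>x\<in>B. f x = 0" using B(2,3) independentD[of B B f] by blast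
    with z x show "f x = 0" by auto
  qed
  then have "card (B \<union> w ` I) = dim (B \<union> w ` I)" by (simp add: dim_eq_card_independent)
  also have "\<dots> \<le> dim V" using B V I by (intro dim_mono_finite[where F = F]) auto
  finally show ?thesis using B I disj inj by (simp add: card_Un_disjoint card_image)
qed

lemma dim_plus_dim_le_of_inter_zero:
  assumes "subspace U" "subspace V" "subspace Z" "U \<subseteq> Z" "V \<subseteq> Z" "Z \<subseteq> span F" "finite F"
    and "U \<inter> V \<subseteq> {0}"
  shows "dim U + dim V \<le> dim Z"
proof -
  obtain B where B: "B \<subseteq> U" "finite B" "independent B" "U \<subseteq> span B" "card B = dim U"
    using finite_basis_of[of U F] assms by blast
  have "card B + dim V \<le> dim Z"
  proof (rule card_plus_dim_le_of_independent_modulo[where w = "\<lambda>x. x" and F = F])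
    fix c assume c: "(\<Sum>i\<in>B. scale (c i) i) \<in> V"
    have "(\<Sum>i\<in>B. scale (c i) i) \<in> U" using B assms by (intro subspace_sum subspace_scale) auto
    then have "(\<Sum>i\<in>B. scale (c i) i) = 0" using c assms by blast
    then show "\<forall>i\<in>B. c i = 0" using B(2,3) independentD[of B B c] by blast
  qed (use assms B in auto)
  then show ?thesis using B by simp
qed

lemma dim_le_dim_image_plus_dim_kernel:
  assumes f: "Vector_Spaces.linear scale scale f" and V: "subspace V" "V \<subseteq> span F" "finite F"
  shows "dim V \<le> dim (f ` V) + dim {v \<in> V. f v = 0}"
proof -
  interpret f: Vector_Spaces.linear scale scale f by (rule f)
  have fV: "f ` V \<subseteq> span (f ` F)" using V(2) f.span_image[of F] by auto
  obtain B where B: "B \<subseteq> f ` V" "finite B" "independent B" "f ` V \<subseteq> span B" "card B = dim (f ` V)"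
    using finite_basis_of[OF fV] V(3) by blast
  obtain C where C: "C \<subseteq> V" "f ` C = B" "inj_on f C" using B(1) by (metis subset_image_inj)
  have "V \<subseteq> span (C \<union> {v \<in> V. f v = 0})"
  proof
    fix v assume v: "v \<in> V"
    then have "f v \<in> span (f ` C)" using B C by blast
    then obtain c where c: "c \<in> span C" "f c = f v" using f.span_image[of C] by auto
    have "c \<in> V" using c C V span_minimal by blast
    then have "v - c \<in> {v \<in> V. f v = 0}" using v V c by (simp add: subspace_diff f.diff)
    then have "v - c \<in> span (C \<union> {v \<in> V. f v = 0})" by (simp add: span_base)
    moreover have "c \<in> span (C \<union> {v \<in> V. f v = 0})" using c(1) span_mono[of C] by auto
    ultimately show "v \<in> span (C \<union> {v \<in> V. f v = 0})" using span_add[of "v - c" _ c] by force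
  qed
  moreover have "finite C" using B C by (metis finite_image_iff)
  ultimately have "dim V \<le> card C + dim {v \<in> V. f v = 0}"
    using V by (intro dim_le_of_span_modulo[where F = F]) auto
  also have "card C = dim (f ` V)" using B C by (metis card_image)
  finally show ?thesis .
qed

end

section \<open>Order filtration on polynomials\<close>

type_synonym 'k mpoly = "(nat \<Rightarrow>\<^sub>0 nat) \<Rightarrow>\<^sub>0 'k"

definition mdeg :: "(nat \<Rightarrow>\<^sub>0 nat) \<Rightarrow> nat" where
  "mdeg m = (\<Sum>i\<in>Poly_Mapping.keys m. Poly_Mapping.lookup m i)"

lemma mdeg_superset:
  "finite S \<Longrightarrow> Poly_Mapping.keys m \<subseteq> S \<Longrightarrow> mdeg m = (\<Sum>i\<in>S. Poly_Mapping.lookup m i)"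
  unfolding mdeg_def by (rule sum.mono_neutral_left) (auto simp: in_keys_iff)

lemma mdeg_add: "mdeg (m + n) = mdeg m + mdeg n"
proof -
  let ?S = "Poly_Mapping.keys m \<union> Poly_Mapping.keys n"
  have "Poly_Mapping.keys (m + n) \<subseteq> ?S" by (rule Poly_Mapping.keys_add)
  then show ?thesis
    by (simp add: mdeg_superset[of ?S] lookup_add sum.distrib)
qed

lemma mdeg_zero [simp]: "mdeg 0 = 0" by (simp add: mdeg_def)

lemma mdeg_single [simp]: "mdeg (Poly_Mapping.single i a) = a"
  by (cases "a = 0") (auto simp: mdeg_def)

lemma mdeg_eq_0_iff [simp]: "mdeg m = 0 \<longleftrightarrow> m = 0"
proof
  assume "mdeg m = 0"
  then show "m = 0" by (intro poly_mapping_eqI) (auto simp: mdeg_def in_keys_iff)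
qed simp

definition polys :: "nat \<Rightarrow> 'k::field mpoly set" where
  "polys d = {p. \<forall>m\<in>Poly_Mapping.keys p. Poly_Mapping.keys m \<subseteq> {..<d}}"

text \<open>The polynomials of order at least \<open>a\<close>; within \<open>polys d\<close> they form the ideal \<open>\<nn>\<^sup>a\<close>.\<close>

definition ord_ge :: "nat \<Rightarrow> 'k::field mpoly set" where
  "ord_ge a = {p. \<forall>m. mdeg m < a \<longrightarrow> Poly_Mapping.lookup p m = 0}"

lemma ord_geD: "p \<in> ord_ge a \<Longrightarrow> mdeg m < a \<Longrightarrow> Poly_Mapping.lookup p m = 0"
  by (simp add: ord_ge_def)

lemma ord_ge_0 [simp]: "ord_ge 0 = UNIV" by (auto simp: ord_ge_def)
lemma ord_ge_antimono: "a \<le> b \<Longrightarrow> p \<in> ord_ge b \<Longrightarrow> p \<in> ord_ge a" by (auto simp: ord_ge_def)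
lemma zero_ord_ge [simp]: "0 \<in> ord_ge a" by (auto simp: ord_ge_def)
lemma ord_ge_add: "p \<in> ord_ge a \<Longrightarrow> q \<in> ord_ge a \<Longrightarrow> p + q \<in> ord_ge a"
  by (auto simp: ord_ge_def lookup_add)
lemma ord_ge_uminus: "p \<in> ord_ge a \<Longrightarrow> - p \<in> ord_ge a" by (auto simp: ord_ge_def)
lemma ord_ge_diff: "p \<in> ord_ge a \<Longrightarrow> q \<in> ord_ge a \<Longrightarrow> p - q \<in> ord_ge a"
  by (auto simp: ord_ge_def lookup_minus)
lemma ord_ge_sum: "(\<And>i. i \<in> S \<Longrightarrow> f i \<in> ord_ge a) \<Longrightarrow> sum f S \<in> ord_ge a"
  by (auto simp: ord_ge_def lookup_sum)

lemma ord_ge_single: "a \<le> mdeg m \<Longrightarrow> Poly_Mapping.single m c \<in> ord_ge a"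
  by (auto simp: ord_ge_def lookup_single when_def)

lemma lookup_times:
  fixes p q :: "'k::field mpoly"
  shows "Poly_Mapping.lookup (p * q) m = (\<Sum>x\<in>Poly_Mapping.keys p. \<Sum>y\<in>Poly_Mapping.keys q.
     Poly_Mapping.lookup p x * Poly_Mapping.lookup q y when m = x + y)"
proof -
  have "p * q = (\<Sum>x\<in>Poly_Mapping.keys p. \<Sum>y\<in>Poly_Mapping.keys q.
     Poly_Mapping.single (x + y) (Poly_Mapping.lookup p x * Poly_Mapping.lookup q y))"
  proof -
    have e: "f = (\<Sum>x\<in>Poly_Mapping.keys f. Poly_Mapping.single x (Poly_Mapping.lookup f x))" for f :: "'k mpoly"
      by (rule poly_mapping_eqI)
        (auto simp: lookup_sum lookup_single when_def sum.delta' in_keys_iff cong: if_cong)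
    show ?thesis
      by (subst e[of p], subst e[of q]) (simp add: sum_product mult_single)
  qed
  then show ?thesis by (simp add: lookup_sum lookup_single when_def eq_commute)
qed

lemma ord_ge_mult:
  assumes "p \<in> ord_ge a" "q \<in> ord_ge b" shows "p * q \<in> ord_ge (a + b)"
  unfolding ord_ge_def
proof (clarsimp simp: lookup_times)
  fix m assume m: "mdeg m < a + b"
  show "(\<Sum>x\<in>Poly_Mapping.keys p. \<Sum>y\<in>Poly_Mapping.keys q.
     Poly_Mapping.lookup p x * Poly_Mapping.lookup q y when m = x + y) = 0"
  proof (intro sum.neutral ballI)
    fix x y
    show "(Poly_Mapping.lookup p x * Poly_Mapping.lookup q y when m = x + y) = 0"
      using m ord_geD[OF assms(1), of x] ord_geD[OF assms(2), of y]
      by (cases "mdeg x < a") (auto simp: when_def mdeg_add)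
  qed
qed

lemma ord_ge_mult_left: "q \<in> ord_ge b \<Longrightarrow> p * q \<in> ord_ge b"
  using ord_ge_mult[of p 0 q b] by simp
lemma ord_ge_mult_right: "p \<in> ord_ge b \<Longrightarrow> p * q \<in> ord_ge b"
  using ord_ge_mult_left[of p b q] by (simp add: mult.commute)

text \<open>The nonconstant part of \<open>p\<close> raises the order of \<open>q\<close>, so only the constant term of \<open>p\<close> contributes.\<close>

lemma lookup_mult_lowest:
  assumes "q \<in> ord_ge a" "mdeg m = a"
  shows "Poly_Mapping.lookup (p * q) m = Poly_Mapping.lookup p 0 * Poly_Mapping.lookup q m"
proof -
  let ?c = "Poly_Mapping.single 0 (Poly_Mapping.lookup p 0)"
  have "p - ?c \<in> ord_ge 1" by (auto simp: ord_ge_def lookup_minus)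
  then have "(p - ?c) * q \<in> ord_ge (1 + a)" using assms(1) by (rule ord_ge_mult)
  then have "Poly_Mapping.lookup ((p - ?c) * q) m = 0" using assms(2) by (intro ord_geD) auto
  then have "Poly_Mapping.lookup (p * q) m = Poly_Mapping.lookup (?c * q) m"
    by (simp add: algebra_simps lookup_minus)
  also have "?c * q = Poly_Mapping.map ((*) (Poly_Mapping.lookup p 0)) q"
    by (simp add: mult_map_scale_conv_mult)
  finally show ?thesis by (simp add: Poly_Mapping.map.rep_eq when_def)
qed

lemma lookup_0_mult: "Poly_Mapping.lookup (p * q) 0
    = Poly_Mapping.lookup p 0 * Poly_Mapping.lookup (q::'k::field mpoly) 0"
  by (rule lookup_mult_lowest[of q 0]) simp_all

lemma lookup_single_0_mult [simp]:
  "Poly_Mapping.lookup (Poly_Mapping.single 0 c * (p::'k::field mpoly)) m = c * Poly_Mapping.lookup p m"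
proof -
  have "Poly_Mapping.single 0 c * p = Poly_Mapping.map ((*) c) p"
    by (simp add: mult_map_scale_conv_mult)
  then show ?thesis by (simp add: Poly_Mapping.map.rep_eq when_def)
qed

lemma ord_ge_1_iff: "p \<in> ord_ge (Suc 0) \<longleftrightarrow> Poly_Mapping.lookup p 0 = 0"
  by (auto simp: ord_ge_def)

lemma ord_ge_Suc_iff: "p \<in> ord_ge (Suc a) \<longleftrightarrow> p \<in> ord_ge a \<and> (\<forall>m. mdeg m = a \<longrightarrow> Poly_Mapping.lookup p m = 0)"
  by (auto simp: ord_ge_def less_Suc_eq)

lemma polys_add: "p \<in> polys d \<Longrightarrow> q \<in> polys d \<Longrightarrow> p + q \<in> polys d"
  using Poly_Mapping.keys_add[of p q] by (auto simp: polys_def)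
lemma polys_uminus: "p \<in> polys d \<Longrightarrow> - p \<in> polys d" by (auto simp: polys_def in_keys_iff)
lemma polys_diff: "p \<in> polys d \<Longrightarrow> q \<in> polys d \<Longrightarrow> p - q \<in> polys d"
  using polys_add[of p d "- q"] polys_uminus by auto
lemma zero_polys [simp]: "0 \<in> polys d" by (simp add: polys_def)
lemma one_polys [simp]: "1 \<in> polys d" by (simp add: polys_def)
lemma polys_sum: "(\<And>i. i \<in> S \<Longrightarrow> f i \<in> polys d) \<Longrightarrow> sum f S \<in> polys d"
  by (induction S rule: infinite_finite_induct) (auto intro: polys_add)
lemma polys_mult: "p \<in> polys d \<Longrightarrow> q \<in> polys d \<Longrightarrow> p * q \<in> polys d"
proof -
  assume pq: "p \<in> polys d" "q \<in> polys d"
  show ?thesis unfolding polys_def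
  proof (clarify)
    fix m i assume m: "m \<in> Poly_Mapping.keys (p * q)" and i: "i \<in> Poly_Mapping.keys m"
    obtain a b where "m = a + b" "a \<in> Poly_Mapping.keys p" "b \<in> Poly_Mapping.keys q"
      using keys_mult[of p q] m by blast
    then show "i < d" using pq i Poly_Mapping.keys_add[of a b] by (fastforce simp: polys_def)
  qed
qed
lemma single_polys: "Poly_Mapping.keys m \<subseteq> {..<d} \<Longrightarrow> Poly_Mapping.single m c \<in> polys d"
  by (simp add: polys_def)

definition monoms :: "nat \<Rightarrow> nat \<Rightarrow> (nat \<Rightarrow>\<^sub>0 nat) set" where
  "monoms d a = {m. Poly_Mapping.keys m \<subseteq> {..<d} \<and> mdeg m = a}"

lemma polys_lookup_zero: "p \<in> polys d \<Longrightarrow> mdeg m = a \<Longrightarrow> m \<notin> monoms d a \<Longrightarrow> Poly_Mapping.lookup p m = 0"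
  by (auto simp: polys_def monoms_def in_keys_iff)

lemma finite_monoms: "finite (monoms d a)"
proof -
  let ?S = "{f::nat \<Rightarrow> nat. \<forall>i. (i \<in> {..<d} \<longrightarrow> f i \<in> {..a}) \<and> (i \<notin> {..<d} \<longrightarrow> f i = 0)}"
  have "Poly_Mapping.lookup ` monoms d a \<subseteq> ?S"
  proof (clarsimp simp: monoms_def, intro conjI impI)
    fix m :: "nat \<Rightarrow>\<^sub>0 nat" and i assume m: "Poly_Mapping.keys m \<subseteq> {..<d}"
    show "Poly_Mapping.lookup m i \<le> mdeg m" if "i < d"
    proof -
      have "Poly_Mapping.lookup m i \<le> (\<Sum>i<d. Poly_Mapping.lookup m i)"
        using that by (intro member_le_sum) auto
      then show ?thesis using mdeg_superset[of "{..<d}" m] m by simp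
    qed
    show "Poly_Mapping.lookup m i = 0" if "\<not> i < d" using that m by (auto simp: in_keys_iff)
  qed
  moreover have "finite ?S" by (rule finite_set_of_finite_funs) auto
  moreover have "inj_on Poly_Mapping.lookup (monoms d a)" by (rule inj_onI) (simp add: poly_mapping_eqI)
  ultimately show ?thesis using finite_imageD finite_subset by blast
qed

text \<open>Multiplication by \<open>x\<^sub>0\<close> embeds the monomials of degree \<open>a\<close> and misses the pure powers of the other variables.\<close>

lemma card_monoms_Suc:
  assumes "d > 0"
  shows "card (monoms d a) + (d - 1) \<le> card (monoms d (Suc a))"
proof -
  let ?X = "(\<lambda>m. Poly_Mapping.single 0 1 + m) ` monoms d a"
  let ?Y = "(\<lambda>j. Poly_Mapping.single j (Suc a)) ` {1..<d}"
  have "?X \<subseteq> monoms d (Suc a)"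
  proof (clarify)
    fix m assume m: "m \<in> monoms d a"
    show "Poly_Mapping.single 0 1 + m \<in> monoms d (Suc a)"
      using assms m Poly_Mapping.keys_add[of "Poly_Mapping.single 0 (1::nat)" m]
      by (auto simp: monoms_def mdeg_add split: if_splits)
  qed
  moreover have "?Y \<subseteq> monoms d (Suc a)" by (auto simp: monoms_def)
  moreover have "?X \<inter> ?Y = {}"
  proof (rule ccontr)
    assume "\<not> ?thesis"
    then obtain m j where mj: "Poly_Mapping.single 0 1 + m = Poly_Mapping.single j (Suc a)" "j \<in> {1..<d}"
      by blast
    have "Poly_Mapping.lookup (Poly_Mapping.single 0 1 + m) 0 = 0"
      unfolding mj(1) using mj(2) by (simp add: lookup_single when_def)
    then show False by (simp add: lookup_add)
  qed
  moreover have "card ?X = card (monoms d a)" by (intro card_image inj_onI) simp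
  moreover have "card ?Y = d - 1"
    by (subst card_image) (auto intro!: inj_onI simp: poly_mapping_eq_iff fun_eq_iff lookup_single when_def split: if_splits)
  ultimately show ?thesis
    using finite_monoms[of d "Suc a"] card_mono[of "monoms d (Suc a)" "?X \<union> ?Y"]
      card_Un_disjoint[of ?X ?Y] finite_monoms[of d a] by simp
qed

definition trunc :: "nat \<Rightarrow> 'k::field mpoly \<Rightarrow> 'k mpoly" where
  "trunc t p = (\<Sum>m\<in>Poly_Mapping.keys p. if mdeg m < t then Poly_Mapping.single m (Poly_Mapping.lookup p m) else 0)"

lemma lookup_trunc: "Poly_Mapping.lookup (trunc t p) m = (if mdeg m < t then Poly_Mapping.lookup p m else 0)"
proof -
  have "Poly_Mapping.lookup (trunc t p) m = (\<Sum>x\<in>Poly_Mapping.keys p.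
      if x = m then (if mdeg m < t then Poly_Mapping.lookup p m else 0) else 0)"
    unfolding trunc_def lookup_sum by (rule sum.cong) (auto simp: lookup_single when_def)
  then show ?thesis by (auto simp: in_keys_iff)
qed

lemma trunc_diff: "p - trunc t p \<in> ord_ge t" "trunc t p - p \<in> ord_ge t"
  by (auto simp: ord_ge_def lookup_minus lookup_trunc)

lemma trunc_polys: "p \<in> polys d \<Longrightarrow> trunc t p \<in> polys d"
  by (auto simp: polys_def in_keys_iff lookup_trunc split: if_splits)

lemma trunc_eq_0_iff: "trunc t p = 0 \<longleftrightarrow> p \<in> ord_ge t"
  by (auto simp: ord_ge_def poly_mapping_eq_iff fun_eq_iff lookup_trunc)

section \<open>Matrices and vectors of polynomials\<close>

lemma sum_fun_apply: "(\<Sum>i\<in>S. f i) x = (\<Sum>i\<in>S. f i x)"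
  by (induction S rule: infinite_finite_induct) auto

interpretation fv: vector_space "\<lambda>(c::'k::field) (f::'i \<Rightarrow> 'k) i. c * f i"
  by unfold_locales (auto simp: fun_eq_iff algebra_simps)

interpretation pv: vector_space "\<lambda>(c::'k::field) (v::'i \<Rightarrow> 'k mpoly) i. Poly_Mapping.single 0 c * v i"
  by unfold_locales (auto simp: fun_eq_iff algebra_simps single_add mult_single[symmetric] mult.assoc[symmetric] mult_single)

text \<open>Vectors and matrices are functions on all of \<open>nat\<close>, with zeros beyond their size, because the
  ranks in a resolution vary inside a single type. The number \<open>m\<close> of columns is an argument of the product.\<close>

definition mv :: "nat \<Rightarrow> (nat \<Rightarrow> nat \<Rightarrow> 'a::comm_ring_1) \<Rightarrow> (nat \<Rightarrow> 'a) \<Rightarrow> nat \<Rightarrow> 'a" where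
  "mv m A v = (\<lambda>j. \<Sum>l<m. A j l * v l)"

definition cf :: "(nat \<Rightarrow>\<^sub>0 nat) \<Rightarrow> ('i \<Rightarrow> 'k::field mpoly) \<Rightarrow> 'i \<Rightarrow> 'k" where
  "cf m v = (\<lambda>i. Poly_Mapping.lookup (v i) m)"

text \<open>The reduction of a matrix modulo \<open>\<nn>\<close>.\<close>

definition cmat :: "(nat \<Rightarrow> nat \<Rightarrow> 'k::field mpoly) \<Rightarrow> nat \<Rightarrow> nat \<Rightarrow> 'k" where
  "cmat A = (\<lambda>j l. Poly_Mapping.lookup (A j l) 0)"

definition cvec :: "(nat \<Rightarrow> 'k::field) \<Rightarrow> nat \<Rightarrow> 'k mpoly" where
  "cvec c = (\<lambda>j. Poly_Mapping.single 0 (c j))"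

definition kvec :: "nat \<Rightarrow> (nat \<Rightarrow> 'k::field) set" where
  "kvec b = {c. \<forall>j\<ge>b. c j = 0}"

definition pvec :: "nat \<Rightarrow> nat \<Rightarrow> (nat \<Rightarrow> 'k::field mpoly) set" where
  "pvec d b = {v. (\<forall>j. v j \<in> polys d) \<and> (\<forall>j\<ge>b. v j = 0)}"

definition pmat :: "nat \<Rightarrow> nat \<Rightarrow> (nat \<Rightarrow> nat \<Rightarrow> 'k::field mpoly) set" where
  "pmat d b = {A. \<forall>l. (\<lambda>j. A j l) \<in> pvec d b}"

definition ordv :: "nat \<Rightarrow> (nat \<Rightarrow> 'k::field mpoly) set" where
  "ordv a = {v. \<forall>j. v j \<in> ord_ge a}"

abbreviation pscale :: "'k::field mpoly \<Rightarrow> (nat \<Rightarrow> 'k mpoly) \<Rightarrow> nat \<Rightarrow> 'k mpoly" where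
  "pscale p v \<equiv> \<lambda>j. p * v j"

lemma mv_add: "mv m A (u + v) = mv m A u + mv m A v"
  by (auto simp: mv_def fun_eq_iff algebra_simps sum.distrib)
lemma mv_diff: "mv m A (u - v) = mv m A u - mv m A v"
  by (auto simp: mv_def fun_eq_iff algebra_simps sum_subtractf)
lemma mv_scale: "mv m A (\<lambda>j. p * v j) = (\<lambda>j. p * mv m A v j)"
  by (auto simp: mv_def fun_eq_iff algebra_simps sum_distrib_left)
lemma mv_zero [simp]: "mv m A 0 = 0" by (auto simp: mv_def fun_eq_iff)
lemma mv_sum: "mv m A (\<Sum>i\<in>S. f i) = (\<Sum>i\<in>S. mv m A (f i))"
  by (auto simp: mv_def fun_eq_iff sum_fun_apply sum_distrib_left intro: sum.swap)
lemma mv_mv: "mv m A (mv n B v) = mv n (\<lambda>j l. \<Sum>i<m. A j i * B i l) v"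
  by (auto simp: mv_def fun_eq_iff sum_distrib_left sum_distrib_right mult.assoc intro: sum.swap)

lemma ordv_mono: "a \<le> b \<Longrightarrow> v \<in> ordv b \<Longrightarrow> v \<in> ordv a"
  by (auto simp: ordv_def intro: ord_ge_antimono)
lemma ordv_0 [simp]: "ordv 0 = UNIV" by (auto simp: ordv_def)
lemma zero_ordv [simp]: "0 \<in> ordv a" by (auto simp: ordv_def)
lemma ordv_add: "u \<in> ordv a \<Longrightarrow> v \<in> ordv a \<Longrightarrow> u + v \<in> ordv a"
  by (auto simp: ordv_def intro: ord_ge_add)
lemma ordv_diff: "u \<in> ordv a \<Longrightarrow> v \<in> ordv a \<Longrightarrow> u - v \<in> ordv a"
  by (auto simp: ordv_def intro: ord_ge_diff)
lemma ordv_sum: "(\<And>i. i \<in> S \<Longrightarrow> f i \<in> ordv a) \<Longrightarrow> sum f S \<in> ordv a"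
  by (induction S rule: infinite_finite_induct) (auto intro: ordv_add)
lemma ordv_pscale: "p \<in> ord_ge a \<Longrightarrow> v \<in> ordv b \<Longrightarrow> pscale p v \<in> ordv (a + b)"
  by (auto simp: ordv_def intro: ord_ge_mult)
lemma ordv_pscale': "v \<in> ordv b \<Longrightarrow> pscale p v \<in> ordv b"
  using ordv_pscale[of p 0 v b] by simp
lemma ordv_pscale'': "p \<in> ord_ge b \<Longrightarrow> pscale p v \<in> ordv b"
  using ordv_pscale[of p b v 0] by simp
lemma ordv_mv: "v \<in> ordv a \<Longrightarrow> mv m A v \<in> ordv a"
  by (auto simp: ordv_def mv_def intro!: ord_ge_sum ord_ge_mult_left)

lemma pvec_add: "u \<in> pvec d b \<Longrightarrow> v \<in> pvec d b \<Longrightarrow> u + v \<in> pvec d b"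
  by (auto simp: pvec_def intro: polys_add)
lemma pvec_diff: "u \<in> pvec d b \<Longrightarrow> v \<in> pvec d b \<Longrightarrow> u - v \<in> pvec d b"
  by (auto simp: pvec_def intro: polys_diff)
lemma zero_pvec [simp]: "0 \<in> pvec d b" by (auto simp: pvec_def)
lemma pvec_sum: "(\<And>i. i \<in> S \<Longrightarrow> f i \<in> pvec d b) \<Longrightarrow> sum f S \<in> pvec d b"
  by (induction S rule: infinite_finite_induct) (auto intro: pvec_add)
lemma pvec_pscale: "p \<in> polys d \<Longrightarrow> v \<in> pvec d b \<Longrightarrow> pscale p v \<in> pvec d b"
  by (auto simp: pvec_def intro: polys_mult)
lemma pvec_mv: "A \<in> pmat d b \<Longrightarrow> v \<in> pvec d m \<Longrightarrow> mv m A v \<in> pvec d b"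
  by (auto simp: pvec_def pmat_def mv_def intro!: polys_sum polys_mult)
lemma pvec_cvec: "c \<in> kvec b \<Longrightarrow> cvec c \<in> pvec d b"
  by (auto simp: pvec_def kvec_def cvec_def intro!: single_polys)
lemma kvec_cf: "v \<in> pvec d b \<Longrightarrow> cf m v \<in> kvec b"
  by (auto simp: pvec_def kvec_def cf_def)
lemma cf_cvec [simp]: "cf 0 (cvec c) = c" by (auto simp: cf_def cvec_def)
lemma cf_add: "cf m (u + v) = cf m u + cf m v" by (auto simp: cf_def fun_eq_iff lookup_add)
lemma cf_diff: "cf m (u - v) = cf m u - cf m v" by (auto simp: cf_def fun_eq_iff lookup_minus)
lemma cf_sum: "cf m (\<Sum>i\<in>S. f i) = (\<Sum>i\<in>S. cf m (f i))"
  by (auto simp: cf_def fun_eq_iff sum_fun_apply lookup_sum)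
lemma kvec_mv: "A \<in> pmat d b \<Longrightarrow> mv m (cmat A) c \<in> kvec b"
  by (auto simp: kvec_def pmat_def pvec_def mv_def cmat_def)

lemma cf_mv:
  assumes "v \<in> ordv (mdeg m)"
  shows "cf m (mv n A v) = mv n (cmat A) (cf m v)"
  using assms by (auto simp: cf_def mv_def cmat_def fun_eq_iff lookup_sum ordv_def intro!: sum.cong lookup_mult_lowest)

lemma cf_pscale:
  assumes "v \<in> ordv (mdeg m)"
  shows "cf m (pscale p v) = (\<lambda>j. Poly_Mapping.lookup p 0 * cf m v j)"
  using assms by (auto simp: cf_def fun_eq_iff ordv_def intro!: lookup_mult_lowest)

lemma cf_pscale':
  assumes "p \<in> ord_ge (mdeg m)"
  shows "cf m (pscale p v) = (\<lambda>j. Poly_Mapping.lookup p m * cf 0 v j)"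
proof
  fix i show "cf m (pscale p v) i = Poly_Mapping.lookup p m * cf 0 v i"
    using lookup_mult_lowest[OF assms refl, of "v i"] by (simp add: cf_def mult.commute)
qed

lemma cf_ordv: "v \<in> ordv a \<Longrightarrow> mdeg m < a \<Longrightarrow> cf m v = 0"
  by (auto simp: cf_def ordv_def fun_eq_iff intro: ord_geD)

lemma ordv_Suc_iff: "v \<in> ordv (Suc a) \<longleftrightarrow> v \<in> ordv a \<and> (\<forall>m. mdeg m = a \<longrightarrow> cf m v = 0)"
  by (auto simp: ordv_def ord_ge_Suc_iff cf_def fun_eq_iff)

lemma ordv_1_iff: "v \<in> ordv (Suc 0) \<longleftrightarrow> cf 0 v = 0"
  by (auto simp: ordv_def ord_ge_1_iff cf_def fun_eq_iff)

lemma ordv_Suc_pvecI: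
  assumes "v \<in> pvec d b" "v \<in> ordv a" "\<And>m. m \<in> monoms d a \<Longrightarrow> cf m v = 0"
  shows "v \<in> ordv (Suc a)"
  unfolding ordv_Suc_iff
proof (intro conjI allI impI assms(2))
  fix m :: "nat \<Rightarrow>\<^sub>0 nat" assume "mdeg m = a"
  then show "cf m v = 0" using assms polys_lookup_zero[of _ d m a]
    by (cases "m \<in> monoms d a") (auto simp: cf_def pvec_def fun_eq_iff)
qed

text \<open>Kernel and image of the differential that \<open>A\<close> induces on \<open>k \<otimes> F\<close>.\<close>

definition ker_k :: "nat \<Rightarrow> (nat \<Rightarrow> nat \<Rightarrow> 'k::field mpoly) \<Rightarrow> (nat \<Rightarrow> 'k) set" where
  "ker_k m A = {c \<in> kvec m. mv m (cmat A) c = 0}"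

definition im_k :: "nat \<Rightarrow> (nat \<Rightarrow> nat \<Rightarrow> 'k::field mpoly) \<Rightarrow> (nat \<Rightarrow> 'k) set" where
  "im_k m A = mv m (cmat A) ` kvec m"

lemma subspace_kvec: "fv.subspace (kvec b)"
  by (auto simp: fv.subspace_def kvec_def)


lemma subspace_im_k: "fv.subspace (im_k m A)"
  unfolding im_k_def fv.subspace_def
proof (intro conjI ballI allI)
  show "0 \<in> mv m (cmat A) ` kvec m" by (rule image_eqI[of _ _ 0]) (auto simp: kvec_def)
next
  fix x y assume "x \<in> mv m (cmat A) ` kvec m" "y \<in> mv m (cmat A) ` kvec m"
  then obtain a b where "x = mv m (cmat A) a" "y = mv m (cmat A) b" "a \<in> kvec m" "b \<in> kvec m" by auto
  then show "x + y \<in> mv m (cmat A) ` kvec m"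
    by (intro image_eqI[of _ _ "a + b"]) (auto simp: mv_add kvec_def)
next
  fix c x assume "x \<in> mv m (cmat A) ` kvec m"
  then obtain a where "x = mv m (cmat A) a" "a \<in> kvec m" by auto
  then show "(\<lambda>i. c * x i) \<in> mv m (cmat A) ` kvec m"
    by (intro image_eqI[of _ _ "\<lambda>i. c * a i"]) (auto simp: mv_scale kvec_def)
qed

lemma subspace_ker_k: "fv.subspace (ker_k m A)"
  unfolding ker_k_def fv.subspace_def
  by (auto simp: mv_add mv_scale kvec_def)

definition unitv :: "nat \<Rightarrow> nat \<Rightarrow> 'a::zero_neq_one" where
  "unitv l = (\<lambda>j. if j = l then 1 else 0)"

lemma kvec_eq_sum_unitv: "c \<in> kvec b \<Longrightarrow> c = (\<Sum>l<b. (\<lambda>j. c l * unitv l j))"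
proof
  fix j assume "c \<in> kvec b"
  moreover have "(\<Sum>l<b. (\<lambda>j. c l * unitv l j)) j = (\<Sum>l<b. if l = j then c j else 0)"
    unfolding sum_fun_apply by (intro sum.cong) (auto simp: unitv_def)
  ultimately show "c j = (\<Sum>l<b. (\<lambda>j. c l * unitv l j)) j" by (auto simp: kvec_def)
qed

lemma kvec_subset_span: "(kvec b :: (nat \<Rightarrow> 'k::field) set) \<subseteq> fv.span (unitv ` {..<b})"
proof
  fix c :: "nat \<Rightarrow> 'k::field" assume "c \<in> kvec b"
  then have "c = (\<Sum>l<b. (\<lambda>j. c l * unitv l j))" by (rule kvec_eq_sum_unitv)
  also have "\<dots> \<in> fv.span (unitv ` {..<b})"
    by (intro fv.span_sum fv.span_scale fv.span_base) auto
  finally show "c \<in> fv.span (unitv ` {..<b})" .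
qed

section \<open>Exact sequences over the truncated ring\<close>

text \<open>Exactness of \<open>R\<^sup>n \<rightarrow> R\<^sup>m \<rightarrow> R\<^sup>b\<close> in the middle, expressed over \<open>Q\<close>. The matrices are not reduced
  modulo \<open>\<nn>\<^sup>t\<close>, because their products have parts of degree \<open>t\<close> that are needed below.\<close>

definition exact_mod :: "nat \<Rightarrow> nat \<Rightarrow> nat \<Rightarrow> (nat \<Rightarrow> nat \<Rightarrow> 'k::field mpoly) \<Rightarrow> nat \<Rightarrow> (nat \<Rightarrow> nat \<Rightarrow> 'k mpoly) \<Rightarrow> bool" where
  "exact_mod t d m A n B \<longleftrightarrow> (\<forall>v\<in>pvec d m. mv m A v \<in> ordv t \<longleftrightarrow> (\<exists>u\<in>pvec d n. v - mv n B u \<in> ordv t))"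

lemma exact_mod_complex:
  assumes "exact_mod t d m A n B" "B \<in> pmat d m" "u \<in> pvec d n"
  shows "mv m A (mv n B u) \<in> ordv t"
proof -
  have "mv n B u - mv n B u \<in> ordv t" by simp
  then show ?thesis using assms pvec_mv[of B d m u n] unfolding exact_mod_def by blast
qed

lemma exact_mod_lift:
  assumes "exact_mod t d m A n B" "v \<in> pvec d m" "mv m A v \<in> ordv t"
  obtains u where "u \<in> pvec d n" "v - mv n B u \<in> ordv t"
  using assms unfolding exact_mod_def by blast

lemma cf0_mv: "cf 0 (mv n A v) = mv n (cmat A) (cf 0 v)"
  by (rule cf_mv) simp

lemma im_k_subset_ker_k:
  assumes "exact_mod t d m A n B" "B \<in> pmat d m" "t > 0"
  shows "im_k n B \<subseteq> ker_k m A"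
  unfolding im_k_def ker_k_def
proof clarify
  fix c :: "nat \<Rightarrow> 'a" assume c: "c \<in> kvec n"
  have "mv m A (mv n B (cvec c)) \<in> ordv t" using exact_mod_complex[OF assms(1,2) pvec_cvec[OF c]] .
  then have "cf 0 (mv m A (mv n B (cvec c))) = 0" using assms(3) by (intro cf_ordv) auto
  then show "mv n (cmat B) c \<in> kvec m \<and> mv m (cmat A) (mv n (cmat B) c) = 0"
    using kvec_mv[OF assms(2)] by (simp add: cf0_mv)
qed

lemma ker_k_subset_kvec: "ker_k m A \<subseteq> kvec m" by (auto simp: ker_k_def)

lemma ker_k_span: "ker_k m A \<subseteq> fv.span (unitv ` {..<m})"
  using ker_k_subset_kvec kvec_subset_span by blast

lemma cf_im_k:
  assumes "v \<in> ordv (mdeg m)" "v \<in> pvec d n"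
  shows "cf m (mv n A v) \<in> im_k n A"
  using assms by (auto simp: cf_mv im_k_def intro: kvec_cf)

lemma mv_single_vec: "l < n \<Longrightarrow> mv n A (\<lambda>j. if j = l then 1 else 0) = (\<lambda>j. A j l)"
  by (auto simp: mv_def fun_eq_iff if_distrib[of "\<lambda>x. _ * x"] cong: if_cong)

text \<open>When \<open>A B\<close> vanishes modulo \<open>\<nn>\<^sup>t\<close>, all its entries have order at least \<open>t\<close>. Its part of
  degree \<open>t\<close> therefore sees only the constant terms of the vector that it is applied to.\<close>

lemma product_lowest:
  assumes "\<And>u. u \<in> pvec d n \<Longrightarrow> mv m A (mv n B u) \<in> ordv t"
  obtains C where "\<And>\<nu> u. mdeg \<nu> = t \<Longrightarrow> cf \<nu> (mv m A (mv n B u)) = mv n (C \<nu>) (cf 0 u)"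
proof
  let ?P = "\<lambda>j l. \<Sum>i<m. A j i * B i l"
  fix \<nu> u assume \<nu>: "mdeg \<nu> = t"
  have P: "?P j l \<in> ord_ge t" if "l < n" for j l
  proof -
    have "(\<lambda>j. if j = l then 1 else 0) \<in> pvec d n" using that by (auto simp: pvec_def)
    from assms[OF this] have "mv n ?P (\<lambda>j. if j = l then 1 else 0) \<in> ordv t" by (simp add: mv_mv)
    then show ?thesis unfolding mv_single_vec[OF that] ordv_def by blast
  qed
  show "cf \<nu> (mv m A (mv n B u)) = mv n ((\<lambda>\<nu> j l. Poly_Mapping.lookup (?P j l) \<nu>) \<nu>) (cf 0 u)"
  proof
    fix j
    have "Poly_Mapping.lookup (?P j l * u l) \<nu> = Poly_Mapping.lookup (?P j l) \<nu> * Poly_Mapping.lookup (u l) 0"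
      if "l < n" for l
      using lookup_mult_lowest[OF P[OF that] \<nu>, of "u l" j] by (simp add: mult.commute)
    then show "cf \<nu> (mv m A (mv n B u)) j = mv n (\<lambda>j l. Poly_Mapping.lookup (?P j l) \<nu>) (cf 0 u) j"
      unfolding mv_mv by (simp add: mv_def cf_def lookup_sum)
  qed
qed

text \<open>Write \<open>\<mu> = x \<mu>'\<close> with a variable \<open>x\<close>. Since \<open>z\<close> is a cycle modulo \<open>\<nn>\<close>, the vector \<open>\<mu>' z\<close> is mapped into
  \<open>\<nn>\<^sup>t\<close>, so \<open>\<mu>' z = A1 y\<close> modulo \<open>\<nn>\<^sup>t\<close>. Now \<open>A1 (x y)\<close> agrees with \<open>\<mu> z\<close> up to order \<open>t + 1\<close>; in particular
  it vanishes over \<open>R\<close>, so \<open>x y = A0 u\<close> modulo \<open>\<nn>\<^sup>t\<close>. Undoing this replacement changes the part of degree \<open>t\<close>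
  of \<open>A1 A0 u\<close> only by the image of constant vectors under \<open>A1\<close>, and \<open>A0 u\<close> has no constant term because \<open>x y\<close> has none.\<close>

lemma second_step_lift:
  fixes A2 A1 A0 :: "nat \<Rightarrow> nat \<Rightarrow> 'k::field mpoly"
  assumes M: "A1 \<in> pmat d b" "A0 \<in> pmat d m"
    and ex: "exact_mod t d b A2 m A1" "exact_mod t d m A1 n A0"
    and t: "t > 0" and z: "z \<in> ker_k b A2" and \<mu>: "\<mu> \<in> monoms d t"
  obtains u where "u \<in> pvec d n" "mv n A0 u \<in> ordv 1"
    "\<And>\<nu>. mdeg \<nu> = t \<Longrightarrow> cf \<nu> (mv m A1 (mv n A0 u)) - (if \<nu> = \<mu> then z else 0) \<in> im_k m A1"
proof -
  have "\<mu> \<noteq> 0" using \<mu> t by (auto simp: monoms_def)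
  then obtain l where l: "l \<in> Poly_Mapping.keys \<mu>" by (metis all_not_in_conv keys_eq_empty)
  then have ld: "l < d" using \<mu> by (auto simp: monoms_def)
  define s where "s = Poly_Mapping.single l (1::nat)"
  define \<mu>' where "\<mu>' = \<mu> - s"
  have \<mu>_eq: "\<mu> = s + \<mu>'"
    using l by (intro poly_mapping_eqI)
      (auto simp: \<mu>'_def s_def lookup_add lookup_minus lookup_single when_def in_keys_iff)
  have deg\<mu>': "mdeg \<mu>' = t - 1" using \<mu> by (auto simp: monoms_def \<mu>_eq mdeg_add s_def)
  have k\<mu>': "Poly_Mapping.keys \<mu>' \<subseteq> {..<d}"
    using \<mu> unfolding monoms_def \<mu>'_def subset_iff in_keys_iff lookup_minus by force
  have zk: "z \<in> kvec b" "mv b (cmat A2) z = 0" using z by (auto simp: ker_k_def)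
  let ?x = "Poly_Mapping.single s (1::'k)"
  let ?w = "Poly_Mapping.single \<mu>' (1::'k)"
  have xp: "?x \<in> polys d" using ld by (auto intro!: single_polys simp: s_def)
  have xo: "?x \<in> ord_ge 1" by (rule ord_ge_single) (simp add: s_def)
  have wp: "?w \<in> polys d" using k\<mu>' by (rule single_polys)
  have wo: "?w \<in> ord_ge (t - 1)" by (rule ord_ge_single) (simp add: deg\<mu>')
  have "mv b A2 (cvec z) \<in> ordv 1" using zk by (simp add: ordv_1_iff cf0_mv)
  then have "mv b A2 (pscale ?w (cvec z)) \<in> ordv ((t - 1) + 1)"
    unfolding mv_scale by (rule ordv_pscale[OF wo])
  then have "mv b A2 (pscale ?w (cvec z)) \<in> ordv t" using t by simp
  then obtain y where y: "y \<in> pvec d m" "pscale ?w (cvec z) - mv m A1 y \<in> ordv t"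
    using exact_mod_lift[OF ex(1) pvec_pscale[OF wp pvec_cvec[OF zk(1)]]] by blast
  define p where "p = pscale ?w (cvec z) - mv m A1 y"
  have xwz: "pscale ?x (pscale ?w (cvec z)) = pscale (Poly_Mapping.single \<mu> 1) (cvec z)"
    by (simp add: fun_eq_iff mult.assoc[symmetric] mult_single \<mu>_eq)
  have e1: "mv m A1 (pscale ?x y) = pscale (Poly_Mapping.single \<mu> 1) (cvec z) - pscale ?x p"
    unfolding mv_scale xwz[symmetric] by (auto simp: fun_eq_iff p_def algebra_simps)
  have xp1: "pscale ?x p \<in> ordv (1 + t)" using y unfolding p_def by (intro ordv_pscale xo)
  have "pscale (Poly_Mapping.single \<mu> 1) (cvec z) \<in> ordv t"
    by (rule ordv_pscale'', rule ord_ge_single) (use \<mu> in \<open>simp add: monoms_def\<close>)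
  then have "mv m A1 (pscale ?x y) \<in> ordv t"
    unfolding e1 using xp1 by (intro ordv_diff) (auto intro: ordv_mono[of t "1 + t"])
  then obtain u where u: "u \<in> pvec d n" "pscale ?x y - mv n A0 u \<in> ordv t"
    using exact_mod_lift[OF ex(2) pvec_pscale[OF xp y(1)]] by blast
  define q where "q = pscale ?x y - mv n A0 u"
  have qp: "q \<in> pvec d m" unfolding q_def using y(1) u(1) M xp by (intro pvec_diff pvec_pscale pvec_mv)
  have A0u: "mv n A0 u = pscale ?x y - q" by (simp add: q_def)
  have "mv n A0 u \<in> ordv 1" unfolding A0u
    using u(2) ordv_mono[of 1 t q] t by (intro ordv_diff ordv_pscale'' xo) (simp add: q_def)
  moreover have "cf \<nu> (mv m A1 (mv n A0 u)) - (if \<nu> = \<mu> then z else 0) \<in> im_k m A1" if \<nu>: "mdeg \<nu> = t" for \<nu>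
  proof -
    have "cf \<nu> (mv m A1 (mv n A0 u)) = cf \<nu> (pscale (Poly_Mapping.single \<mu> 1) (cvec z)) - cf \<nu> (pscale ?x p) - cf \<nu> (mv m A1 q)"
      unfolding A0u mv_diff e1 cf_diff ..
    also have "cf \<nu> (pscale ?x p) = 0" using xp1 \<nu> by (intro cf_ordv) auto
    also have "cf \<nu> (pscale (Poly_Mapping.single \<mu> 1) (cvec z)) = (if \<nu> = \<mu> then z else 0)"
      using \<nu> \<mu> by (subst cf_pscale') (auto simp: monoms_def fun_eq_iff lookup_single when_def intro!: ord_ge_single)
    finally have "cf \<nu> (mv m A1 (mv n A0 u)) - (if \<nu> = \<mu> then z else 0) = - cf \<nu> (mv m A1 q)"
      by (simp add: fun_eq_iff)
    moreover have "cf \<nu> (mv m A1 q) \<in> im_k m A1"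
      using u(2) qp \<nu> by (intro cf_im_k[of _ _ d]) (auto simp: q_def)
    ultimately show ?thesis using fv.subspace_neg[OF subspace_im_k] by metis
  qed
  ultimately show ?thesis by (rule that[OF u(1)])
qed

text \<open>The cycles supplied by the preceding lemma, one for each monomial of degree \<open>t\<close> and each basis
  element \<open>z\<close> of the homology at \<open>A2\<close>, are independent modulo boundaries: on a linear combination of them
  that is a boundary, the part of degree \<open>t\<close> of \<open>A1 A0\<close> lies in the image of \<open>A1\<close>, whereas at each monomial
  it is, up to that image, the corresponding combination of the \<open>z\<close>.\<close>

lemma betti_growth_lower:
  fixes A2 A1 A0 A' :: "nat \<Rightarrow> nat \<Rightarrow> 'k::field mpoly"
  assumes M: "A1 \<in> pmat d b" "A0 \<in> pmat d m" "A' \<in> pmat d n"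
    and ex: "exact_mod t d b A2 m A1" "exact_mod t d m A1 n A0" "exact_mod t d n A0 p A'"
    and t: "t > 0"
  shows "card (monoms d t) * (fv.dim (ker_k b A2) - fv.dim (im_k m A1)) + fv.dim (im_k p A') \<le> fv.dim (ker_k n A0)"
proof -
  have sub: "im_k m A1 \<subseteq> ker_k b A2" using im_k_subset_ker_k[OF ex(1) M(1) t] .
  obtain W B where W: "finite W" "W \<subseteq> ker_k b A2"
      "card W + fv.dim (im_k m A1) = fv.dim (ker_k b A2)" "finite B" "B \<subseteq> im_k m A1" "fv.span B = im_k m A1"
      "B \<inter> W = {}" "fv.independent (B \<union> W)" "fv.span (B \<union> W) = ker_k b A2"
    by (rule fv.dim_eq_dim_plus_complement[OF subspace_im_k subspace_ker_k sub ker_k_span]) simp_all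
  obtain C where C: "\<And>\<nu> u. mdeg \<nu> = t \<Longrightarrow> cf \<nu> (mv m A1 (mv n A0 u)) = mv n (C \<nu>) (cf 0 u)"
    by (rule product_lowest[OF exact_mod_complex[OF ex(2) M(2)]]) simp_all
  have "\<exists>u. u \<in> pvec d n \<and> mv n A0 u \<in> ordv 1 \<and>
      (\<forall>\<nu>. mdeg \<nu> = t \<longrightarrow> cf \<nu> (mv m A1 (mv n A0 u)) - (if \<nu> = fst x then snd x else 0) \<in> im_k m A1)"
    if "x \<in> monoms d t \<times> W" for x
  proof -
    have "snd x \<in> ker_k b A2" "fst x \<in> monoms d t" using that W(2) by auto
    from M(1,2) ex(1,2) t this show ?thesis
    proof (rule second_step_lift)
      fix u
      assume "u \<in> pvec d n" "mv n A0 u \<in> ordv 1"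
        "\<And>\<nu>. mdeg \<nu> = t \<Longrightarrow> cf \<nu> (mv m A1 (mv n A0 u)) - (if \<nu> = fst x then snd x else 0) \<in> im_k m A1"
      then show ?thesis by (intro exI[of _ u] conjI allI impI)
    qed
  qed
  then have "\<forall>x\<in>monoms d t \<times> W. \<exists>u. u \<in> pvec d n \<and> mv n A0 u \<in> ordv 1 \<and>
      (\<forall>\<nu>. mdeg \<nu> = t \<longrightarrow> cf \<nu> (mv m A1 (mv n A0 u)) - (if \<nu> = fst x then snd x else 0) \<in> im_k m A1)"
    by (rule ballI)
  from bchoice[OF this] obtain u where u0: "\<forall>x\<in>monoms d t \<times> W. u x \<in> pvec d n \<and> mv n A0 (u x) \<in> ordv 1 \<and>
      (\<forall>\<nu>. mdeg \<nu> = t \<longrightarrow> cf \<nu> (mv m A1 (mv n A0 (u x))) - (if \<nu> = fst x then snd x else 0) \<in> im_k m A1)" ..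
  have u: "\<And>x. x \<in> monoms d t \<times> W \<Longrightarrow> u x \<in> pvec d n"
      "\<And>x. x \<in> monoms d t \<times> W \<Longrightarrow> mv n A0 (u x) \<in> ordv 1"
      "\<And>x \<nu>. x \<in> monoms d t \<times> W \<Longrightarrow> mdeg \<nu> = t \<Longrightarrow>
         cf \<nu> (mv m A1 (mv n A0 (u x))) - (if \<nu> = fst x then snd x else 0) \<in> im_k m A1"
    subgoal premises p for x using bspec[OF u0 p] by (elim conjE)
    subgoal premises p for x using bspec[OF u0 p] by (elim conjE)
    subgoal premises p for x \<nu> using bspec[OF u0 p(1)] p(2) by (elim conjE allE[of _ \<nu>] impE)
    done
  have "card (monoms d t \<times> W) + fv.dim (im_k p A') \<le> fv.dim (ker_k n A0)"
  proof (rule fv.card_plus_dim_le_of_independent_modulo[where w = "\<lambda>x. cf 0 (u x)", OF subspace_im_k subspace_ker_k _ ker_k_span])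
    show "im_k p A' \<subseteq> ker_k n A0" using im_k_subset_ker_k[OF ex(3) M(3) t] .
    show "finite (monoms d t \<times> W)" using W finite_monoms by blast
    show "cf 0 (u x) \<in> ker_k n A0" if "x \<in> monoms d t \<times> W" for x
      using u(1,2)[OF that] by (auto simp: ker_k_def kvec_cf ordv_1_iff cf0_mv)
    fix c assume c: "(\<Sum>x\<in>monoms d t \<times> W. (\<lambda>j. c x * cf 0 (u x) j)) \<in> im_k p A'"
    then obtain e where e: "e \<in> kvec p" "(\<Sum>x\<in>monoms d t \<times> W. (\<lambda>j. c x * cf 0 (u x) j)) = mv p (cmat A') e"
      unfolding im_k_def by blast
    show "\<forall>x\<in>monoms d t \<times> W. c x = 0"
    proof (clarify, rename_tac \<nu> z)
      fix \<nu> z assume \<nu>: "\<nu> \<in> monoms d t" and z: "z \<in> W"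
      have deg: "mdeg \<nu> = t" using \<nu> by (simp add: monoms_def)
      have A'e: "mv p A' (cvec e) \<in> pvec d n" using M(3) e(1) by (intro pvec_mv pvec_cvec)
      have "cf \<nu> (mv m A1 (mv n A0 (mv p A' (cvec e)))) \<in> im_k m A1"
        using exact_mod_complex[OF ex(3) M(3) pvec_cvec[OF e(1)]] deg
        by (intro cf_im_k[of _ _ d] pvec_mv[OF M(2)] A'e) simp
      then have 1: "mv n (C \<nu>) (mv p (cmat A') e) \<in> im_k m A1" by (simp add: C[OF deg] cf0_mv)
      have "mv n (C \<nu>) (mv p (cmat A') e)
        = (\<Sum>x\<in>monoms d t \<times> W. (\<lambda>j. c x * cf \<nu> (mv m A1 (mv n A0 (u x))) j))"
        unfolding e(2)[symmetric] by (simp add: mv_sum mv_scale C[OF deg])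
      then have 2: "(\<Sum>x\<in>monoms d t \<times> W. (\<lambda>j. c x * cf \<nu> (mv m A1 (mv n A0 (u x))) j)) \<in> im_k m A1"
        using 1 by simp
      have 3: "(\<Sum>x\<in>monoms d t \<times> W. (\<lambda>j. c x * (cf \<nu> (mv m A1 (mv n A0 (u x))) - (if \<nu> = fst x then snd x else 0)) j)) \<in> im_k m A1"
        by (intro fv.subspace_sum[OF subspace_im_k] fv.subspace_scale[OF subspace_im_k] u(3) deg)
      have "(\<Sum>x\<in>monoms d t \<times> W. (\<lambda>j. c x * cf \<nu> (mv m A1 (mv n A0 (u x))) j)) -
         (\<Sum>x\<in>monoms d t \<times> W. (\<lambda>j. c x * (cf \<nu> (mv m A1 (mv n A0 (u x))) - (if \<nu> = fst x then snd x else 0)) j))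
         = (\<Sum>x\<in>monoms d t \<times> W. (\<lambda>j. c x * (if \<nu> = fst x then snd x else 0) j))"
        unfolding sum_subtractf[symmetric] by (intro sum.cong) (auto simp: fun_eq_iff algebra_simps)
      also have "\<dots> = (\<Sum>\<mu>\<in>monoms d t. \<Sum>z\<in>W. (\<lambda>j. c (\<mu>, z) * (if \<nu> = \<mu> then z else 0) j))"
        by (subst sum.cartesian_product) (auto intro!: sum.cong)
      also have "\<dots> = (\<Sum>\<mu>\<in>monoms d t. if \<mu> = \<nu> then (\<Sum>z\<in>W. (\<lambda>j. c (\<nu>, z) * z j)) else 0)"
        by (intro sum.cong refl) (auto simp: fun_eq_iff sum_fun_apply)
      also have "\<dots> = (\<Sum>z\<in>W. (\<lambda>j. c (\<nu>, z) * z j))" using \<nu> finite_monoms by simp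
      finally have "(\<Sum>z\<in>W. (\<lambda>j. c (\<nu>, z) * z j)) \<in> im_k m A1"
        using fv.subspace_diff[OF subspace_im_k 2 3] by simp
      then have "(\<Sum>z\<in>W. (\<lambda>j. c (\<nu>, z) * z j)) \<in> fv.span B" using W by simp
      from fv.independent_modulo_span[OF W(8,7,4,1) this] z show "c (\<nu>, z) = 0" by (rule bspec)
    qed
  qed simp
  moreover have "card W = fv.dim (ker_k b A2) - fv.dim (im_k m A1)" using W(3) by simp
  ultimately show ?thesis by (simp add: card_cartesian_product)
qed

section \<open>Splitting off the part of a matrix that is invertible modulo \<open>\<nn>\<close>\<close>

text \<open>Steinitz exchange, by which a basis of \<open>U\<close> is completed with unit vectors.\<close>

lemma exists_coordinate_complement:
  fixes U :: "(nat \<Rightarrow> 'k::field) set"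
  assumes U: "fv.subspace U" "U \<subseteq> kvec b"
  obtains B J where "finite B" "B \<subseteq> U" "J \<subseteq> {..<b}"
    "\<And>c. c \<in> kvec b \<Longrightarrow> \<exists>f w. (\<forall>j. j \<notin> J \<longrightarrow> w j = 0) \<and> c = (\<Sum>x\<in>B. (\<lambda>j. f x * x j)) + w"
    "\<And>f w. \<lbrakk>\<forall>j. j \<notin> J \<longrightarrow> w j = 0; (\<Sum>x\<in>B. (\<lambda>j. f x * x j)) + w = 0\<rbrakk> \<Longrightarrow> (\<forall>x\<in>B. f x = 0) \<and> w = 0"
    "fv.span B = U"
proof -
  let ?E = "unitv ` {..<b} :: (nat \<Rightarrow> 'k) set"
  have Usp: "U \<subseteq> fv.span ?E" using U(2) kvec_subset_span by blast
  obtain B where B: "B \<subseteq> U" "finite B" "fv.independent B" "U \<subseteq> fv.span B" "card B = fv.dim U"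
    by (rule fv.finite_basis_of[OF Usp]) simp_all
  obtain C where C: "B \<subseteq> C" "C \<subseteq> B \<union> ?E" "fv.independent C" "B \<union> ?E \<subseteq> fv.span C"
    by (rule fv.maximal_independent_subset_extend[OF Un_upper1[of B ?E] B(3)]) (rule that)
  define J where "J = {j. j < b \<and> unitv j \<in> C - B}"
  have inj: "inj (unitv :: nat \<Rightarrow> nat \<Rightarrow> 'k)"
  proof (rule injI)
    fix i j assume "(unitv i :: nat \<Rightarrow> 'k) = unitv j"
    then have "(unitv i :: nat \<Rightarrow> 'k) i = unitv j i" by simp
    then show "i = j" by (simp add: unitv_def split: if_splits)
  qed
  have CB: "C - B = unitv ` J" using C(2) by (auto simp: J_def)
  have fJ: "finite J" by (simp add: J_def)
  have fC: "finite C" using C(2) B(2) finite_subset by fastforce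
  have sumC: "(\<Sum>x\<in>C. (\<lambda>j. h x * x j)) = (\<Sum>x\<in>B. (\<lambda>j. h x * x j)) + (\<lambda>j. if j \<in> J then h (unitv j) else 0)" for h
  proof -
    have "(\<Sum>x\<in>C. (\<lambda>j. h x * x j)) = (\<Sum>x\<in>B. (\<lambda>j. h x * x j)) + (\<Sum>x\<in>C - B. (\<lambda>j. h x * x j))"
      using C(1) fC by (simp add: sum.subset_diff add.commute)
    also have "(\<Sum>x\<in>C - B. (\<lambda>j. h x * x j)) = (\<Sum>i\<in>J. (\<lambda>j. h (unitv i) * unitv i j))"
      unfolding CB using inj by (subst sum.reindex) (auto intro: inj_on_subset)
    also have "\<dots> = (\<lambda>j. if j \<in> J then h (unitv j) else 0)"
      using fJ by (auto simp: fun_eq_iff sum_fun_apply unitv_def if_distrib[of "\<lambda>x. _ * x"] cong: if_cong)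
    finally show ?thesis .
  qed
  show ?thesis
  proof
    show "finite B" "B \<subseteq> U" using B by auto
    show "J \<subseteq> {..<b}" by (auto simp: J_def)
    show "fv.span B = U" using B U(1) fv.span_minimal by blast
  next
    fix c :: "nat \<Rightarrow> 'k" assume "c \<in> kvec b"
    then have "c \<in> fv.span ?E" using kvec_subset_span by blast
    also have "\<dots> \<subseteq> fv.span C" using C(4) by (intro fv.span_minimal) auto
    finally obtain h where "c = (\<Sum>x\<in>C. (\<lambda>j. h x * x j))"
      using fC fv.span_finite[of C] by auto
    then show "\<exists>f w. (\<forall>j. j \<notin> J \<longrightarrow> w j = 0) \<and> c = (\<Sum>x\<in>B. (\<lambda>j. f x * x j)) + w"
      unfolding sumC by (intro exI[of _ h] exI[of _ "\<lambda>j. if j \<in> J then h (unitv j) else 0"]) auto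
  next
    fix f w assume w: "\<forall>j. j \<notin> J \<longrightarrow> w j = (0::'k)" and z: "(\<Sum>x\<in>B. (\<lambda>j. f x * x j)) + w = 0"
    let ?h = "\<lambda>x. if x \<in> B then f x else w (inv_into UNIV unitv x)"
    have invu: "inv_into UNIV unitv (unitv j :: nat \<Rightarrow> 'k) = j" for j using inj by simp
    have nB: "j \<in> J \<Longrightarrow> unitv j \<notin> B" for j by (simp add: J_def)
    have "(\<Sum>x\<in>C. (\<lambda>j. ?h x * x j)) = (\<Sum>x\<in>B. (\<lambda>j. f x * x j)) + w"
      unfolding sumC using w by (intro arg_cong2[of _ _ _ _ "(+)"] sum.cong) (auto simp: fun_eq_iff invu nB)
    then have "\<forall>x\<in>C. ?h x = 0" using z C(3) fC fv.independentD[of C C ?h] by auto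
    then have "\<forall>x\<in>B. f x = 0" using C(1) by force
    moreover from this have "(\<Sum>x\<in>B. (\<lambda>j. f x * x j)) = 0" by (intro sum.neutral) (simp add: fun_eq_iff)
    then have "w = 0" using z by simp
    ultimately show "(\<forall>x\<in>B. f x = 0) \<and> w = 0" by blast
  qed
qed

text \<open>Modulo \<open>\<nn>\<close> the vectors \<open>A (Y x)\<close> form a basis of the image of \<open>A\<close>, and the coordinates in
  \<open>J\<close> span a complement. Both existence and uniqueness of the decomposition pass from constant terms to all
  orders one degree at a time, because in lowest degree the vectors \<open>A (Y x)\<close> act through their constant terms.\<close>

lemma exists_free_splitting:
  fixes A :: "nat \<Rightarrow> nat \<Rightarrow> 'k::field mpoly"
  assumes A: "A \<in> pmat d b"
  obtains B :: "(nat \<Rightarrow> 'k) set" and Y J where "finite B" "J \<subseteq> {..<b}" "\<And>x. x \<in> B \<Longrightarrow> Y x \<in> pvec d m"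
    "\<And>v t. v \<in> pvec d b \<Longrightarrow> \<exists>a w. (\<forall>x. a x \<in> polys d) \<and> w \<in> pvec d b \<and> (\<forall>j. j \<notin> J \<longrightarrow> w j = 0) \<and>
        v - (\<Sum>x\<in>B. pscale (a x) (mv m A (Y x))) - w \<in> ordv t"
    "\<And>a w s. \<lbrakk>\<forall>j. j \<notin> J \<longrightarrow> w j = 0; (\<Sum>x\<in>B. pscale (a x) (mv m A (Y x))) + w \<in> ordv s\<rbrakk>
        \<Longrightarrow> (\<forall>x\<in>B. a x \<in> ord_ge s) \<and> w \<in> ordv s"
    "\<And>c. c \<in> im_k m A \<Longrightarrow> (\<forall>j. j \<notin> J \<longrightarrow> c j = 0) \<Longrightarrow> c = 0"
proof -
  have "im_k m A \<subseteq> kvec b" using kvec_mv[OF A] by (auto simp: im_k_def)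
  then obtain B J where BJ: "finite B" "B \<subseteq> im_k m A" "J \<subseteq> {..<b}"
    "\<And>c. c \<in> kvec b \<Longrightarrow> \<exists>f w. (\<forall>j. j \<notin> J \<longrightarrow> w j = 0) \<and> c = (\<Sum>x\<in>B. (\<lambda>j. f x * x j)) + w"
    "\<And>f w. \<lbrakk>\<forall>j. j \<notin> J \<longrightarrow> w j = 0; (\<Sum>x\<in>B. (\<lambda>j. f x * x j)) + w = 0\<rbrakk> \<Longrightarrow> (\<forall>x\<in>B. f x = 0) \<and> w = 0"
    "fv.span B = im_k m A"
    by (rule exists_coordinate_complement[OF subspace_im_k]) (rule that)
  have "\<forall>x\<in>B. \<exists>y. y \<in> kvec m \<and> x = mv m (cmat A) y" using BJ(2) by (auto simp: im_k_def)
  from bchoice[OF this] obtain y where y': "\<forall>x\<in>B. y x \<in> kvec m \<and> x = mv m (cmat A) (y x)" ..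
  note y = y'[THEN bspec, THEN conjunct1] y'[THEN bspec, THEN conjunct2, symmetric]
  define Y where "Y x = (cvec (y x) :: nat \<Rightarrow> 'k mpoly)" for x
  have Y: "x \<in> B \<Longrightarrow> Y x \<in> pvec d m" for x using y(1) by (simp add: Y_def pvec_cvec)
  define N where "N x = mv m A (Y x)" for x
  have N: "x \<in> B \<Longrightarrow> cf 0 (N x) = x" for x by (simp add: N_def Y_def cf0_mv y)
  have Np: "x \<in> B \<Longrightarrow> N x \<in> pvec d b" for x unfolding N_def using A Y by (rule pvec_mv)
  have ex: "\<exists>a w. (\<forall>x. a x \<in> polys d) \<and> w \<in> pvec d b \<and> (\<forall>j. j \<notin> J \<longrightarrow> w j = 0) \<and>
        v - (\<Sum>x\<in>B. pscale (a x) (N x)) - w \<in> ordv t" if v: "v \<in> pvec d b" for v t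
  proof (induction t)
    case 0
    show ?case by (rule exI[of _ "\<lambda>_. 0"], rule exI[of _ 0]) (auto simp: pvec_def)
  next
    case (Suc t)
    then obtain a w where aw': "(\<forall>x. a x \<in> polys d) \<and> w \<in> pvec d b \<and> (\<forall>j. j \<notin> J \<longrightarrow> w j = 0) \<and>
        v - (\<Sum>x\<in>B. pscale (a x) (N x)) - w \<in> ordv t" by (elim exE)
    note aw = aw'[THEN conjunct1, rule_format] aw'[THEN conjunct2, THEN conjunct1]
      aw'[THEN conjunct2, THEN conjunct2, THEN conjunct1, rule_format] aw'[THEN conjunct2, THEN conjunct2, THEN conjunct2]
    define r where "r = v - (\<Sum>x\<in>B. pscale (a x) (N x)) - w"
    have rp: "r \<in> pvec d b" unfolding r_def using v aw Np by (intro pvec_diff pvec_sum pvec_pscale)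
    have "\<exists>f w. (\<forall>j. j \<notin> J \<longrightarrow> w j = 0) \<and> cf \<mu> r = (\<Sum>x\<in>B. (\<lambda>j. f x * x j)) + w" for \<mu>
      using BJ(4)[OF kvec_cf[OF rp]] .
    then have "\<forall>\<mu>. \<exists>p. (\<forall>j. j \<notin> J \<longrightarrow> snd p j = 0) \<and> cf \<mu> r = (\<Sum>x\<in>B. (\<lambda>j. fst p x * x j)) + snd p"
      by simp
    from choice[OF this] obtain p where p: "\<forall>\<mu>. (\<forall>j. j \<notin> J \<longrightarrow> snd (p \<mu>) j = 0) \<and>
        cf \<mu> r = (\<Sum>x\<in>B. (\<lambda>j. fst (p \<mu>) x * x j)) + snd (p \<mu>)" ..
    define f u where "f \<mu> = fst (p \<mu>)" and "u \<mu> = snd (p \<mu>)" for \<mu>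
    have fu: "\<And>\<mu> j. j \<notin> J \<Longrightarrow> u \<mu> j = 0"
        "\<And>\<mu>. cf \<mu> r = (\<Sum>x\<in>B. (\<lambda>j. f \<mu> x * x j)) + u \<mu>"
      unfolding f_def u_def using p by simp_all
    define a' where "a' x = (\<Sum>\<mu>\<in>monoms d t. Poly_Mapping.single \<mu> (f \<mu> x))" for x
    define w' where "w' = (\<Sum>\<mu>\<in>monoms d t. (\<lambda>j. Poly_Mapping.single \<mu> (u \<mu> j)))"
    have a'p: "a' x \<in> polys d" for x unfolding a'_def
      by (intro polys_sum single_polys) (simp add: monoms_def)
    have a'o: "a' x \<in> ord_ge t" for x unfolding a'_def
      by (intro ord_ge_sum ord_ge_single) (simp add: monoms_def)
    have w'J: "w' j = 0" if "j \<notin> J" for j unfolding w'_def sum_fun_apply using fu(1)[OF that] by simp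
    have w'p: "w' \<in> pvec d b" unfolding pvec_def
    proof (clarsimp, intro conjI allI impI)
      show "w' j \<in> polys d" for j unfolding w'_def sum_fun_apply
        by (intro polys_sum single_polys) (simp add: monoms_def)
      show "w' j = 0" if "b \<le> j" for j using w'J[of j] BJ(3) that by fastforce
    qed
    have w'o: "w' \<in> ordv t" unfolding w'_def
      by (intro ordv_sum) (auto simp: ordv_def monoms_def intro: ord_ge_single)
    let ?r = "r - (\<Sum>x\<in>B. pscale (a' x) (N x)) - w'"
    have "?r \<in> ordv (Suc t)"
    proof (rule ordv_Suc_pvecI)
      show "?r \<in> pvec d b" using rp a'p Np w'p by (intro pvec_diff pvec_sum pvec_pscale)
      show "?r \<in> ordv t" using aw(4) a'o w'o by (intro ordv_diff ordv_sum ordv_pscale'') (simp_all add: r_def)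
    next
      fix \<mu> assume \<mu>: "\<mu> \<in> monoms d t"
      have la: "Poly_Mapping.lookup (a' x) \<mu> = f \<mu> x" for x
        using \<mu> finite_monoms by (simp add: a'_def lookup_sum lookup_single when_def)
      have "cf \<mu> w' = u \<mu>"
        using \<mu> finite_monoms by (simp add: cf_def fun_eq_iff w'_def sum_fun_apply lookup_sum lookup_single when_def)
      moreover have "cf \<mu> (\<Sum>x\<in>B. pscale (a' x) (N x)) = (\<Sum>x\<in>B. (\<lambda>j. f \<mu> x * x j))"
        unfolding cf_sum using a'o \<mu> by (intro sum.cong refl) (subst cf_pscale', auto simp: monoms_def la N)
      ultimately show "cf \<mu> ?r = 0" using fu(2)[of \<mu>] by (simp add: cf_diff)
    qed
    moreover have "?r = v - (\<Sum>x\<in>B. pscale (a x + a' x) (N x)) - (w + w')"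
      unfolding r_def by (simp add: fun_eq_iff sum_fun_apply algebra_simps sum.distrib)
    ultimately have "v - (\<Sum>x\<in>B. pscale (a x + a' x) (N x)) - (w + w') \<in> ordv (Suc t)" by simp
    moreover have "\<forall>j. j \<notin> J \<longrightarrow> (w + w') j = 0" using aw(3) w'J by simp
    moreover have "\<forall>x. a x + a' x \<in> polys d" by (intro allI polys_add aw(1) a'p)
    moreover have "w + w' \<in> pvec d b" by (intro pvec_add aw(2) w'p)
    ultimately show ?case by (intro exI[of _ "\<lambda>x. a x + a' x"] exI[of _ "w + w'"] conjI)
  qed
  have un: "(\<forall>x\<in>B. a x \<in> ord_ge s) \<and> w \<in> ordv s"
    if w: "\<forall>j. j \<notin> J \<longrightarrow> w j = 0" and o: "(\<Sum>x\<in>B. pscale (a x) (N x)) + w \<in> ordv s" for a w s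
    using o
  proof (induction s)
    case (Suc s)
    then have IH: "\<And>x. x \<in> B \<Longrightarrow> a x \<in> ord_ge s" "w \<in> ordv s" using ordv_mono[of s "Suc s"] by auto
    have "Poly_Mapping.lookup (a x) \<mu> = 0" if "mdeg \<mu> = s" "x \<in> B" for \<mu> x
    proof -
      have "0 = cf \<mu> ((\<Sum>x\<in>B. pscale (a x) (N x)) + w)"
        by (rule sym, rule cf_ordv[OF Suc.prems]) (simp add: that(1))
      also have "\<dots> = (\<Sum>x\<in>B. (\<lambda>j. Poly_Mapping.lookup (a x) \<mu> * x j)) + cf \<mu> w"
        unfolding cf_add cf_sum using IH that(1)
        by (intro arg_cong2[of _ _ _ _ "(+)"] sum.cong refl) (subst cf_pscale', auto simp: N)
      finally have "(\<Sum>x\<in>B. (\<lambda>j. Poly_Mapping.lookup (a x) \<mu> * x j)) + cf \<mu> w = 0" by simp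
      from BJ(5)[OF _ this] w that(2) show ?thesis by (auto simp: cf_def)
    qed
    then have a: "\<forall>x\<in>B. a x \<in> ord_ge (Suc s)" using IH by (auto simp: ord_ge_Suc_iff)
    then have "(\<Sum>x\<in>B. pscale (a x) (N x)) \<in> ordv (Suc s)" by (intro ordv_sum ordv_pscale'') auto
    from ordv_diff[OF Suc.prems this] show ?case using a by (simp only: add_diff_cancel_left' simp_thms)
  qed simp
  have "c = 0" if c: "c \<in> im_k m A" "\<forall>j. j \<notin> J \<longrightarrow> c j = 0" for c
  proof -
    obtain f where "c = (\<Sum>x\<in>B. (\<lambda>j. f x * x j))" using c(1) BJ(1,6) fv.span_finite[of B] by auto
    then have "(\<Sum>x\<in>B. (\<lambda>j. - f x * x j)) + c = 0"
      by (simp add: fun_eq_iff sum_fun_apply sum_negf)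
    from BJ(5)[OF c(2) this] show ?thesis by simp
  qed
  with BJ(1,3) Y ex[unfolded N_def] un[unfolded N_def] show ?thesis by (rule that)
qed

section \<open>Growth of Betti numbers\<close>

lemma lookup_single_mult_add:
  "Poly_Mapping.lookup (Poly_Mapping.single s 1 * (p::'k::field mpoly)) (s + m) = Poly_Mapping.lookup p m"
proof -
  have "Poly_Mapping.lookup (Poly_Mapping.single s 1 * p) (s + m)
     = (\<Sum>y\<in>Poly_Mapping.keys p. if m = y then Poly_Mapping.lookup p y else 0)"
    by (simp add: lookup_times when_def)
  then show ?thesis by (auto simp: in_keys_iff)
qed

lemma trunc_add: "trunc t (p + q) = trunc t p + trunc t q"
  by (rule poly_mapping_eqI) (simp add: lookup_trunc lookup_add)
lemma trunc_scale: "trunc t (Poly_Mapping.single 0 c * p) = Poly_Mapping.single 0 c * trunc t p"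
  by (rule poly_mapping_eqI) (simp add: lookup_trunc)
lemma trunc_trunc: "trunc t (trunc t p) = trunc t p"
  by (rule poly_mapping_eqI) (simp add: lookup_trunc)

text \<open>Vectors of polynomials of degree less than \<open>t\<close> represent the elements of \<open>R\<^sup>b\<close>; this gives
  access to linear algebra over \<open>k\<close> in \<open>R\<^sup>b\<close>.\<close>

lemma reduced_vec_in_span:
  fixes v :: "nat \<Rightarrow> 'k::field mpoly"
  assumes "v \<in> pvec d b" "\<And>j. trunc t (v j) = v j"
  shows "v \<in> pv.span ((\<lambda>(l, \<mu>) j. if j = l then Poly_Mapping.single \<mu> 1 else 0) ` ({..<b} \<times> (\<Union>a<t. monoms d a)))"
    (is "v \<in> pv.span ?F")
proof -
  let ?M = "\<Union>a<t. monoms d a"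
  have fM: "finite ?M" using finite_monoms by blast
  have z: "Poly_Mapping.lookup (v j) \<mu> = 0" if "\<mu> \<notin> ?M" for j \<mu>
  proof (cases "mdeg \<mu> < t")
    case True
    then show ?thesis using that assms(1) polys_lookup_zero[of "v j" d \<mu> "mdeg \<mu>"] by (auto simp: pvec_def)
  next
    case False then show ?thesis using lookup_trunc[of t "v j" \<mu>] assms(2) by simp
  qed
  have "v = (\<Sum>x\<in>{..<b} \<times> ?M. (\<lambda>j. Poly_Mapping.single 0 (Poly_Mapping.lookup (v (fst x)) (snd x)) *
      (\<lambda>(l, \<mu>) j. if j = l then Poly_Mapping.single \<mu> 1 else 0) x j))" (is "_ = ?R")
  proof (intro ext poly_mapping_eqI)
    fix j \<mu>
    have "Poly_Mapping.lookup (?R j) \<mu>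
      = (\<Sum>x\<in>{..<b} \<times> ?M. if x = (j, \<mu>) then Poly_Mapping.lookup (v j) \<mu> else 0)"
      unfolding sum_fun_apply lookup_sum
    proof (intro sum.cong refl)
      fix x :: "nat \<times> (nat \<Rightarrow>\<^sub>0 nat)"
      obtain l \<nu> where x: "x = (l, \<nu>)" by (cases x)
      show "Poly_Mapping.lookup (Poly_Mapping.single 0 (Poly_Mapping.lookup (v (fst x)) (snd x)) *
          (case x of (l, \<mu>) \<Rightarrow> \<lambda>j. if j = l then Poly_Mapping.single \<mu> 1 else 0) j) \<mu> =
          (if x = (j, \<mu>) then Poly_Mapping.lookup (v j) \<mu> else 0)"
        unfolding x by (cases "l = j"; cases "\<nu> = \<mu>") (auto simp: lookup_single when_def)
    qed
    also have "\<dots> = Poly_Mapping.lookup (v j) \<mu>"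
      using fM z[of \<mu> j] assms(1) by (auto simp: pvec_def)
    finally show "Poly_Mapping.lookup (v j) \<mu> = Poly_Mapping.lookup (?R j) \<mu>" by simp
  qed
  also have "\<dots> \<in> pv.span ?F"
    by (intro pv.span_sum pv.span_scale pv.span_base) auto
  finally show ?thesis .
qed

text \<open>The part of \<open>A1\<close> that is invertible modulo \<open>\<nn>\<close> does not contribute to homology: by the splitting
  above, every vector in the image of \<open>A1\<close> is a combination of the \<open>A1 (Y x)\<close> plus a vector of the syzygy module
  \<open>N\<close> supported in \<open>J\<close>. A cycle of \<open>A1\<close> modulo \<open>\<nn>\<close> then arises, up to boundaries, from a generator of
  \<open>N\<close>, and generators of \<open>N\<close> modulo \<open>x N\<close> suffice because multiples of \<open>x\<close> have no constant term. As
  \<open>N\<close> has finite dimension over \<open>k\<close>, the dimension of \<open>N / x N\<close> is that of the kernel of \<open>x\<close> on \<open>N\<close>.\<close>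

lemma betti_growth_upper:
  fixes A2 A1 A0 :: "nat \<Rightarrow> nat \<Rightarrow> 'k::field mpoly"
  assumes M: "A1 \<in> pmat d b" "A0 \<in> pmat d m"
    and ex: "exact_mod t d b A2 m A1" "exact_mod t d m A1 n A0"
    and t: "t > 0" and d: "d > 0"
  shows "fv.dim (ker_k m A1) \<le> card (monoms d (t - 1)) * (fv.dim (ker_k b A2) - fv.dim (im_k m A1)) + fv.dim (im_k n A0)"
proof -
  obtain B :: "(nat \<Rightarrow> 'k) set" and Y J where S: "finite B" "J \<subseteq> {..<b}" "\<And>x. x \<in> B \<Longrightarrow> Y x \<in> pvec d m"
    "\<And>v t. v \<in> pvec d b \<Longrightarrow> \<exists>a w. (\<forall>x. a x \<in> polys d) \<and> w \<in> pvec d b \<and> (\<forall>j. j \<notin> J \<longrightarrow> w j = 0) \<and>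
        v - (\<Sum>x\<in>B. pscale (a x) (mv m A1 (Y x))) - w \<in> ordv t"
    "\<And>a w s. \<lbrakk>\<forall>j. j \<notin> J \<longrightarrow> w j = 0; (\<Sum>x\<in>B. pscale (a x) (mv m A1 (Y x))) + w \<in> ordv s\<rbrakk>
        \<Longrightarrow> (\<forall>x\<in>B. a x \<in> ord_ge s) \<and> w \<in> ordv s"
    "\<And>c. c \<in> im_k m A1 \<Longrightarrow> (\<forall>j. j \<notin> J \<longrightarrow> c j = 0) \<Longrightarrow> c = 0"
    by (rule exists_free_splitting[OF M(1), of m]) (rule that)
  define x where "x = (Poly_Mapping.single (Poly_Mapping.single 0 1) 1 :: 'k mpoly)"
  have xo: "x \<in> ord_ge 1" unfolding x_def by (rule ord_ge_single) simp
  have xp: "x \<in> polys d" unfolding x_def by (rule single_polys) (use d in simp)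
  \<comment> \<open>Multiplication by a variable on \<open>R\<^sup>b\<close>, in terms of reduced representatives.\<close>
  define X where "X v = (\<lambda>j. trunc t (x * v j))" for v :: "nat \<Rightarrow> 'k mpoly"
  define N where "N = {v \<in> pvec d b. (\<forall>j. j \<notin> J \<longrightarrow> v j = 0) \<and> (\<forall>j. trunc t (v j) = v j) \<and> mv b A2 v \<in> ordv t}"
  define F :: "(nat \<Rightarrow> 'k mpoly) set" where "F = (\<lambda>(l, \<mu>) j. if j = l then Poly_Mapping.single \<mu> 1 else 0) ` ({..<b} \<times> (\<Union>a<t. monoms d a))"
  have fF: "finite F" by (simp add: F_def finite_monoms)
  have NF: "N \<subseteq> pv.span F" unfolding F_def N_def using reduced_vec_in_span by blast
  have linX: "Vector_Spaces.linear (\<lambda>(c::'k) v i. Poly_Mapping.single 0 c * v i) (\<lambda>c v i. Poly_Mapping.single 0 c * v i) X"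
  proof unfold_locales
    show "X (u + v) = X u + X v" for u v by (simp add: X_def fun_eq_iff trunc_add distrib_left)
    show "X (\<lambda>i. Poly_Mapping.single 0 c * v i) = (\<lambda>i. Poly_Mapping.single 0 c * X v i)" for c v
      by (simp only: X_def mult.left_commute[of x "Poly_Mapping.single 0 c"] trunc_scale)
  qed
  interpret X: Vector_Spaces.linear "\<lambda>(c::'k) (v::nat \<Rightarrow> 'k mpoly) i. Poly_Mapping.single 0 c * v i" "\<lambda>c v i. Poly_Mapping.single 0 c * v i" X
    by (rule linX)
  have subN: "pv.subspace N" unfolding pv.subspace_def
  proof (intro conjI ballI allI)
    show "0 \<in> N" by (simp add: N_def) (simp add: trunc_eq_0_iff)
  next
    fix u v assume "u \<in> N" "v \<in> N"
    then show "u + v \<in> N" by (auto simp: N_def trunc_add mv_add intro: pvec_add ordv_add)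
  next
    fix c :: 'k and v assume "v \<in> N"
    then show "(\<lambda>i. Poly_Mapping.single 0 c * v i) \<in> N"
      by (auto simp: N_def trunc_scale mv_scale intro!: ordv_pscale' pvec_pscale single_polys)
  qed
  have Xdiff: "pscale x v - X v \<in> ordv t" for v by (auto simp: X_def ordv_def trunc_diff)
  have XN: "X ` N \<subseteq> N"
  proof clarify
    fix v assume v: "v \<in> N"
    have "mv b A2 (X v) = pscale x (mv b A2 v) - mv b A2 (pscale x v - X v)"
      unfolding mv_diff mv_scale by simp
    also have "mv b A2 v \<in> ordv t" using v by (simp add: N_def)
    then have "pscale x (mv b A2 v) - mv b A2 (pscale x v - X v) \<in> ordv t"
      by (intro ordv_diff ordv_mv[OF Xdiff] ordv_pscale')
    finally show "X v \<in> N" using v xp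
      by (auto simp: N_def X_def trunc_trunc pvec_def trunc_eq_0_iff intro!: trunc_polys polys_mult)
  qed
  define ZV where "ZV = {c \<in> ker_k b A2. \<forall>j. j \<notin> J \<longrightarrow> c j = 0}"
  have subZV: "fv.subspace ZV" using subspace_ker_k[of b A2] by (auto simp: ZV_def fv.subspace_def)
  have dZV: "fv.dim ZV + fv.dim (im_k m A1) \<le> fv.dim (ker_k b A2)"
    using S(6) im_k_subset_ker_k[OF ex(1) M(1) t]
    by (intro fv.dim_plus_dim_le_of_inter_zero[OF subZV subspace_im_k subspace_ker_k _ _ ker_k_span]) (auto simp: ZV_def)
  have "ZV \<subseteq> fv.span (unitv ` {..<b})" using ker_k_span[of b A2] by (auto simp: ZV_def)
  then obtain BZ where BZ': "BZ \<subseteq> ZV" "finite BZ" "fv.independent BZ" "ZV \<subseteq> fv.span BZ" "card BZ = fv.dim ZV"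
    by (rule fv.finite_basis_of) simp
  note BZ = BZ'(1,2,4,5)
  define G where "G = (\<lambda>(\<mu>, z) j. Poly_Mapping.single \<mu> (z j :: 'k)) ` (monoms d (t - 1) \<times> BZ)"
  have fG: "finite G" using BZ finite_monoms by (simp add: G_def)
  have cG: "card G \<le> card (monoms d (t - 1)) * fv.dim ZV"
    unfolding G_def BZ(4)[symmetric] card_cartesian_product[symmetric]
    using BZ finite_monoms by (intro card_image_le) simp
  \<comment> \<open>If \<open>x v\<close> vanishes modulo \<open>\<nn>\<^sup>t\<close>, then \<open>v\<close> has order \<open>t - 1\<close>, and its coefficients are cycles
    supported in \<open>J\<close>. Such cycles meet the boundaries only in zero.\<close>
  have kerG: "{v \<in> N. X v = 0} \<subseteq> pv.span G"
  proof clarify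
    fix v assume v: "v \<in> N" "X v = 0"
    have vo: "v \<in> ordv (t - 1)" unfolding ordv_def
    proof (intro CollectI allI, unfold ord_ge_def, intro CollectI allI impI)
      fix j and m :: "nat \<Rightarrow>\<^sub>0 nat" assume m: "mdeg m < t - 1"
      have "x * v j \<in> ord_ge t" using v(2) by (auto simp: X_def fun_eq_iff trunc_eq_0_iff)
      then have "Poly_Mapping.lookup (x * v j) (Poly_Mapping.single 0 1 + m) = 0"
        by (rule ord_geD) (use m in \<open>simp add: mdeg_add\<close>)
      then show "Poly_Mapping.lookup (v j) m = 0" unfolding x_def by (subst (asm) lookup_single_mult_add)
    qed
    have "v = (\<Sum>\<mu>\<in>monoms d (t - 1). (\<lambda>j. Poly_Mapping.single \<mu> (cf \<mu> v j)))"
    proof (intro ext poly_mapping_eqI)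
      fix j \<nu>
      have "Poly_Mapping.lookup (v j) \<nu> = 0" if "\<nu> \<notin> monoms d (t - 1)"
      proof (cases "mdeg \<nu> < t")
        case True
        then have "mdeg \<nu> < t - 1 \<or> mdeg \<nu> = t - 1" by linarith
        then show ?thesis using vo that v(1) polys_lookup_zero[of "v j" d \<nu> "t - 1"]
          by (auto simp: ordv_def N_def pvec_def dest: ord_geD)
      next
        case False
        then show ?thesis using v(1) lookup_trunc[of t "v j" \<nu>] by (simp add: N_def)
      qed
      then show "Poly_Mapping.lookup (v j) \<nu> = Poly_Mapping.lookup
          ((\<Sum>\<mu>\<in>monoms d (t - 1). (\<lambda>j. Poly_Mapping.single \<mu> (cf \<mu> v j))) j) \<nu>"
        using finite_monoms by (auto simp: sum_fun_apply lookup_sum lookup_single when_def cf_def)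
    qed
    also have "\<dots> \<in> pv.span G"
    proof (intro pv.span_sum)
      fix \<mu> assume \<mu>: "\<mu> \<in> monoms d (t - 1)"
      have "mv b (cmat A2) (cf \<mu> v) = cf \<mu> (mv b A2 v)"
        using vo \<mu> by (intro cf_mv[symmetric]) (simp add: monoms_def)
      also have "\<dots> = 0" using v(1) \<mu> t by (intro cf_ordv[of _ t]) (auto simp: N_def monoms_def)
      finally have "cf \<mu> v \<in> ZV" using v(1) kvec_cf[of v d b \<mu>] by (auto simp: ZV_def ker_k_def N_def cf_def)
      then obtain f where f: "cf \<mu> v = (\<Sum>z\<in>BZ. (\<lambda>j. f z * z j))" using BZ(2,3) fv.span_finite[of BZ] by auto
      have "(\<lambda>j. Poly_Mapping.single \<mu> (cf \<mu> v j)) = (\<Sum>z\<in>BZ. (\<lambda>j. Poly_Mapping.single 0 (f z) * Poly_Mapping.single \<mu> (z j)))"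
        by (intro ext poly_mapping_eqI)
          (simp add: f sum_fun_apply lookup_sum lookup_single mult_single when_def)
      also have "\<dots> \<in> pv.span G"
        using \<mu> by (intro pv.span_sum pv.span_scale pv.span_base) (auto simp: G_def)
      finally show "(\<lambda>j. Poly_Mapping.single \<mu> (cf \<mu> v j)) \<in> pv.span G" .
    qed
    finally show "v \<in> pv.span G" .
  qed
  \<comment> \<open>\<open>W\<close> represents a basis of \<open>N / x N\<close>.\<close>
  obtain W D where "finite W" "W \<subseteq> N" "card W + pv.dim (X ` N) = pv.dim N" "finite D" "D \<subseteq> X ` N" "pv.span D = X ` N"
      "D \<inter> W = {}" "pv.independent (D \<union> W)" "pv.span (D \<union> W) = N"
    by (rule pv.dim_eq_dim_plus_complement[OF X.subspace_image[OF subN] subN XN NF fF]) (rule that)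
  note W = this(1-3,6,9)
  have "card W \<le> pv.dim {v \<in> N. X v = 0}"
    using pv.dim_le_dim_image_plus_dim_kernel[OF linX subN NF fF] W(3) by simp
  also have "\<dots> \<le> card G" using kerG fG by (rule pv.dim_le_card)
  finally have cW: "card W \<le> card (monoms d (t - 1)) * fv.dim ZV" using cG by simp
  have "\<forall>v\<in>N. \<exists>y. y \<in> pvec d m \<and> v - mv m A1 y \<in> ordv t"
  proof
    fix v assume "v \<in> N"
    then have "v \<in> pvec d b" "mv b A2 v \<in> ordv t" by (simp_all add: N_def)
    then obtain y where "y \<in> pvec d m" "v - mv m A1 y \<in> ordv t" by (rule exact_mod_lift[OF ex(1)])
    then show "\<exists>y. y \<in> pvec d m \<and> v - mv m A1 y \<in> ordv t" by (intro exI conjI)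
  qed
  from bchoice[OF this] obtain y where y': "\<forall>v\<in>N. y v \<in> pvec d m \<and> v - mv m A1 (y v) \<in> ordv t" ..
  note y = y'[THEN bspec, THEN conjunct1] y'[THEN bspec, THEN conjunct2]
  let ?yW = "(\<lambda>w. cf 0 (y w)) ` W"
  have "ker_k m A1 \<subseteq> fv.span (?yW \<union> im_k n A0)"
  proof
    fix c assume "c \<in> ker_k m A1"
    then have c: "c \<in> kvec m" "mv m (cmat A1) c = 0" by (auto simp: ker_k_def)
    define v where "v = mv m A1 (cvec c)"
    have vp: "v \<in> pvec d b" unfolding v_def using M(1) c(1) by (intro pvec_mv pvec_cvec)
    have v1: "v \<in> ordv 1" using c(2) by (simp add: v_def ordv_1_iff cf0_mv)
    from S(4)[OF vp, of t] obtain a w0 where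
      aw': "(\<forall>x. a x \<in> polys d) \<and> w0 \<in> pvec d b \<and> (\<forall>j. j \<notin> J \<longrightarrow> w0 j = 0) \<and>
        v - (\<Sum>x\<in>B. pscale (a x) (mv m A1 (Y x))) - w0 \<in> ordv t" by (elim exE)
    note aw = aw'[THEN conjunct1, rule_format] aw'[THEN conjunct2, THEN conjunct1]
      aw'[THEN conjunct2, THEN conjunct2, THEN conjunct1, rule_format] aw'[THEN conjunct2, THEN conjunct2, THEN conjunct2]
    define w where "w = (\<lambda>j. trunc t (w0 j))"
    have w0w: "w0 - w \<in> ordv t" by (auto simp: w_def ordv_def trunc_diff)
    have wJ: "\<forall>j. j \<notin> J \<longrightarrow> w j = 0" using aw(3) by (simp add: w_def trunc_eq_0_iff)
    have wp: "w \<in> pvec d b" using aw(2) by (auto simp: w_def pvec_def trunc_eq_0_iff intro: trunc_polys)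
    \<comment> \<open>The combination of the \<open>Y x\<close> has no constant term, since \<open>v\<close> has none and the splitting respects orders.\<close>
    define g where "g = cvec c - (\<Sum>x\<in>B. pscale (a x) (Y x))"
    have gp: "g \<in> pvec d m" unfolding g_def using aw(1) S(3) c(1) by (intro pvec_diff pvec_sum pvec_pscale pvec_cvec)
    define r where "r = mv m A1 g - w"
    have gS: "mv m A1 g = v - (\<Sum>x\<in>B. pscale (a x) (mv m A1 (Y x)))"
      by (simp add: g_def mv_diff mv_sum mv_scale v_def)
    have "r = (v - (\<Sum>x\<in>B. pscale (a x) (mv m A1 (Y x))) - w0) + (w0 - w)" by (simp add: r_def gS)
    then have ro: "r \<in> ordv t" using ordv_add[OF aw(4) w0w] by simp
    have "(\<Sum>x\<in>B. pscale (a x) (mv m A1 (Y x))) + w = v - r" by (simp add: r_def gS)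
    also have "\<dots> \<in> ordv 1" using v1 ordv_mono[of 1 t r] ro t by (intro ordv_diff) auto
    finally have ao: "\<And>x. x \<in> B \<Longrightarrow> a x \<in> ord_ge 1" using S(5)[OF wJ] by blast
    have "mv b A2 w = mv b A2 (mv m A1 g) - mv b A2 r" by (simp add: r_def mv_diff)
    also have "\<dots> \<in> ordv t" by (rule ordv_diff[OF exact_mod_complex[OF ex(1) M(1) gp] ordv_mv[OF ro]])
    finally have wN: "w \<in> N" using wp wJ by (auto simp: N_def w_def trunc_trunc)
    then obtain q h where q: "q \<in> pv.span D" "h \<in> pv.span W" "w = q + h"
      using W(5) pv.span_Un[of D W] by auto
    obtain n0 where n0: "n0 \<in> N" "q = X n0" using q(1) W(4) by auto
    obtain f where f: "h = (\<Sum>u\<in>W. (\<lambda>j. Poly_Mapping.single 0 (f u) * u j))"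
      using q(2) W(1) pv.span_finite[of W] by auto
    \<comment> \<open>A syzygy whose constant term is \<open>c\<close> minus a combination of the constant terms of the \<open>y u\<close>.\<close>
    define G where "G = g - (\<Sum>u\<in>W. pscale (Poly_Mapping.single 0 (f u)) (y u)) - pscale x (y n0)"
    have Gp: "G \<in> pvec d m" unfolding G_def using gp y(1) W(2) n0(1) xp
      by (intro pvec_diff pvec_sum pvec_pscale single_polys) auto
    have "mv m A1 G = r + (\<Sum>u\<in>W. pscale (Poly_Mapping.single 0 (f u)) (u - mv m A1 (y u)))
        + pscale x (n0 - mv m A1 (y n0)) - (pscale x n0 - X n0)"
    proof -
      have "mv m A1 G = r + w - (\<Sum>u\<in>W. pscale (Poly_Mapping.single 0 (f u)) (mv m A1 (y u))) - pscale x (mv m A1 (y n0))"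
        by (simp add: G_def mv_diff mv_sum mv_scale r_def)
      also have "w = (\<Sum>u\<in>W. pscale (Poly_Mapping.single 0 (f u)) u) + X n0" using q f n0 by simp
      finally show ?thesis
        by (auto simp: fun_eq_iff sum_fun_apply algebra_simps sum_subtractf)
    qed
    also have "\<dots> \<in> ordv t"
      by (intro ordv_add ordv_diff[OF _ Xdiff] ordv_sum ordv_pscale' ro y(2) n0(1) subsetD[OF W(2)])
    finally obtain u where u: "u \<in> pvec d n" "G - mv n A0 u \<in> ordv t"
      using exact_mod_lift[OF ex(2) Gp] by blast
    have "cf 0 (G - mv n A0 u) = 0" using u(2) t by (intro cf_ordv) auto
    then have "cf 0 G = mv n (cmat A0) (cf 0 u)" by (simp add: cf_diff cf0_mv)
    moreover have "cf 0 G = c - (\<Sum>w\<in>W. (\<lambda>j. f w * cf 0 (y w) j))"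
    proof -
      have 1: "cf 0 (pscale (a x) (Y x)) = 0" if "x \<in> B" for x
        using ao[OF that] by (intro cf_ordv[of _ 1] ordv_pscale'') auto
      have 2: "cf 0 (pscale x (y n0)) = 0" using xo by (intro cf_ordv[of _ 1] ordv_pscale'') auto
      have 3: "cf 0 (pscale (Poly_Mapping.single 0 (f w)) (y w)) = (\<lambda>j. f w * cf 0 (y w) j)" for w
        by (subst cf_pscale) auto
      show ?thesis by (simp add: G_def g_def cf_diff cf_sum 1 2 3)
    qed
    ultimately have "c = (\<Sum>w\<in>W. (\<lambda>j. f w * cf 0 (y w) j)) + mv n (cmat A0) (cf 0 u)"
      by (simp add: algebra_simps)
    also have "\<dots> \<in> fv.span (?yW \<union> im_k n A0)"
      using u(1) by (intro fv.span_add fv.span_sum fv.span_scale fv.span_base) (auto simp: im_k_def intro: kvec_cf)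
    finally show "c \<in> fv.span (?yW \<union> im_k n A0)" .
  qed
  then have "fv.dim (ker_k m A1) \<le> card ?yW + fv.dim (im_k n A0)"
    using W(1) subset_trans[OF im_k_subset_ker_k[OF ex(2) M(2) t] ker_k_span]
    by (intro fv.dim_le_of_span_modulo[where F = "unitv ` {..<m}"]) simp_all
  also have "card ?yW \<le> card W" using W(1) by (rule card_image_le)
  also note cW
  also have "card (monoms d (t - 1)) * fv.dim ZV
      \<le> card (monoms d (t - 1)) * (fv.dim (ker_k b A2) - fv.dim (im_k m A1))"
    using dZV by (intro mult_left_mono) auto
  finally show ?thesis by simp
qed

text \<open>The coordinates in \<open>J\<close> complement the image of \<open>A0\<close> modulo \<open>\<nn>\<close>; the point is that they do so over
  \<open>R\<close>. Let \<open>w\<close>, supported in \<open>J\<close>, be in the image, say \<open>w = A0 y\<close>. Its constant term vanishes, so the constant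
  term of \<open>y\<close> is a cycle and, by hypothesis, a boundary; hence \<open>y\<close> may be taken in \<open>\<nn>\<close>. Each column of \<open>A0\<close> is a combination of
  the \<open>A0 (Y x)\<close> plus an element of the same module \<open>N\<close> of vectors \<open>w\<close>, and uniqueness of the splitting
  gives \<open>N \<subseteq> \<nn> N\<close>. Iterating, \<open>N\<close> vanishes modulo \<open>\<nn>\<^sup>t\<close>.\<close>

lemma split_of_ker_subset_im:
  fixes A0 A1 :: "nat \<Rightarrow> nat \<Rightarrow> 'k::field mpoly"
  assumes M: "A0 \<in> pmat d b" "A1 \<in> pmat d m" and ex: "exact_mod t d m A0 n A1"
    and t: "t > 0" and ki: "ker_k m A0 \<subseteq> im_k n A1"
  obtains J where "J \<subseteq> {..<b}"
    "\<And>v. v \<in> pvec d b \<Longrightarrow> \<exists>y w. y \<in> pvec d m \<and> w \<in> pvec d b \<and> (\<forall>j. j \<notin> J \<longrightarrow> w j = 0) \<and> v - mv m A0 y - w \<in> ordv t"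
    "\<And>w y. \<lbrakk>w \<in> pvec d b; \<forall>j. j \<notin> J \<longrightarrow> w j = 0; y \<in> pvec d m; w - mv m A0 y \<in> ordv t\<rbrakk> \<Longrightarrow> w \<in> ordv t"
proof -
  obtain B :: "(nat \<Rightarrow> 'k) set" and Y J where S: "finite B" "J \<subseteq> {..<b}" "\<And>x. x \<in> B \<Longrightarrow> Y x \<in> pvec d m"
    "\<And>v t. v \<in> pvec d b \<Longrightarrow> \<exists>a w. (\<forall>x. a x \<in> polys d) \<and> w \<in> pvec d b \<and> (\<forall>j. j \<notin> J \<longrightarrow> w j = 0) \<and>
        v - (\<Sum>x\<in>B. pscale (a x) (mv m A0 (Y x))) - w \<in> ordv t"
    "\<And>a w s. \<lbrakk>\<forall>j. j \<notin> J \<longrightarrow> w j = 0; (\<Sum>x\<in>B. pscale (a x) (mv m A0 (Y x))) + w \<in> ordv s\<rbrakk>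
        \<Longrightarrow> (\<forall>x\<in>B. a x \<in> ord_ge s) \<and> w \<in> ordv s"
    "\<And>c. c \<in> im_k m A0 \<Longrightarrow> (\<forall>j. j \<notin> J \<longrightarrow> c j = 0) \<Longrightarrow> c = 0"
    by (rule exists_free_splitting[OF M(1), of m]) (rule that)
  define N where "N = {w \<in> pvec d b. (\<forall>j. j \<notin> J \<longrightarrow> w j = 0) \<and> (\<exists>y\<in>pvec d m. w - mv m A0 y \<in> ordv t)}"
  have lincomb: "(\<Sum>x\<in>B. pscale (a x) (mv m A0 (Y x))) = mv m A0 (\<Sum>x\<in>B. pscale (a x) (Y x))" for a
    by (simp add: mv_sum mv_scale)
  have Yp: "(\<Sum>x\<in>B. pscale (a x) (Y x)) \<in> pvec d m" if "\<forall>x. a x \<in> polys d" for a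
    using that S(3) by (intro pvec_sum pvec_pscale) simp_all
  have split: "\<exists>a w. (\<forall>x. a x \<in> polys d) \<and> w \<in> N \<and> mv m A0 y - (\<Sum>x\<in>B. pscale (a x) (mv m A0 (Y x))) - w \<in> ordv t"
    if y: "y \<in> pvec d m" for y
  proof -
    from S(4)[OF pvec_mv[OF M(1) y], of t] obtain a w where aw: "(\<forall>x. a x \<in> polys d) \<and> w \<in> pvec d b \<and> (\<forall>j. j \<notin> J \<longrightarrow> w j = 0) \<and>
        mv m A0 y - (\<Sum>x\<in>B. pscale (a x) (mv m A0 (Y x))) - w \<in> ordv t" by (elim exE)
    let ?r = "mv m A0 y - (\<Sum>x\<in>B. pscale (a x) (mv m A0 (Y x))) - w"
    have "w - mv m A0 (y - (\<Sum>x\<in>B. pscale (a x) (Y x))) = 0 - ?r"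
      unfolding lincomb mv_diff by simp
    also have "?r \<in> ordv t" using aw by (elim conjE)
    then have "0 - ?r \<in> ordv t" by (rule ordv_diff[OF zero_ordv])
    finally have wo: "w - mv m A0 (y - (\<Sum>x\<in>B. pscale (a x) (Y x))) \<in> ordv t" .
    have "y - (\<Sum>x\<in>B. pscale (a x) (Y x)) \<in> pvec d m" using aw by (intro pvec_diff y Yp) (elim conjE)
    then have "\<exists>y\<in>pvec d m. w - mv m A0 y \<in> ordv t" by (rule rev_bexI) (rule wo)
    then have "w \<in> N" unfolding N_def using aw by (elim conjE) (intro CollectI conjI)
    then show ?thesis using aw by (elim conjE) (intro exI[of _ a] exI[of _ w] conjI)
  qed
  have main: "N \<subseteq> ordv s" if "s \<le> t" for s using that
  proof (induction s)
    case (Suc s)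
    show ?case
    proof
      fix w assume "w \<in> N"
      then obtain y where w: "w \<in> pvec d b" "\<forall>j. j \<notin> J \<longrightarrow> w j = 0" "y \<in> pvec d m" "w - mv m A0 y \<in> ordv t"
        unfolding N_def by blast
      have "cf 0 (w - mv m A0 y) = 0" using w(4) t by (intro cf_ordv) auto
      then have c0: "cf 0 w = mv m (cmat A0) (cf 0 y)" by (simp add: cf_diff cf0_mv)
      then have "cf 0 w \<in> im_k m A0" using kvec_cf[OF w(3)] by (auto simp: im_k_def)
      then have "cf 0 w = 0" using w(2) by (intro S(6)) (simp_all add: cf_def)
      then have "cf 0 y \<in> ker_k m A0" using c0 kvec_cf[OF w(3)] by (simp add: ker_k_def)
      then obtain c where c: "c \<in> kvec n" "cf 0 y = mv n (cmat A1) c" using ki by (auto simp: im_k_def)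
      define y' where "y' = y - mv n A1 (cvec c)"
      have y'1: "y' \<in> ordv 1" using c(2) by (simp add: y'_def ordv_1_iff cf_diff cf0_mv)
      have wy': "w - mv m A0 y' \<in> ordv t"
      proof -
        have "w - mv m A0 y' = (w - mv m A0 y) + mv m A0 (mv n A1 (cvec c))" by (simp add: y'_def mv_diff)
        also have "\<dots> \<in> ordv t" by (rule ordv_add[OF w(4) exact_mod_complex[OF ex M(2) pvec_cvec[OF c(1)]]])
        finally show ?thesis .
      qed
      have "\<forall>l\<in>{..<m}. \<exists>p. (\<forall>x. fst p x \<in> polys d) \<and> snd p \<in> N \<and>
          mv m A0 (unitv l) - (\<Sum>x\<in>B. pscale (fst p x) (mv m A0 (Y x))) - snd p \<in> ordv t"
      proof
        fix l assume "l \<in> {..<m}"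
        then have "unitv l \<in> pvec d m" by (auto simp: unitv_def pvec_def)
        from split[OF this] show "\<exists>p. (\<forall>x. fst p x \<in> polys d) \<and> snd p \<in> N \<and>
          mv m A0 (unitv l) - (\<Sum>x\<in>B. pscale (fst p x) (mv m A0 (Y x))) - snd p \<in> ordv t" by simp
      qed
      from bchoice[OF this] obtain p where p: "\<forall>l\<in>{..<m}. (\<forall>x. fst (p l) x \<in> polys d) \<and> snd (p l) \<in> N \<and>
          mv m A0 (unitv l) - (\<Sum>x\<in>B. pscale (fst (p l) x) (mv m A0 (Y x))) - snd (p l) \<in> ordv t" ..
      \<comment> \<open>The part of \<open>A0 y'\<close> that lies in \<open>\<nn> N\<close>; it agrees with \<open>w\<close> modulo \<open>\<nn>\<^sup>t\<close>.\<close>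
      define v where "v = (\<Sum>l<m. pscale (y' l) (snd (p l)))"
      define r where "r l = mv m A0 (unitv l) - (\<Sum>x\<in>B. pscale (fst (p l) x) (mv m A0 (Y x))) - snd (p l)" for l
      have col: "mv m A0 (unitv l) = (\<lambda>j. A0 j l)" if "l < m" for l
        unfolding unitv_def using that by (rule mv_single_vec)
      have e: "mv m A0 y' = (\<Sum>l<m. pscale (y' l) (mv m A0 (unitv l)))"
      proof
        fix j
        have "mv m A0 y' j = (\<Sum>l<m. y' l * A0 j l)" by (simp add: mv_def mult.commute)
        also have "\<dots> = (\<Sum>l<m. pscale (y' l) (mv m A0 (unitv l))) j"
          unfolding sum_fun_apply by (intro sum.cong refl) (simp add: col)
        finally show "mv m A0 y' j = (\<Sum>l<m. pscale (y' l) (mv m A0 (unitv l))) j" .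
      qed
      have "(\<Sum>x\<in>B. pscale (- (\<Sum>l<m. y' l * fst (p l) x)) (mv m A0 (Y x))) + (w - v)
          = (w - mv m A0 y') + (\<Sum>l<m. pscale (y' l) (r l))"
      proof
        fix j
        have "(\<Sum>l<m. pscale (y' l) (r l)) j = (\<Sum>l<m. y' l * mv m A0 (unitv l) j)
            - (\<Sum>l<m. \<Sum>x\<in>B. y' l * fst (p l) x * mv m A0 (Y x) j) - v j"
          by (simp add: r_def v_def sum_fun_apply right_diff_distrib sum_subtractf sum_distrib_left mult.assoc)
        moreover have "(\<Sum>l<m. \<Sum>x\<in>B. y' l * fst (p l) x * mv m A0 (Y x) j)
           = (\<Sum>x\<in>B. (\<Sum>l<m. y' l * fst (p l) x) * mv m A0 (Y x) j)"
          by (subst sum.swap) (simp add: sum_distrib_right)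
        moreover have "mv m A0 y' j = (\<Sum>l<m. y' l * mv m A0 (unitv l) j)"
          using fun_cong[OF e, of j] by (simp add: sum_fun_apply)
        ultimately show "((\<Sum>x\<in>B. pscale (- (\<Sum>l<m. y' l * fst (p l) x)) (mv m A0 (Y x))) + (w - v)) j
          = ((w - mv m A0 y') + (\<Sum>l<m. pscale (y' l) (r l))) j"
          by (simp add: sum_fun_apply sum_negf)
      qed
      also have "\<dots> \<in> ordv t"
      proof (intro ordv_add[OF wy'] ordv_sum ordv_pscale')
        fix l assume "l \<in> {..<m}"
        from p[THEN bspec, OF this] show "r l \<in> ordv t" unfolding r_def by (elim conjE)
      qed
      finally have o: "(\<Sum>x\<in>B. pscale (- (\<Sum>l<m. y' l * fst (p l) x)) (mv m A0 (Y x))) + (w - v) \<in> ordv t" .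
      have "\<forall>j. j \<notin> J \<longrightarrow> (w - v) j = 0" using w(2) p by (simp add: v_def sum_fun_apply N_def)
      from S(5)[OF this o] have "w - v \<in> ordv t" ..
      moreover have "v \<in> ordv (1 + s)" unfolding v_def
        using p Suc y'1 by (intro ordv_sum ordv_pscale) (auto simp: ordv_def)
      ultimately have "(w - v) + v \<in> ordv (Suc s)"
        using Suc.prems by (intro ordv_add ordv_mono[of "Suc s" t "w - v"]) simp_all
      then show "w \<in> ordv (Suc s)" by simp
    qed
  qed simp
  show ?thesis
  proof (rule that)
    show "J \<subseteq> {..<b}" by (rule S(2))
    fix v :: "nat \<Rightarrow> 'k mpoly" assume "v \<in> pvec d b"
    from S(4)[OF this, of t] obtain a w where aw: "(\<forall>x. a x \<in> polys d) \<and> w \<in> pvec d b \<and> (\<forall>j. j \<notin> J \<longrightarrow> w j = 0) \<and>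
        v - (\<Sum>x\<in>B. pscale (a x) (mv m A0 (Y x))) - w \<in> ordv t" by (elim exE)
    then show "\<exists>y w. y \<in> pvec d m \<and> w \<in> pvec d b \<and> (\<forall>j. j \<notin> J \<longrightarrow> w j = 0) \<and> v - mv m A0 y - w \<in> ordv t"
      unfolding lincomb using Yp[of a] by (intro exI[of _ "\<Sum>x\<in>B. pscale (a x) (Y x)"] exI[of _ w] conjI) simp_all
  next
    fix w y :: "nat \<Rightarrow> 'k mpoly" assume "w \<in> pvec d b" "\<forall>j. j \<notin> J \<longrightarrow> w j = 0" "y \<in> pvec d m" "w - mv m A0 y \<in> ordv t"
    then have "w \<in> N" by (auto simp: N_def)
    then show "w \<in> ordv t" using main[of t] by blast
  qed
qed

text \<open>The lower estimate passes from index \<open>i - 1\<close> to \<open>i + 1\<close> and the upper one from \<open>i - 1\<close> to \<open>i\<close>, so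
  their difference is a multiple of \<open>\<beta> (i - 1)\<close>.\<close>

lemma betti_sequence_growth:
  fixes A :: "nat \<Rightarrow> nat \<Rightarrow> nat \<Rightarrow> 'k::field mpoly" and b :: "nat \<Rightarrow> nat"
  defines "\<beta> \<equiv> \<lambda>i. fv.dim (ker_k (b i) (A (i - 1))) - fv.dim (im_k (b (Suc i)) (A i))"
  assumes M: "\<And>i. A i \<in> pmat d (b i)"
    and ex: "\<And>i. exact_mod t d (b (Suc i)) (A i) (b (Suc (Suc i))) (A (Suc i))"
    and t: "t > 0" and d: "d > 1" and nz: "\<beta> 1 \<noteq> 0" and i: "i \<ge> 2"
  shows "\<beta> i + (d - 1) \<le> \<beta> (Suc i)"
proof -
  have le: "fv.dim (im_k (b (Suc (Suc i))) (A (Suc i))) \<le> fv.dim (ker_k (b (Suc i)) (A i))" for i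
    by (rule fv.dim_mono_finite[OF im_k_subset_ker_k[OF ex M t] ker_k_span]) simp
  have lower: "card (monoms d t) * \<beta> (Suc i) \<le> \<beta> (Suc (Suc (Suc i)))" for i
    using betti_growth_lower[OF M M M ex ex ex t, of i] by (simp add: \<beta>_def)
  have upper: "\<beta> (Suc (Suc i)) \<le> card (monoms d (t - 1)) * \<beta> (Suc i)" for i
    using betti_growth_upper[OF M M ex ex t, of i] d le[of "Suc i"] by (simp add: \<beta>_def)
  have h: "card (monoms d (t - 1)) + (d - 1) \<le> card (monoms d t)"
    using card_monoms_Suc[of d "t - 1"] d t by simp
  have pos: "\<beta> (Suc i) \<noteq> 0" for i
  proof (induction i rule: less_induct)
    case (less i)
    consider "i = 0" | "i = 1" | j where "i = Suc (Suc j)" by (metis One_nat_def not0_implies_Suc)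
    then show ?case
    proof cases
      case 1 then show ?thesis using nz by simp
    next
      case 2
      \<comment> \<open>\<open>\<beta> 2\<close> is not reached from below, but \<open>\<beta> 3\<close> is nonzero and bounded by a multiple of \<open>\<beta> 2\<close>.\<close>
      have "0 < card (monoms d t) * \<beta> (Suc 0)" using nz h d by simp
      also note lower[of 0]
      also note upper[of "Suc 0"]
      finally show ?thesis using 2 by simp
    next
      case 3
      have "0 < card (monoms d t) * \<beta> (Suc j)" using less[of j] 3 h d by simp
      also note lower[of j]
      finally show ?thesis using 3 by simp
    qed
  qed
  define j where "j = i - 2"
  have j: "i = Suc (Suc j)" using i by (simp add: j_def)
  have "\<beta> i + (d - 1) * \<beta> (Suc j) \<le> card (monoms d (t - 1)) * \<beta> (Suc j) + (d - 1) * \<beta> (Suc j)"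
    using upper[of j] j by simp
  also have "\<dots> \<le> card (monoms d t) * \<beta> (Suc j)" using mult_le_mono1[OF h, of "\<beta> (Suc j)"] by (simp add: add_mult_distrib)
  also have "\<dots> \<le> \<beta> (Suc i)" using lower[of j] j by simp
  finally have "\<beta> i + (d - 1) * \<beta> (Suc j) \<le> \<beta> (Suc i)" .
  moreover have "d - 1 \<le> (d - 1) * \<beta> (Suc j)" using pos[of j] by simp
  ultimately show ?thesis by linarith
qed

section \<open>The truncated polynomial ring\<close>

lemma (in abelian_group) coset_eq_iff:
  assumes H: "subgroup H (add_monoid G)" and xy: "x \<in> carrier G" "y \<in> carrier G"
  shows "H +> x = H +> y \<longleftrightarrow> x \<ominus> y \<in> H"
proof
  interpret H: additive_subgroup H G by (rule additive_subgroup.intro[OF H])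
  assume "H +> x = H +> y"
  moreover have "x \<in> H +> x" using xy H.zero_closed by (force simp: a_r_coset_def')
  ultimately obtain h where "h \<in> H" "x = h \<oplus> y" by (auto simp: a_r_coset_def')
  moreover from this have "h \<in> carrier G" using H.a_Hcarr by blast
  ultimately show "x \<ominus> y \<in> H" using xy by (simp add: minus_eq a_assoc r_neg)
next
  interpret H: additive_subgroup H G by (rule additive_subgroup.intro[OF H])
  assume h: "x \<ominus> y \<in> H"
  have "x = (x \<ominus> y) \<oplus> y" using xy by (simp add: minus_eq a_assoc l_neg)
  then have "x \<in> H +> y" using h by (auto simp: a_r_coset_def')
  then show "H +> x = H +> y" using a_repr_independence[OF _ xy(2) H] by simp
qed

lemma mpoly_ring_simps [simp]:
  "carrier (mpoly_ring d) = polys d" "x \<otimes>\<^bsub>mpoly_ring d\<^esub> y = x * y" "x \<oplus>\<^bsub>mpoly_ring d\<^esub> y = x + y"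
  "\<zero>\<^bsub>mpoly_ring d\<^esub> = 0" "\<one>\<^bsub>mpoly_ring d\<^esub> = 1"
  by (simp_all add: mpoly_ring_def polys_def)

lemma cring_mpoly_ring: "cring (mpoly_ring d :: ('k::field mpoly) ring)"
proof (rule cringI)
  show "abelian_group (mpoly_ring d :: ('k mpoly) ring)"
  proof (rule abelian_groupI)
    fix x :: "'k mpoly" assume "x \<in> carrier (mpoly_ring d)"
    then show "\<exists>y\<in>carrier (mpoly_ring d). y \<oplus>\<^bsub>mpoly_ring d\<^esub> x = \<zero>\<^bsub>mpoly_ring d\<^esub>"
      by (intro bexI[of _ "- x"]) (auto intro: polys_uminus)
  qed (auto intro: polys_add simp: ac_simps)
  show "Group.comm_monoid (mpoly_ring d :: ('k mpoly) ring)"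
    by (rule comm_monoidI) (auto intro: polys_mult simp: ac_simps)
qed (auto simp: algebra_simps)

interpretation mp: cring "mpoly_ring d :: ('k::field mpoly) ring" for d by (rule cring_mpoly_ring)

lemma mpoly_ring_uminus: "x \<in> polys d \<Longrightarrow> \<ominus>\<^bsub>mpoly_ring d\<^esub> x = - x"
  by (rule mp.minus_equality) (auto intro: polys_uminus)

lemma mpoly_ring_minus: "x \<in> polys d \<Longrightarrow> y \<in> polys d \<Longrightarrow> x \<ominus>\<^bsub>mpoly_ring d\<^esub> y = x - y"
  by (simp add: mp.minus_eq mpoly_ring_uminus)

lemma ideal_polys_ord_ge: "ideal (polys d \<inter> ord_ge a) (mpoly_ring d :: ('k::field mpoly) ring)"
proof (rule idealI)
  show "ring (mpoly_ring d :: ('k mpoly) ring)" by (rule mp.ring_axioms)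
  show "subgroup (polys d \<inter> ord_ge a) (add_monoid (mpoly_ring d :: ('k mpoly) ring))"
  proof (rule subgroup.intro)
    fix x :: "'k mpoly" assume "x \<in> polys d \<inter> ord_ge a"
    then show "inv\<^bsub>add_monoid (mpoly_ring d)\<^esub> x \<in> polys d \<inter> ord_ge a"
      using mpoly_ring_uminus[of x d] by (auto simp: a_inv_def intro: polys_uminus ord_ge_uminus)
  qed (auto intro: polys_add ord_ge_add)
qed (auto intro: polys_mult ord_ge_mult_left ord_ge_mult_right)

lemma polys_termwise:
  assumes "p \<in> polys d \<inter> ord_ge a" "0 \<in> S" "\<And>x y. x \<in> S \<Longrightarrow> y \<in> S \<Longrightarrow> x + y \<in> S"
    and "\<And>m c. Poly_Mapping.keys m \<subseteq> {..<d} \<Longrightarrow> a \<le> mdeg m \<Longrightarrow> Poly_Mapping.single m c \<in> S"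
  shows "(p :: 'k::field mpoly) \<in> S"
proof -
  have "p = (\<Sum>m\<in>Poly_Mapping.keys p. Poly_Mapping.single m (Poly_Mapping.lookup p m))"
    by (rule poly_mapping_eqI) (auto simp: lookup_sum lookup_single when_def in_keys_iff)
  also have "\<dots> \<in> S"
  proof -
    have "(\<Sum>m\<in>T. Poly_Mapping.single m (Poly_Mapping.lookup p m)) \<in> S" if "T \<subseteq> Poly_Mapping.keys p" for T
      using finite_subset[OF that finite_keys] that
    proof (induction T rule: finite_induct)
      case (insert m T)
      then have "Poly_Mapping.keys m \<subseteq> {..<d}" "a \<le> mdeg m"
        using assms(1) ord_geD[of p a m] by (auto simp: polys_def in_keys_iff not_le[symmetric])
      then show ?case using insert assms(3,4) by simp
    qed (simp add: assms(2))
    then show ?thesis by blast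
  qed
  finally show ?thesis .
qed

lemma single_split_variable:
  assumes "Poly_Mapping.keys m \<subseteq> {..<d}" "Suc a \<le> mdeg m"
  obtains m' i where "i < d" "Poly_Mapping.keys m' \<subseteq> {..<d}" "a \<le> mdeg m'"
    "Poly_Mapping.single m c = Poly_Mapping.single m' c * mpoly_var i"
proof -
  have "m \<noteq> 0" using assms(2) by auto
  then obtain i where i: "i \<in> Poly_Mapping.keys m" by (metis all_not_in_conv keys_eq_empty)
  define m' where "m' = m - Poly_Mapping.single i 1"
  have m: "m = m' + Poly_Mapping.single i 1"
    using i by (intro poly_mapping_eqI)
      (auto simp: m'_def lookup_add lookup_minus lookup_single when_def in_keys_iff)
  show ?thesis
  proof (rule that)
    show "i < d" using i assms(1) by auto
    show "Poly_Mapping.keys m' \<subseteq> {..<d}"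
      using assms(1) unfolding m'_def subset_iff in_keys_iff lookup_minus by force
    show "a \<le> mdeg m'" using assms(2) unfolding m mdeg_add by simp
    show "Poly_Mapping.single m c = Poly_Mapping.single m' c * mpoly_var i"
      by (simp add: mpoly_var_def mult_single m)
  qed
qed

lemma vars_ideal_eq: "vars_ideal d = (polys d \<inter> ord_ge 1 :: 'k::field mpoly set)"
proof
  have v: "mpoly_var ` {..<d} \<subseteq> (polys d \<inter> ord_ge 1 :: 'k mpoly set)"
    by (auto simp: mpoly_var_def intro!: single_polys ord_ge_single)
  show "vars_ideal d \<subseteq> (polys d \<inter> ord_ge 1 :: 'k mpoly set)"
    unfolding vars_ideal_def by (rule mp.genideal_minimal[OF ideal_polys_ord_ge v])
  have c: "mpoly_var ` {..<d} \<subseteq> carrier (mpoly_ring d :: 'k mpoly ring)" using v by auto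
  interpret I: ideal "vars_ideal d :: 'k mpoly set" "mpoly_ring d"
    unfolding vars_ideal_def by (rule mp.genideal_ideal[OF c])
  show "(polys d \<inter> ord_ge 1 :: 'k mpoly set) \<subseteq> vars_ideal d"
  proof
    fix p :: "'k mpoly" assume p: "p \<in> polys d \<inter> ord_ge 1"
    then show "p \<in> vars_ideal d"
    proof (rule polys_termwise)
      show "(0 :: 'k mpoly) \<in> vars_ideal d" using I.zero_closed by simp
      show "x + y \<in> vars_ideal d" if "x \<in> vars_ideal d" "y \<in> vars_ideal d" for x y :: "'k mpoly"
        using I.a_closed[OF that] by simp
      fix m :: "nat \<Rightarrow>\<^sub>0 nat" and e :: 'k assume m: "Poly_Mapping.keys m \<subseteq> {..<d}" "1 \<le> mdeg m"
      have m0: "Suc 0 \<le> mdeg m" using m(2) by simp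
      obtain m' i where "i < d" "Poly_Mapping.keys m' \<subseteq> {..<d}" "0 \<le> mdeg m'"
        "Poly_Mapping.single m e = Poly_Mapping.single m' e * mpoly_var i"
        by (rule single_split_variable[OF m(1) m0])
      moreover have "(mpoly_var i :: 'k mpoly) \<in> vars_ideal d"
        unfolding vars_ideal_def by (rule subsetD[OF mp.genideal_self[OF c]]) (use \<open>i < d\<close> in simp)
      ultimately show "Poly_Mapping.single m e \<in> vars_ideal d"
        using I.I_l_closed[of "mpoly_var i" "Poly_Mapping.single m' e"] by (simp add: single_polys)
    qed
  qed
qed

lemma ideal_prod_ord_ge:
  "ideal_prod (mpoly_ring d) (polys d \<inter> ord_ge a) (polys d \<inter> ord_ge 1) = (polys d \<inter> ord_ge (Suc a) :: 'k::field mpoly set)"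
    (is "?P = ?I")
proof
  show "?P \<subseteq> ?I"
  proof
    fix s assume "s \<in> ?P"
    then show "s \<in> ?I"
    proof (induction rule: ideal_prod.induct)
      case (prod i j)
      then show ?case using ord_ge_mult[of i a j 1] by (auto intro: polys_mult)
    qed (auto intro: polys_add ord_ge_add)
  qed
  show "?I \<subseteq> ?P"
  proof
    fix p :: "'k mpoly" assume p: "p \<in> ?I"
    then show "p \<in> ?P"
    proof (rule polys_termwise)
      show "0 \<in> ?P" using ideal_prod.prod[of 0 "polys d \<inter> ord_ge a" 0 "polys d \<inter> ord_ge 1" "mpoly_ring d"] by simp
      show "x + y \<in> ?P" if "x \<in> ?P" "y \<in> ?P" for x y
        using ideal_prod.sum[OF that] by simp
      fix m :: "nat \<Rightarrow>\<^sub>0 nat" and e :: 'k assume m: "Poly_Mapping.keys m \<subseteq> {..<d}" "Suc a \<le> mdeg m"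
      obtain m' i where *: "i < d" "Poly_Mapping.keys m' \<subseteq> {..<d}" "a \<le> mdeg m'"
        "Poly_Mapping.single m e = Poly_Mapping.single m' e * mpoly_var i"
        by (rule single_split_variable[OF m])
      have "mpoly_var i \<in> (polys d \<inter> ord_ge 1 :: 'k mpoly set)"
        using * by (auto simp: mpoly_var_def intro!: single_polys ord_ge_single)
      moreover have "Poly_Mapping.single m' e \<in> polys d \<inter> ord_ge a"
        using * by (auto intro!: single_polys ord_ge_single)
      ultimately show "Poly_Mapping.single m e \<in> ?P"
        using ideal_prod.prod[of "Poly_Mapping.single m' e" "polys d \<inter> ord_ge a" "mpoly_var i" "polys d \<inter> ord_ge 1" "mpoly_ring d"] *(4) by simp
    qed
  qed
qed

lemma vars_ideal_power: "vars_ideal d [^]\<^bsub>ideals_set (mpoly_ring d)\<^esub> (t::nat) = (polys d \<inter> ord_ge t :: 'k::field mpoly set)"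
proof (induction t)
  case 0
  show ?case by (simp add: nat_pow_def ideals_set_def)
next
  case (Suc t)
  have "(vars_ideal d :: 'k mpoly set) [^]\<^bsub>ideals_set (mpoly_ring d)\<^esub> (Suc t)
    = ideal_prod (mpoly_ring d) (vars_ideal d [^]\<^bsub>ideals_set (mpoly_ring d)\<^esub> t) (vars_ideal d)"
    by (simp add: nat_pow_def ideals_set_def)
  also have "\<dots> = polys d \<inter> ord_ge (Suc t)" unfolding Suc.IH unfolding vars_ideal_eq by (rule ideal_prod_ord_ge)
  finally show ?case .
qed

text \<open>The ring is a locale parameter with a defining equation, so that its carrier can be treated abstractly
  as the image of \<open>polys d\<close> under \<open>pr\<close>.\<close>

locale trunc_ring =
  fixes d t :: nat and R :: "('k::field mpoly set) ring"
  assumes R_def: "R = trunc_poly_ring d t" and t_pos: "t > 0"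
begin

definition pr :: "'k mpoly \<Rightarrow> 'k mpoly set" where
  "pr p = (polys d \<inter> ord_ge t) +>\<^bsub>mpoly_ring d\<^esub> p"

lemma R_eq: "R = mpoly_ring d Quot (polys d \<inter> ord_ge t)"
  unfolding R_def trunc_poly_ring_def vars_ideal_power ..

sublocale I: ideal "polys d \<inter> ord_ge t" "mpoly_ring d :: 'k mpoly ring" by (rule ideal_polys_ord_ge)

sublocale R: cring R unfolding R_eq by (rule I.quotient_is_cring[OF cring_mpoly_ring])

lemma carrier_R: "carrier R = pr ` polys d"
  unfolding R_eq FactRing_def A_RCOSETS_def' pr_def by auto

lemma pr_carrier [simp, intro]: "p \<in> polys d \<Longrightarrow> pr p \<in> carrier R" by (simp add: carrier_R)

lemma carrierE: assumes "X \<in> carrier R" obtains p where "p \<in> polys d" "X = pr p"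
  using assms by (auto simp: carrier_R)

lemma pr_eq_iff: "p \<in> polys d \<Longrightarrow> q \<in> polys d \<Longrightarrow> pr p = pr q \<longleftrightarrow> p - q \<in> ord_ge t"
  unfolding pr_def using mp.coset_eq_iff[OF I.a_subgroup, of p q]
  by (simp add: mpoly_ring_minus polys_diff)

lemma pr_hom: "pr \<in> ring_hom (mpoly_ring d) R"
  unfolding pr_def R_eq by (rule I.rcos_ring_hom)

lemma pr_add: "p \<in> polys d \<Longrightarrow> q \<in> polys d \<Longrightarrow> pr (p + q) = pr p \<oplus>\<^bsub>R\<^esub> pr q"
  using ring_hom_add[OF pr_hom, of p q] by simp
lemma pr_mult: "p \<in> polys d \<Longrightarrow> q \<in> polys d \<Longrightarrow> pr (p * q) = pr p \<otimes>\<^bsub>R\<^esub> pr q"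
  using ring_hom_mult[OF pr_hom, of p q] by simp
lemma pr_one: "pr 1 = \<one>\<^bsub>R\<^esub>" using ring_hom_one[OF pr_hom] by simp
lemma pr_zero: "pr 0 = \<zero>\<^bsub>R\<^esub>"
  using ring_hom_zero[OF pr_hom mp.ring_axioms R.ring_axioms] by simp
lemma pr_eq_zero_iff: "p \<in> polys d \<Longrightarrow> pr p = \<zero>\<^bsub>R\<^esub> \<longleftrightarrow> p \<in> ord_ge t"
  using pr_eq_iff[of p 0] by (simp add: pr_zero)

text \<open>Zero is lifted to zero so that lifts of vectors of length \<open>b\<close> vanish from index \<open>b\<close> on.\<close>

definition lift :: "'k mpoly set \<Rightarrow> 'k mpoly" where
  "lift X = (if X = \<zero>\<^bsub>R\<^esub> then 0 else SOME p. p \<in> polys d \<and> pr p = X)"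

lemma lift: "X \<in> carrier R \<Longrightarrow> lift X \<in> polys d \<and> pr (lift X) = X"
proof (cases "X = \<zero>\<^bsub>R\<^esub>")
  case False
  assume "X \<in> carrier R"
  then have "\<exists>p. p \<in> polys d \<and> pr p = X" by (auto simp: carrier_R)
  from someI_ex[OF this] False show ?thesis by (simp add: lift_def)
qed (simp add: lift_def pr_zero)

lemma lift_zero [simp]: "lift \<zero>\<^bsub>R\<^esub> = 0" by (simp add: lift_def)

definition ct :: "'k mpoly set \<Rightarrow> 'k" where "ct X = Poly_Mapping.lookup (lift X) 0"

lemma ct_pr: "p \<in> polys d \<Longrightarrow> ct (pr p) = Poly_Mapping.lookup p 0"
proof -
  assume p: "p \<in> polys d"
  then have "lift (pr p) - p \<in> ord_ge t" using lift[of "pr p"] pr_eq_iff[of "lift (pr p)" p] by auto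
  then have "Poly_Mapping.lookup (lift (pr p) - p) 0 = 0" using t_pos by (intro ord_geD) auto
  then show ?thesis by (simp add: ct_def lookup_minus)
qed

lemma ct_add: "X \<in> carrier R \<Longrightarrow> Y \<in> carrier R \<Longrightarrow> ct (X \<oplus>\<^bsub>R\<^esub> Y) = ct X + ct Y"
  by (elim carrierE) (simp add: pr_add[symmetric] ct_pr polys_add lookup_add)
lemma ct_mult: "X \<in> carrier R \<Longrightarrow> Y \<in> carrier R \<Longrightarrow> ct (X \<otimes>\<^bsub>R\<^esub> Y) = ct X * ct Y"
  by (elim carrierE) (simp add: pr_mult[symmetric] ct_pr polys_mult lookup_0_mult)
lemma ct_one [simp]: "ct \<one>\<^bsub>R\<^esub> = 1" using ct_pr[of 1] by (simp add: pr_one)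
lemma ct_zero [simp]: "ct \<zero>\<^bsub>R\<^esub> = 0" using ct_pr[of 0] by (simp add: pr_zero)
lemma ct_uminus: "X \<in> carrier R \<Longrightarrow> ct (\<ominus>\<^bsub>R\<^esub> X) = - ct X"
  using ct_add[of X "\<ominus>\<^bsub>R\<^esub> X"] by (simp add: R.r_neg add_eq_0_iff)

definition kc :: "'k \<Rightarrow> 'k mpoly set" where "kc c = pr (Poly_Mapping.single 0 c)"

lemma kc_carrier [simp, intro]: "kc c \<in> carrier R" by (simp add: kc_def single_polys)
lemma ct_kc [simp]: "ct (kc c) = c" by (simp add: kc_def ct_pr single_polys)

definition mm :: "'k mpoly set set" where "mm = {X \<in> carrier R. ct X = 0}"

lemma ideal_mm: "ideal mm R"
proof (rule idealI)
  show "ring R" by (rule R.ring_axioms)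
  show "subgroup mm (add_monoid R)"
  proof (rule subgroup.intro)
    fix x assume "x \<in> mm"
    then show "inv\<^bsub>add_monoid R\<^esub> x \<in> mm"
      using ct_uminus[of x] R.a_inv_closed[of x] by (auto simp: mm_def a_inv_def)
  qed (auto simp: mm_def ct_add)
qed (auto simp: mm_def ct_mult)

text \<open>The geometric series inverts a polynomial with nonzero constant term, since powers of a
  polynomial without constant term vanish modulo \<open>\<nn>\<^sup>t\<close>.\<close>

lemma unit_if_ct_nonzero:
  assumes "X \<in> carrier R" "ct X \<noteq> 0"
  obtains Y where "Y \<in> carrier R" "Y \<otimes>\<^bsub>R\<^esub> X = \<one>\<^bsub>R\<^esub>"
proof -
  obtain p where p: "p \<in> polys d" "X = pr p" using assms(1) by (rule carrierE)
  define c where "c = Poly_Mapping.lookup p 0"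
  have c: "c \<noteq> 0" using assms(2) p by (simp add: c_def ct_pr)
  define q where "q = 1 - Poly_Mapping.single 0 (inverse c) * p"
  have qp: "q \<in> polys d" unfolding q_def using p(1) by (intro polys_diff polys_mult single_polys) auto
  have q1: "q \<in> ord_ge (Suc 0)" using c by (simp add: ord_ge_1_iff q_def lookup_minus lookup_one c_def)
  have qpow: "q ^ i \<in> polys d \<and> q ^ i \<in> ord_ge i" for i
  proof (induction i)
    case (Suc i)
    then show ?case using qp q1 ord_ge_mult[of q "Suc 0" "q ^ i" i] by (auto intro: polys_mult)
  qed simp
  define s where "s = (\<Sum>i<t. q ^ i) * Poly_Mapping.single 0 (inverse c)"
  have sp: "s \<in> polys d" unfolding s_def using qpow by (intro polys_mult polys_sum single_polys) auto
  have "s * p = (1 - q) * (\<Sum>i<t. q ^ i)" by (simp add: s_def q_def algebra_simps)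
  also have "\<dots> = 1 - q ^ t" by (rule one_diff_power_eq[symmetric])
  finally have "s * p - 1 = - (q ^ t)" by simp
  then have "s * p - 1 \<in> ord_ge t" using qpow[of t] ord_ge_uminus by metis
  then have "pr (s * p) = pr 1" using pr_eq_iff[of "s * p" 1] sp p by (simp add: polys_mult)
  then have "pr s \<otimes>\<^bsub>R\<^esub> X = \<one>\<^bsub>R\<^esub>" using sp p by (simp add: pr_mult pr_one)
  then show ?thesis using that sp by blast
qed

lemma ideal_not_in_mm: "ideal J R \<Longrightarrow> X \<in> J \<Longrightarrow> X \<notin> mm \<Longrightarrow> J = carrier R"
proof -
  assume J: "ideal J R" and X: "X \<in> J" "X \<notin> mm"
  interpret J: ideal J R by (rule J)
  have Xc: "X \<in> carrier R" using X(1) by (rule J.Icarr)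
  then have "ct X \<noteq> 0" using X by (simp add: mm_def)
  then obtain Y where "Y \<in> carrier R" "Y \<otimes>\<^bsub>R\<^esub> X = \<one>\<^bsub>R\<^esub>" by (rule unit_if_ct_nonzero[OF Xc])
  then have "\<one>\<^bsub>R\<^esub> \<in> J" using J.I_l_closed[OF X(1)] by metis
  then show ?thesis by (rule J.one_imp_carrier)
qed

lemma maximalideal_mm: "maximalideal mm R"
proof (rule maximalidealI[OF ideal_mm])
  have "\<one>\<^bsub>R\<^esub> \<notin> mm" by (simp add: mm_def)
  then show "carrier R \<noteq> mm" by auto
  fix J assume "ideal J R" "mm \<subseteq> J" "J \<subseteq> carrier R"
  then show "J = mm \<or> J = carrier R" using ideal_not_in_mm[of J] by blast
qed

lemma local_max_ideal_eq: "local_max_ideal R = mm"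
  unfolding local_max_ideal_def
proof (rule the_equality)
  show "maximalideal mm R" by (rule maximalideal_mm)
  fix J assume J: "maximalideal J R"
  interpret J: maximalideal J R by (rule J)
  have "J \<subseteq> mm" using ideal_not_in_mm[OF J.ideal_axioms] J.I_notcarr by blast
  then show "J = mm" using J.I_maximal[OF ideal_mm] maximalideal.I_notcarr[OF maximalideal_mm]
    by (auto simp: mm_def)
qed

abbreviation "K \<equiv> residue_field R"

lemma K_eq: "K = R Quot mm" by (simp add: residue_field_def local_max_ideal_eq)

lemma field_K: "field K"
  unfolding K_eq by (rule maximalideal.quotient_is_field[OF maximalideal_mm R.cring_axioms])

lemma subgroup_mm: "subgroup mm (add_monoid R)"
  using additive_subgroup.a_subgroup[OF ideal.axioms(1)[OF ideal_mm]] .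

definition rs :: "'k mpoly set \<Rightarrow> 'k mpoly set set" where "rs X = mm +>\<^bsub>R\<^esub> X"

lemma carrier_K: "carrier K = rs ` carrier R"
  unfolding K_eq FactRing_def A_RCOSETS_def' rs_def by auto

lemma minus_mm_iff: "X \<in> carrier R \<Longrightarrow> Y \<in> carrier R \<Longrightarrow> X \<ominus>\<^bsub>R\<^esub> Y \<in> mm \<longleftrightarrow> ct X = ct Y"
  unfolding mm_def a_minus_def using ct_add[of X "\<ominus>\<^bsub>R\<^esub> Y"] ct_uminus[of Y] by simp

lemma rs_eq_iff: "X \<in> carrier R \<Longrightarrow> Y \<in> carrier R \<Longrightarrow> rs X = rs Y \<longleftrightarrow> ct X = ct Y"
  unfolding rs_def using R.coset_eq_iff[OF subgroup_mm, of X Y] minus_mm_iff[of X Y] by (rule trans)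

lemma rs_hom: "rs \<in> ring_hom R K" unfolding rs_def K_eq by (rule ideal.rcos_ring_hom[OF ideal_mm])

lemma mem_rs: "X \<in> carrier R \<Longrightarrow> Y \<in> rs X \<longleftrightarrow> Y \<in> carrier R \<and> ct Y = ct X"
proof
  assume X: "X \<in> carrier R" and Y: "Y \<in> rs X"
  then obtain Z where "Z \<in> carrier R" "ct Z = 0" "Y = Z \<oplus>\<^bsub>R\<^esub> X"
    by (auto simp: rs_def a_r_coset_def' mm_def)
  then show "Y \<in> carrier R \<and> ct Y = ct X" using X by (simp add: ct_add)
next
  assume X: "X \<in> carrier R" and Y: "Y \<in> carrier R \<and> ct Y = ct X"
  have "Y = (Y \<ominus>\<^bsub>R\<^esub> X) \<oplus>\<^bsub>R\<^esub> X" using X Y by (simp add: R.minus_eq R.a_assoc R.l_neg)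
  moreover have "Y \<ominus>\<^bsub>R\<^esub> X \<in> mm" using X Y by (simp add: minus_mm_iff)
  ultimately show "Y \<in> rs X" by (auto simp: rs_def a_r_coset_def')
qed

text \<open>The identification of the residue field with \<open>k\<close>. The choice operator makes the action
  of a residue class in \<open>residue_space\<close> the multiplication by this scalar.\<close>

definition kt :: "'k mpoly set set \<Rightarrow> 'k" where "kt Z = ct (SOME X. X \<in> Z)"

lemma some_rs: "X \<in> carrier R \<Longrightarrow> (SOME Y. Y \<in> rs X) \<in> carrier R \<and> ct (SOME Y. Y \<in> rs X) = ct X"
  using someI[of "\<lambda>Y. Y \<in> rs X" X] mem_rs[of X X] mem_rs[of X "SOME Y. Y \<in> rs X"] by blast

lemma kt_rs [simp]: "X \<in> carrier R \<Longrightarrow> kt (rs X) = ct X"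
  by (simp add: kt_def some_rs)

lemma carrier_KE: assumes "Z \<in> carrier K" obtains c where "Z = rs (kc c)" "kt Z = c"
proof -
  obtain X where X: "X \<in> carrier R" "Z = rs X" using assms by (auto simp: carrier_K)
  then have "Z = rs (kc (ct X))" using rs_eq_iff[of X "kc (ct X)"] by simp
  then show ?thesis using that X by simp
qed

end

section \<open>Free modules over the truncated ring\<close>

lemma free_mod_on_simps [simp]:
  "carrier (free_mod_on R S) = {c. (\<forall>s\<in>S. c s \<in> carrier R) \<and> (\<forall>s. s \<notin> S \<longrightarrow> c s = \<zero>\<^bsub>R\<^esub>) \<and>
       finite {s. c s \<noteq> \<zero>\<^bsub>R\<^esub>}}"
  "\<zero>\<^bsub>free_mod_on R S\<^esub> = (\<lambda>s. \<zero>\<^bsub>R\<^esub>)"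
  "c \<oplus>\<^bsub>free_mod_on R S\<^esub> c' = (\<lambda>s. c s \<oplus>\<^bsub>R\<^esub> c' s)"
  "r \<odot>\<^bsub>free_mod_on R S\<^esub> c = (\<lambda>s. r \<otimes>\<^bsub>R\<^esub> c s)"
  by (simp_all add: free_mod_on_def)

lemma free_mod_on_outside: "c \<in> carrier (free_mod_on R S) \<Longrightarrow> s \<notin> S \<Longrightarrow> c s = \<zero>\<^bsub>R\<^esub>"
  by simp

lemma free_mod_on_finite: "c \<in> carrier (free_mod_on R S) \<Longrightarrow> finite {s. c s \<noteq> \<zero>\<^bsub>R\<^esub>}"
  by simp

lemma free_mod_on_memI:
  "(\<And>s. s \<in> S \<Longrightarrow> c s \<in> carrier R) \<Longrightarrow> (\<And>s. s \<notin> S \<Longrightarrow> c s = \<zero>\<^bsub>R\<^esub>) \<Longrightarrow> finite {s. c s \<noteq> \<zero>\<^bsub>R\<^esub>}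
    \<Longrightarrow> c \<in> carrier (free_mod_on R S)"
  by simp

lemma (in cring) free_mod_on_value: "c \<in> carrier (free_mod_on R S) \<Longrightarrow> c s \<in> carrier R"
  by (cases "s \<in> S") auto

lemma (in cring) free_mod_on_module: "Module.module R (free_mod_on R S)"
proof (rule moduleI)
  show "cring R" by (rule cring_axioms)
  show "abelian_group (free_mod_on R S)"
  proof (rule abelian_groupI)
    fix x y assume x: "x \<in> carrier (free_mod_on R S)" and y: "y \<in> carrier (free_mod_on R S)"
    have "{s. x s \<oplus> y s \<noteq> \<zero>} \<subseteq> {s. x s \<noteq> \<zero>} \<union> {s. y s \<noteq> \<zero>}" by auto
    then have "finite {s. x s \<oplus> y s \<noteq> \<zero>}" by (rule finite_subset) (use x y in \<open>simp only: free_mod_on_simps finite_Un mem_Collect_eq\<close>)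
    then show "x \<oplus>\<^bsub>free_mod_on R S\<^esub> y \<in> carrier (free_mod_on R S)" using x y by auto
    show "x \<oplus>\<^bsub>free_mod_on R S\<^esub> y = y \<oplus>\<^bsub>free_mod_on R S\<^esub> x"
      using free_mod_on_value[OF x] free_mod_on_value[OF y] by (auto simp: fun_eq_iff a_comm)
    fix z assume z: "z \<in> carrier (free_mod_on R S)"
    show "x \<oplus>\<^bsub>free_mod_on R S\<^esub> y \<oplus>\<^bsub>free_mod_on R S\<^esub> z = x \<oplus>\<^bsub>free_mod_on R S\<^esub> (y \<oplus>\<^bsub>free_mod_on R S\<^esub> z)"
      using free_mod_on_value[OF x] free_mod_on_value[OF y] free_mod_on_value[OF z] by (auto simp: fun_eq_iff a_assoc)
  next
    fix x assume x: "x \<in> carrier (free_mod_on R S)"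
    show "\<zero>\<^bsub>free_mod_on R S\<^esub> \<oplus>\<^bsub>free_mod_on R S\<^esub> x = x"
      using free_mod_on_value[OF x] by (auto simp: fun_eq_iff)
    have "{s. \<ominus> x s \<noteq> \<zero>} \<subseteq> {s. x s \<noteq> \<zero>}" by auto
    then have "finite {s. \<ominus> x s \<noteq> \<zero>}" by (rule finite_subset) (use x in \<open>simp only: free_mod_on_simps mem_Collect_eq\<close>)
    then show "\<exists>y\<in>carrier (free_mod_on R S). y \<oplus>\<^bsub>free_mod_on R S\<^esub> x = \<zero>\<^bsub>free_mod_on R S\<^esub>"
      using x free_mod_on_value[OF x] by (intro bexI[of _ "\<lambda>s. \<ominus> x s"]) (auto simp: l_neg)
  qed auto
next
  fix a x assume a: "a \<in> carrier R" and x: "x \<in> carrier (free_mod_on R S)"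
  have "{s. a \<otimes> x s \<noteq> \<zero>} \<subseteq> {s. x s \<noteq> \<zero>}" using a by auto
  then have "finite {s. a \<otimes> x s \<noteq> \<zero>}" by (rule finite_subset) (use x in \<open>simp only: free_mod_on_simps mem_Collect_eq\<close>)
  then show "a \<odot>\<^bsub>free_mod_on R S\<^esub> x \<in> carrier (free_mod_on R S)" using a x by auto
next
  fix a b x assume a: "a \<in> carrier R" "b \<in> carrier R" and x: "x \<in> carrier (free_mod_on R S)"
  show "(a \<oplus> b) \<odot>\<^bsub>free_mod_on R S\<^esub> x = a \<odot>\<^bsub>free_mod_on R S\<^esub> x \<oplus>\<^bsub>free_mod_on R S\<^esub> b \<odot>\<^bsub>free_mod_on R S\<^esub> x"
    using a free_mod_on_value[OF x] by (auto simp: fun_eq_iff l_distr)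
  show "(a \<otimes> b) \<odot>\<^bsub>free_mod_on R S\<^esub> x = a \<odot>\<^bsub>free_mod_on R S\<^esub> (b \<odot>\<^bsub>free_mod_on R S\<^esub> x)"
    using a free_mod_on_value[OF x] by (auto simp: fun_eq_iff m_assoc)
next
  fix a x y assume a: "a \<in> carrier R" and x: "x \<in> carrier (free_mod_on R S)" and y: "y \<in> carrier (free_mod_on R S)"
  show "a \<odot>\<^bsub>free_mod_on R S\<^esub> (x \<oplus>\<^bsub>free_mod_on R S\<^esub> y) = a \<odot>\<^bsub>free_mod_on R S\<^esub> x \<oplus>\<^bsub>free_mod_on R S\<^esub> a \<odot>\<^bsub>free_mod_on R S\<^esub> y"
    using a free_mod_on_value[OF x] free_mod_on_value[OF y] by (auto simp: fun_eq_iff r_distr)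
next
  fix x assume x: "x \<in> carrier (free_mod_on R S)"
  show "\<one> \<odot>\<^bsub>free_mod_on R S\<^esub> x = x" using free_mod_on_value[OF x] by (auto simp: fun_eq_iff)
qed

lemma (in Module.module) hom_zero:
  assumes "f \<in> LinearCombinations.module_hom R M N" "Module.module R N"
  shows "f \<zero>\<^bsub>M\<^esub> = \<zero>\<^bsub>N\<^esub>"
proof -
  interpret N: Module.module R N by (rule assms(2))
  have c: "f \<zero>\<^bsub>M\<^esub> \<in> carrier N" using assms(1) by (auto simp: LinearCombinations.module_hom_def)
  have "f (\<zero> \<odot>\<^bsub>M\<^esub> \<zero>\<^bsub>M\<^esub>) = \<zero> \<odot>\<^bsub>N\<^esub> f \<zero>\<^bsub>M\<^esub>"
    by (rule LinearCombinations.module_hom_smult[OF assms(1)]) simp_all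
  moreover have "\<zero> \<odot>\<^bsub>M\<^esub> \<zero>\<^bsub>M\<^esub> = \<zero>\<^bsub>M\<^esub>" by (rule smult_l_null) simp
  moreover have "\<zero> \<odot>\<^bsub>N\<^esub> f \<zero>\<^bsub>M\<^esub> = \<zero>\<^bsub>N\<^esub>" by (rule N.smult_l_null[OF c])
  ultimately show ?thesis by (simp only:)
qed

context trunc_ring
begin

abbreviation F :: "nat \<Rightarrow> ('k mpoly set, nat \<Rightarrow> 'k mpoly set) module" where
  "F b \<equiv> free_mod_on R {..<b}"

lemma module_F: "Module.module R (F b)" by (rule R.free_mod_on_module)

definition prv :: "(nat \<Rightarrow> 'k mpoly) \<Rightarrow> nat \<Rightarrow> 'k mpoly set" where
  "prv v = (\<lambda>j. pr (v j))"

definition liftv :: "(nat \<Rightarrow> 'k mpoly set) \<Rightarrow> nat \<Rightarrow> 'k mpoly" where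
  "liftv c = (\<lambda>j. lift (c j))"

lemma F_carrier_iff: "c \<in> carrier (F b) \<longleftrightarrow> (\<forall>j<b. c j \<in> carrier R) \<and> (\<forall>j\<ge>b. c j = \<zero>\<^bsub>R\<^esub>)"
proof -
  have "finite {s. c s \<noteq> \<zero>\<^bsub>R\<^esub>}" if "\<forall>j\<ge>b. c j = \<zero>\<^bsub>R\<^esub>"
    by (rule finite_subset[of _ "{..<b}"]) (use that in \<open>force simp: not_le[symmetric]\<close>, simp)
  then show ?thesis by (auto simp only: free_mod_on_simps mem_Collect_eq lessThan_iff not_less Ball_def)
qed

lemma prv_carrier [intro]: "v \<in> pvec d b \<Longrightarrow> prv v \<in> carrier (F b)"
  unfolding F_carrier_iff by (auto simp: pvec_def prv_def pr_zero)

lemma liftv_pvec: "c \<in> carrier (F b) \<Longrightarrow> liftv c \<in> pvec d b"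
  unfolding F_carrier_iff pvec_def liftv_def using lift by (auto) (metis lift_zero not_le zero_polys)

lemma prv_liftv: "c \<in> carrier (F b) \<Longrightarrow> prv (liftv c) = c"
  using lift R.free_mod_on_value[of c "{..<b}"] by (auto simp: prv_def liftv_def)

lemma F_carrierE: assumes "c \<in> carrier (F b)" obtains v where "v \<in> pvec d b" "c = prv v"
  using assms liftv_pvec prv_liftv that by metis

lemma pvecD: "v \<in> pvec d b \<Longrightarrow> v j \<in> polys d" by (simp add: pvec_def)

lemma prv_eq_iff: "v \<in> pvec d b \<Longrightarrow> w \<in> pvec d b \<Longrightarrow> prv v = prv w \<longleftrightarrow> v - w \<in> ordv t"
  by (auto simp: prv_def fun_eq_iff pr_eq_iff[OF pvecD pvecD] ordv_def)

lemma prv_add: "v \<in> pvec d b \<Longrightarrow> w \<in> pvec d b \<Longrightarrow> prv (v + w) = prv v \<oplus>\<^bsub>F b\<^esub> prv w"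
  by (auto simp: prv_def fun_eq_iff pr_add[OF pvecD pvecD])
lemma prv_scale: "p \<in> polys d \<Longrightarrow> v \<in> pvec d b \<Longrightarrow> prv (pscale p v) = pr p \<odot>\<^bsub>F b\<^esub> prv v"
  by (auto simp: prv_def fun_eq_iff pr_mult[OF _ pvecD])
lemma prv_zero: "prv 0 = \<zero>\<^bsub>F b\<^esub>" by (auto simp: prv_def pr_zero)
lemma prv_eq_zero_iff: "v \<in> pvec d b \<Longrightarrow> prv v = \<zero>\<^bsub>F b\<^esub> \<longleftrightarrow> v \<in> ordv t"
  unfolding prv_zero[of b, symmetric] using prv_eq_iff[of v b 0] by simp

lemma unitv_pvec: "l < b \<Longrightarrow> unitv l \<in> pvec d b" by (auto simp: unitv_def pvec_def)

lemma pvec_eq_sum_unitv: "v \<in> pvec d b \<Longrightarrow> v = (\<Sum>l<b. pscale (v l) (unitv l))"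
proof
  fix j assume "v \<in> pvec d b"
  moreover have "(\<Sum>l<b. pscale (v l) (unitv l)) j = (\<Sum>l<b. if l = j then v j else 0)"
    unfolding sum_fun_apply by (intro sum.cong) (auto simp: unitv_def)
  ultimately show "v j = (\<Sum>l<b. pscale (v l) (unitv l)) j" by (auto simp: pvec_def)
qed

lemma mv_unitv: "l < m \<Longrightarrow> mv m A (unitv l) = (\<lambda>j. A j l)"
  unfolding unitv_def by (rule mv_single_vec)

lemma hom_matrix:
  assumes \<delta>: "\<delta> \<in> LinearCombinations.module_hom R (F m) (F b)"
  obtains A where "A \<in> pmat d b" "\<And>v. v \<in> pvec d m \<Longrightarrow> \<delta> (prv v) = prv (mv m A v)"
proof
  define A where "A = (\<lambda>j l. if l < m then liftv (\<delta> (prv (unitv l))) j else 0)"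
  have \<delta>c: "c \<in> carrier (F m) \<Longrightarrow> \<delta> c \<in> carrier (F b)" for c
    using \<delta> unfolding LinearCombinations.module_hom_def by blast
  have col: "(\<lambda>j. A j l) \<in> pvec d b" for l
    using liftv_pvec[OF \<delta>c[OF prv_carrier[OF unitv_pvec]], of l] by (cases "l < m") (auto simp: A_def pvec_def)
  then show A: "A \<in> pmat d b" by (simp add: pmat_def)
  have colp: "prv (\<lambda>j. A j l) = \<delta> (prv (unitv l))" if "l < m" for l
    using prv_liftv[OF \<delta>c[OF prv_carrier[OF unitv_pvec[OF that]]]] that by (simp add: A_def)
  fix v :: "nat \<Rightarrow> 'k mpoly" assume v: "v \<in> pvec d m"
  have "\<delta> (prv (\<Sum>l\<in>S. pscale (v l) (unitv l))) = prv (mv m A (\<Sum>l\<in>S. pscale (v l) (unitv l)))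
      \<and> (\<Sum>l\<in>S. pscale (v l) (unitv l)) \<in> pvec d m" if "S \<subseteq> {..<m}" for S
    using finite_subset[OF that finite_lessThan] that
  proof (induction S rule: finite_induct)
    case empty
    have "\<delta> \<zero>\<^bsub>F m\<^esub> = \<zero>\<^bsub>F b\<^esub>" using module.hom_zero[OF module_F \<delta> module_F] .
    then have e: "\<delta> (prv 0) = prv 0" unfolding prv_zero[of m, symmetric] prv_zero[of b, symmetric] .
    show ?case unfolding sum.empty mv_zero by (intro conjI e zero_pvec)
  next
    case (insert l S)
    let ?s = "\<Sum>l\<in>S. pscale (v l) (unitv l)"
    have l: "l < m" and vl: "v l \<in> polys d" using insert v by (auto simp: pvec_def)
    have sp: "?s \<in> pvec d m" and IH: "\<delta> (prv ?s) = prv (mv m A ?s)" using insert by auto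
    have up: "pscale (v l) (unitv l) \<in> pvec d m" using vl unitv_pvec[OF l] by (rule pvec_pscale)
    have "\<delta> (prv (pscale (v l) (unitv l) + ?s)) = \<delta> (prv (pscale (v l) (unitv l)) \<oplus>\<^bsub>F m\<^esub> prv ?s)"
      by (simp only: prv_add[OF up sp])
    also have "\<dots> = \<delta> (prv (pscale (v l) (unitv l))) \<oplus>\<^bsub>F b\<^esub> \<delta> (prv ?s)"
      using LinearCombinations.module_hom_add[OF \<delta> prv_carrier[OF up] prv_carrier[OF sp]] .
    also have "\<delta> (prv (pscale (v l) (unitv l))) = pr (v l) \<odot>\<^bsub>F b\<^esub> \<delta> (prv (unitv l))"
      unfolding prv_scale[OF vl unitv_pvec[OF l]]
      by (rule LinearCombinations.module_hom_smult[OF \<delta> pr_carrier[OF vl] prv_carrier[OF unitv_pvec[OF l]]])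
    also have "\<dots> = prv (pscale (v l) (mv m A (unitv l)))"
      unfolding colp[OF l, symmetric] mv_unitv[OF l] by (rule prv_scale[OF vl col, symmetric])
    also have "\<dots> \<oplus>\<^bsub>F b\<^esub> \<delta> (prv ?s) = prv (pscale (v l) (mv m A (unitv l)) + mv m A ?s)"
      unfolding IH by (rule prv_add[OF pvec_pscale[OF vl pvec_mv[OF A unitv_pvec[OF l]]] pvec_mv[OF A sp], symmetric])
    also have "pscale (v l) (mv m A (unitv l)) + mv m A ?s = mv m A (pscale (v l) (unitv l) + ?s)"
      by (simp only: mv_add mv_scale)
    finally show ?case unfolding sum.insert[OF insert.hyps(1,2)] using pvec_add[OF up sp] by blast
  qed
  from this[of "{..<m}"] show "\<delta> (prv v) = prv (mv m A v)" using pvec_eq_sum_unitv[OF v] by simp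
qed

lemma matrix_hom:
  assumes A: "A \<in> pmat d b"
  shows "(\<lambda>c. prv (mv m A (liftv c))) \<in> LinearCombinations.module_hom R (F m) (F b)"
    and "v \<in> pvec d m \<Longrightarrow> prv (mv m A (liftv (prv v))) = prv (mv m A v)"
proof -
  have wd: "prv (mv m A (liftv (prv v))) = prv (mv m A v)" if v: "v \<in> pvec d m" for v
  proof -
    have l: "liftv (prv v) \<in> pvec d m" using liftv_pvec[OF prv_carrier[OF v]] .
    have "liftv (prv v) - v \<in> ordv t"
      using prv_eq_iff[OF l v] prv_liftv[OF prv_carrier[OF v]] by simp
    then have "mv m A (liftv (prv v)) - mv m A v \<in> ordv t" unfolding mv_diff[symmetric] by (rule ordv_mv)
    then show ?thesis using prv_eq_iff[OF pvec_mv[OF A l] pvec_mv[OF A v]] by simp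
  qed
  then show "v \<in> pvec d m \<Longrightarrow> prv (mv m A (liftv (prv v))) = prv (mv m A v)" .
  show "(\<lambda>c. prv (mv m A (liftv c))) \<in> LinearCombinations.module_hom R (F m) (F b)"
    unfolding LinearCombinations.module_hom_def
  proof (intro CollectI conjI ballI allI impI Pi_I)
    fix c assume "c \<in> carrier (F m)"
    then show "prv (mv m A (liftv c)) \<in> carrier (F b)" by (intro prv_carrier pvec_mv[OF A] liftv_pvec)
  next
    fix c c' assume "c \<in> carrier (F m) \<and> c' \<in> carrier (F m)"
    then obtain v v' where v: "v \<in> pvec d m" "c = prv v" "v' \<in> pvec d m" "c' = prv v'" by (metis F_carrierE)
    show "prv (mv m A (liftv (c \<oplus>\<^bsub>F m\<^esub> c'))) = prv (mv m A (liftv c)) \<oplus>\<^bsub>F b\<^esub> prv (mv m A (liftv c'))"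
      unfolding v(2,4) prv_add[OF v(1,3), symmetric]
      by (simp only: wd v pvec_add mv_add prv_add[OF pvec_mv[OF A v(1)] pvec_mv[OF A v(3)]])
  next
    fix r c assume "r \<in> carrier R \<and> c \<in> carrier (F m)"
    then obtain p v where v: "p \<in> polys d" "r = pr p" "v \<in> pvec d m" "c = prv v" by (metis F_carrierE carrierE)
    show "prv (mv m A (liftv (r \<odot>\<^bsub>F m\<^esub> c))) = r \<odot>\<^bsub>F b\<^esub> prv (mv m A (liftv c))"
      unfolding v(2,4) prv_scale[OF v(1,3), symmetric]
      by (simp only: wd[OF pvec_pscale[OF v(1,3)]] wd[OF v(3)] mv_scale prv_scale[OF v(1) pvec_mv[OF A v(3)]])
  qed
qed

text \<open>Instead of a noetherian argument, a basis over \<open>k\<close> of the representatives of \<open>N\<close> of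
  degree less than \<open>t\<close> serves as a finite set of generators.\<close>

lemma exists_matrix_onto_submodule:
  assumes N: "N \<subseteq> carrier (F b)" "\<zero>\<^bsub>F b\<^esub> \<in> N" "\<And>x y. x \<in> N \<Longrightarrow> y \<in> N \<Longrightarrow> x \<oplus>\<^bsub>F b\<^esub> y \<in> N"
    "\<And>r x. r \<in> carrier R \<Longrightarrow> x \<in> N \<Longrightarrow> r \<odot>\<^bsub>F b\<^esub> x \<in> N"
  obtains m A where "A \<in> pmat d b" "(\<lambda>v. prv (mv m A v)) ` pvec d m = N"
proof -
  define V where "V = {v \<in> pvec d b. (\<forall>j. trunc t (v j) = v j) \<and> prv v \<in> N}"
  define E :: "(nat \<Rightarrow> 'k mpoly) set" where
    "E = (\<lambda>(l, \<mu>) j. if j = l then Poly_Mapping.single \<mu> 1 else 0) ` ({..<b} \<times> (\<Union>a<t. monoms d a))"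
  have fE: "finite E" by (simp add: E_def finite_monoms)
  have VE: "V \<subseteq> pv.span E" unfolding E_def
  proof
    fix v assume "v \<in> V"
    then show "v \<in> pv.span ((\<lambda>(l, \<mu>) j. if j = l then Poly_Mapping.single \<mu> 1 else 0) ` ({..<b} \<times> (\<Union>a<t. monoms d a)))"
      by (intro reduced_vec_in_span[of _ d]) (simp_all add: V_def)
  qed
  obtain B where B: "B \<subseteq> V" "finite B" "pv.independent B" "V \<subseteq> pv.span B" "card B = pv.dim V"
    by (rule pv.finite_basis_of[OF VE fE]) simp_all
  obtain m and g :: "nat \<Rightarrow> nat \<Rightarrow> 'k mpoly" where g: "B = g ` {i. i < m}" "inj_on g {i. i < m}"
    using finite_imp_nat_seg_image_inj_on[OF B(2)] by blast
  define A where "A = (\<lambda>j l. if l < m then g l j else 0)"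
  have gV: "g l \<in> V" if "l < m" for l using B(1) g(1) that by auto
  have col: "(\<lambda>j. A j l) \<in> pvec d b" for l using gV[of l] by (cases "l < m") (auto simp: A_def V_def pvec_def)
  then have A: "A \<in> pmat d b" by (simp add: pmat_def)
  have mvA: "mv m A v = (\<Sum>l<m. pscale (v l) (g l))" for v
    by (auto simp: mv_def A_def fun_eq_iff sum_fun_apply mult.commute intro!: sum.cong)
  show ?thesis
  proof (rule that[OF A], intro equalityI subsetI)
    fix x assume "x \<in> (\<lambda>v. prv (mv m A v)) ` pvec d m"
    then obtain v where v: "v \<in> pvec d m" "x = prv (mv m A v)" by blast
    have "prv (\<Sum>l\<in>S. pscale (v l) (g l)) \<in> N \<and> (\<Sum>l\<in>S. pscale (v l) (g l)) \<in> pvec d b" if "S \<subseteq> {..<m}" for S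
      using finite_subset[OF that finite_lessThan] that
    proof (induction S rule: finite_induct)
      case empty
      show ?case unfolding sum.empty prv_zero[of b] by (intro conjI N(2) zero_pvec)
    next
      case (insert l S)
      have vl: "v l \<in> polys d" using v(1) by (rule pvecD)
      have gl: "g l \<in> pvec d b" "prv (g l) \<in> N" using gV[of l] insert by (auto simp: V_def)
      have "prv (pscale (v l) (g l)) \<in> N"
        unfolding prv_scale[OF vl gl(1)] by (rule N(4)[OF pr_carrier[OF vl] gl(2)])
      moreover have s: "prv (\<Sum>l\<in>S. pscale (v l) (g l)) \<in> N" "(\<Sum>l\<in>S. pscale (v l) (g l)) \<in> pvec d b"
        using insert by (blast, blast)
      ultimately show ?case
        unfolding sum.insert[OF insert.hyps(1,2)] prv_add[OF pvec_pscale[OF vl gl(1)] s(2)]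
        by (intro conjI N(3) pvec_add[OF pvec_pscale[OF vl gl(1)] s(2)])
    qed
    from this[of "{..<m}"] show "x \<in> N" unfolding v(2) mvA by simp
  next
    fix x assume x: "x \<in> N"
    then obtain u where u: "u \<in> pvec d b" "x = prv u" using N(1) F_carrierE by blast
    define v where "v = (\<lambda>j. trunc t (u j))"
    have vp: "v \<in> pvec d b" using u(1) by (auto simp: v_def pvec_def trunc_eq_0_iff intro: trunc_polys)
    have "v - u \<in> ordv t" by (auto simp: v_def ordv_def trunc_diff)
    then have pvx: "prv v = x" using prv_eq_iff[OF vp u(1)] u(2) by simp
    then have "v \<in> V" using vp x by (simp add: V_def v_def trunc_trunc)
    then have "v \<in> pv.span (g ` {..<m})" using B(4) g(1) by (auto simp: lessThan_def)
    then obtain c where "v = (\<Sum>w\<in>g ` {..<m}. (\<lambda>j. Poly_Mapping.single 0 (c w) * w j))"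
      using pv.span_finite[of "g ` {..<m}"] by auto
    also have "\<dots> = (\<Sum>l<m. (\<lambda>j. Poly_Mapping.single 0 (c (g l)) * g l j))"
      using g(2) by (subst sum.reindex) (auto simp: lessThan_def)
    finally have v: "v = (\<Sum>l<m. (\<lambda>j. Poly_Mapping.single 0 (c (g l)) * g l j))" .
    let ?e = "\<lambda>l. if l < m then Poly_Mapping.single 0 (c (g l)) else 0"
    have "?e \<in> pvec d m" by (auto simp: pvec_def intro: single_polys)
    moreover have "mv m A ?e = v" unfolding mvA v by (intro sum.cong) auto
    ultimately show "x \<in> (\<lambda>v. prv (mv m A v)) ` pvec d m" using pvx by (intro image_eqI[of _ _ ?e]) simp_all
  qed
qed


lemma exists_surjection_from_free:
  fixes M :: "('k mpoly set, 'b) module"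
  assumes "fin_gen_module R M"
  obtains m \<epsilon> where "\<epsilon> \<in> LinearCombinations.module_hom R (F m) M" "\<epsilon> ` carrier (F m) = carrier M"
proof -
  have M: "Module.module R M" and "\<exists>A. finite A \<and> A \<subseteq> carrier M \<and> LinearCombinations.module.span R M A = carrier M"
    using assms unfolding fin_gen_module_def by auto
  then obtain A where A: "finite A" "A \<subseteq> carrier M" "LinearCombinations.module.span R M A = carrier M" by blast
  interpret M: Module.module R M by (rule M)
  obtain m :: nat and g where g: "A = g ` {i. i < m}" "inj_on g {i. i < m}"
    using finite_imp_nat_seg_image_inj_on[OF A(1)] by blast
  have gc: "g \<in> {..<m} \<rightarrow> carrier M" using A(2) g(1) by auto
  have gcl: "l < m \<Longrightarrow> g l \<in> carrier M" for l using gc by auto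
  define \<epsilon> where "\<epsilon> c = (\<Oplus>\<^bsub>M\<^esub>l\<in>{..<m}. c l \<odot>\<^bsub>M\<^esub> g l)" for c
  have cl: "c \<in> carrier (F m) \<Longrightarrow> c l \<in> carrier R" for c l by (rule R.free_mod_on_value)
  have tm: "c \<in> carrier (F m) \<Longrightarrow> (\<lambda>l. c l \<odot>\<^bsub>M\<^esub> g l) \<in> {..<m} \<rightarrow> carrier M" for c
    by (intro Pi_I M.smult_closed cl gcl) simp_all
  show ?thesis
  proof (rule that)
    show "\<epsilon> \<in> LinearCombinations.module_hom R (F m) M"
      unfolding LinearCombinations.module_hom_def
    proof (intro CollectI conjI allI impI Pi_I)
      fix c assume c: "c \<in> carrier (F m)"
      show "\<epsilon> c \<in> carrier M" unfolding \<epsilon>_def by (rule M.finsum_closed[OF tm[OF c]])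
    next
      fix c c' assume c: "c \<in> carrier (F m) \<and> c' \<in> carrier (F m)"
      have "\<epsilon> (c \<oplus>\<^bsub>F m\<^esub> c') = (\<Oplus>\<^bsub>M\<^esub>l\<in>{..<m}. c l \<odot>\<^bsub>M\<^esub> g l \<oplus>\<^bsub>M\<^esub> c' l \<odot>\<^bsub>M\<^esub> g l)"
      proof -
        have "(\<lambda>l. c l \<odot>\<^bsub>M\<^esub> g l \<oplus>\<^bsub>M\<^esub> c' l \<odot>\<^bsub>M\<^esub> g l) \<in> {..<m} \<rightarrow> carrier M"
          using tm c by (intro Pi_I M.a_closed) blast+
        moreover have "(c l \<oplus>\<^bsub>R\<^esub> c' l) \<odot>\<^bsub>M\<^esub> g l = c l \<odot>\<^bsub>M\<^esub> g l \<oplus>\<^bsub>M\<^esub> c' l \<odot>\<^bsub>M\<^esub> g l" if "l \<in> {..<m}" for l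
          using c that by (intro M.smult_l_distr cl gcl) simp_all
        ultimately show ?thesis unfolding \<epsilon>_def free_mod_on_simps by (intro M.finsum_cong') simp_all
      qed
      also have "\<dots> = \<epsilon> c \<oplus>\<^bsub>M\<^esub> \<epsilon> c'" unfolding \<epsilon>_def using tm c by (intro M.finsum_addf) blast+
      finally show "\<epsilon> (c \<oplus>\<^bsub>F m\<^esub> c') = \<epsilon> c \<oplus>\<^bsub>M\<^esub> \<epsilon> c'" .
    next
      fix r c assume c: "r \<in> carrier R \<and> c \<in> carrier (F m)"
      have "\<epsilon> (r \<odot>\<^bsub>F m\<^esub> c) = (\<Oplus>\<^bsub>M\<^esub>l\<in>{..<m}. r \<odot>\<^bsub>M\<^esub> (c l \<odot>\<^bsub>M\<^esub> g l))"
      proof -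
        have "(\<lambda>l. r \<odot>\<^bsub>M\<^esub> (c l \<odot>\<^bsub>M\<^esub> g l)) \<in> {..<m} \<rightarrow> carrier M"
        proof (rule Pi_I)
          fix l assume "l \<in> {..<m}"
          then have "g l \<in> carrier M" by (intro gcl) simp
          moreover have "r \<in> carrier R" "c l \<in> carrier R" using c cl by blast+
          ultimately show "r \<odot>\<^bsub>M\<^esub> (c l \<odot>\<^bsub>M\<^esub> g l) \<in> carrier M" by (intro M.smult_closed)
        qed
        moreover have "(r \<otimes>\<^bsub>R\<^esub> c l) \<odot>\<^bsub>M\<^esub> g l = r \<odot>\<^bsub>M\<^esub> (c l \<odot>\<^bsub>M\<^esub> g l)" if "l \<in> {..<m}" for l
          by (rule M.smult_assoc1[OF c[THEN conjunct1] cl[OF c[THEN conjunct2]] gcl]) (use that in simp)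
        ultimately show ?thesis unfolding \<epsilon>_def free_mod_on_simps by (intro M.finsum_cong') simp_all
      qed
      also have "\<dots> = r \<odot>\<^bsub>M\<^esub> \<epsilon> c" unfolding \<epsilon>_def using tm c by (intro M.finsum_smult[symmetric]) blast+
      finally show "\<epsilon> (r \<odot>\<^bsub>F m\<^esub> c) = r \<odot>\<^bsub>M\<^esub> \<epsilon> c" .
    qed
    show "\<epsilon> ` carrier (F m) = carrier M"
    proof (intro equalityI subsetI)
      fix x assume "x \<in> \<epsilon> ` carrier (F m)"
      then obtain c where "c \<in> carrier (F m)" "x = \<epsilon> c" by blast
      then show "x \<in> carrier M" unfolding \<epsilon>_def using M.finsum_closed[OF tm] by simp
    next
      fix x assume "x \<in> carrier M"
      then have "x \<in> M.span A" unfolding A(3) .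
      from M.finite_in_span[OF A(1,2) this] obtain a where a': "a \<in> A \<rightarrow> carrier R \<and> M.lincomb a A = x" ..
      note a = a'[THEN conjunct1] a'[THEN conjunct2]
      define c where "c l = (if l < m then a (g l) else \<zero>\<^bsub>R\<^esub>)" for l
      have cF: "c \<in> carrier (F m)" unfolding F_carrier_iff c_def using a(1) g(1) by auto
      have "x = (\<Oplus>\<^bsub>M\<^esub>v\<in>g ` {..<m}. a v \<odot>\<^bsub>M\<^esub> v)"
        using a(2) g(1) by (simp add: M.lincomb_def lessThan_def)
      also have "\<dots> = (\<Oplus>\<^bsub>M\<^esub>l\<in>{..<m}. a (g l) \<odot>\<^bsub>M\<^esub> g l)"
        using g a(1) A(2) by (intro M.add.finprod_reindex) (auto simp: lessThan_def)
      also have "\<dots> = \<epsilon> c" unfolding \<epsilon>_def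
        by (rule M.finsum_cong'[OF refl tm[OF cF]]) (simp add: c_def)
      finally show "x \<in> \<epsilon> ` carrier (F m)" using cF by blast
    qed
  qed
qed

lemma exists_kernel_cover:
  assumes f: "f \<in> LinearCombinations.module_hom R (F m) N" and N: "Module.module R N"
  obtains n \<delta> where "\<delta> \<in> LinearCombinations.module_hom R (F n) (F m)"
    "\<delta> ` carrier (F n) = {x \<in> carrier (F m). f x = \<zero>\<^bsub>N\<^esub>}"
proof -
  interpret N: Module.module R N by (rule N)
  interpret Fm: Module.module R "F m" by (rule module_F)
  let ?K = "{x \<in> carrier (F m). f x = \<zero>\<^bsub>N\<^esub>}"
  have "?K \<subseteq> carrier (F m)" by blast
  moreover have "\<zero>\<^bsub>F m\<^esub> \<in> ?K" using module.hom_zero[OF module_F f N] Fm.zero_closed by blast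
  moreover have "x \<oplus>\<^bsub>F m\<^esub> y \<in> ?K" if "x \<in> ?K" "y \<in> ?K" for x y
    using that LinearCombinations.module_hom_add[OF f, of x y] Fm.a_closed[of x y] by (simp del: free_mod_on_simps)
  moreover have "r \<odot>\<^bsub>F m\<^esub> x \<in> ?K" if "r \<in> carrier R" "x \<in> ?K" for r x
    using that LinearCombinations.module_hom_smult[OF f, of r x] Fm.smult_closed[of r x] by (simp del: free_mod_on_simps)
  ultimately obtain n A where A: "A \<in> pmat d m" "(\<lambda>v. prv (mv n A v)) ` pvec d n = ?K"
    by (rule exists_matrix_onto_submodule)
  show ?thesis
  proof (rule that[OF matrix_hom(1)[OF A(1)]])
    show "(\<lambda>c. prv (mv n A (liftv c))) ` carrier (F n) = ?K"
      unfolding A(2)[symmetric]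
    proof (intro equalityI subsetI)
      fix x assume "x \<in> (\<lambda>c. prv (mv n A (liftv c))) ` carrier (F n)"
      then obtain c where "c \<in> carrier (F n)" "x = prv (mv n A (liftv c))" by blast
      then show "x \<in> (\<lambda>v. prv (mv n A v)) ` pvec d n" using liftv_pvec by blast
    next
      fix x assume "x \<in> (\<lambda>v. prv (mv n A v)) ` pvec d n"
      then obtain v where v: "v \<in> pvec d n" "x = prv (mv n A v)" by blast
      then have "x = prv (mv n A (liftv (prv v)))" using matrix_hom(2)[OF A(1)] by simp
      then show "x \<in> (\<lambda>c. prv (mv n A (liftv c))) ` carrier (F n)" using prv_carrier[OF v(1)] by blast
    qed
  qed
qed

lemma exists_free_resolution:
  fixes M :: "('k mpoly set, 'b) module"
  assumes "fin_gen_module R M"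
  shows "\<exists>G. free_resolution R M G"
proof -
  have M: "Module.module R M" using assms unfolding fin_gen_module_def by simp
  obtain m \<epsilon> where \<epsilon>: "\<epsilon> \<in> LinearCombinations.module_hom R (F m) M" "\<epsilon> ` carrier (F m) = carrier M"
    by (rule exists_surjection_from_free[OF assms])
  obtain n0 \<delta>0 where d0: "\<delta>0 \<in> LinearCombinations.module_hom R (F n0) (F m)"
    "\<delta>0 ` carrier (F n0) = {x \<in> carrier (F m). \<epsilon> x = \<zero>\<^bsub>M\<^esub>}" by (rule exists_kernel_cover[OF \<epsilon>(1) M])
  define P where "P = (\<lambda>i::nat. \<lambda>(n, m', \<delta>). \<delta> \<in> LinearCombinations.module_hom R (F n) (F m') \<and>
     (i = 0 \<longrightarrow> m' = m \<and> \<delta> ` carrier (F n) = {x \<in> carrier (F m). \<epsilon> x = \<zero>\<^bsub>M\<^esub>}))"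
  define Q where "Q = (\<lambda>(i::nat) (n, m', \<delta>) (n2, m2, \<delta>2). m2 = n \<and>
     \<delta>2 ` carrier (F n2) = {x \<in> carrier (F n). \<delta> x = \<zero>\<^bsub>F m'\<^esub>})"
  have "\<exists>f. \<forall>i. P i (f i) \<and> Q i (f i) (f (Suc i))"
  proof (rule dependent_nat_choice)
    show "\<exists>x. P 0 x" by (rule exI[of _ "(n0, m, \<delta>0)"]) (simp only: P_def case_prod_conv d0 simp_thms)
    fix x i assume Px: "P i x"
    obtain n m' \<delta> where x: "x = (n, m', \<delta>)" by (cases x)
    have \<delta>: "\<delta> \<in> LinearCombinations.module_hom R (F n) (F m')" using Px by (simp only: P_def x case_prod_conv)
    obtain n2 \<delta>2 where d2: "\<delta>2 \<in> LinearCombinations.module_hom R (F n2) (F n)"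
      "\<delta>2 ` carrier (F n2) = {x \<in> carrier (F n). \<delta> x = \<zero>\<^bsub>F m'\<^esub>}" by (rule exists_kernel_cover[OF \<delta> module_F])
    show "\<exists>y. P (Suc i) y \<and> Q i x y"
      by (rule exI[of _ "(n2, n, \<delta>2)"]) (simp only: P_def Q_def x case_prod_conv d2 nat.distinct simp_thms)
  qed
  then obtain f where f: "\<And>i. P i (f i)" "\<And>i. Q i (f i) (f (Suc i))" by blast
  define b where "b i = fst (snd (f i))" for i
  define \<delta> where "\<delta> i = snd (snd (f i))" for i
  have fst: "fst (f i) = b (Suc i)" for i
    using f(2)[of i] unfolding Q_def b_def by (simp only: case_prod_beta)
  have 1: "\<delta> i \<in> LinearCombinations.module_hom R (F (b (Suc i))) (F (b i))" for i
    using f(1)[of i] unfolding P_def case_prod_beta fst b_def[symmetric] \<delta>_def[symmetric] by (elim conjE)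
  have 2: "b 0 = m" "\<delta> 0 ` carrier (F (b (Suc 0))) = {x \<in> carrier (F m). \<epsilon> x = \<zero>\<^bsub>M\<^esub>}"
    using f(1)[of 0] unfolding P_def case_prod_beta fst b_def[symmetric] \<delta>_def[symmetric] by (simp_all only: simp_thms)
  have 3: "\<delta> (Suc i) ` carrier (F (b (Suc (Suc i)))) = {x \<in> carrier (F (b (Suc i))). \<delta> i x = \<zero>\<^bsub>F (b i)\<^esub>}" for i
    using f(2)[of i] unfolding Q_def case_prod_beta fst b_def[symmetric] \<delta>_def[symmetric] by (elim conjE)
  have "free_resolution R M (b, \<delta>, \<epsilon>)"
    unfolding free_resolution_def case_prod_conv Let_def boundaries_def cycles_def nat.case
    using 1 2 3 \<epsilon> by (simp only: simp_thms)
  then show ?thesis by blast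
qed

lemma free_resolution_matrices:
  fixes M :: "('k mpoly set, 'b) module"
  assumes res: "free_resolution R M (b, \<delta>, \<epsilon>)"
  obtains A where "\<And>i. A i \<in> pmat d (b i)"
    "\<And>i v. v \<in> pvec d (b (Suc i)) \<Longrightarrow> \<delta> i (prv v) = prv (mv (b (Suc i)) (A i) v)"
    "\<And>i. exact_mod t d (b (Suc i)) (A i) (b (Suc (Suc i))) (A (Suc i))"
    "\<And>v. v \<in> pvec d (b 0) \<Longrightarrow> \<epsilon> (prv v) = \<zero>\<^bsub>M\<^esub> \<longleftrightarrow> (\<exists>u\<in>pvec d (b (Suc 0)). v - mv (b (Suc 0)) (A 0) u \<in> ordv t)"
proof -
  note r = res[unfolded free_resolution_def case_prod_conv Let_def boundaries_def cycles_def nat.case]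
  have \<delta>: "\<delta> i \<in> LinearCombinations.module_hom R (F (b (Suc i))) (F (b i))" for i using r by blast
  have k0: "\<delta> 0 ` carrier (F (b (Suc 0))) = {x \<in> carrier (F (b 0)). \<epsilon> x = \<zero>\<^bsub>M\<^esub>}" using r by blast
  have ks: "\<delta> (Suc i) ` carrier (F (b (Suc (Suc i)))) = {x \<in> carrier (F (b (Suc i))). \<delta> i x = \<zero>\<^bsub>F (b i)\<^esub>}" for i
    using r by blast
  have "\<forall>i. \<exists>A. A \<in> pmat d (b i) \<and> (\<forall>v\<in>pvec d (b (Suc i)). \<delta> i (prv v) = prv (mv (b (Suc i)) A v))"
  proof
    fix i
    obtain A where "A \<in> pmat d (b i)" "\<And>v. v \<in> pvec d (b (Suc i)) \<Longrightarrow> \<delta> i (prv v) = prv (mv (b (Suc i)) A v)"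
      by (rule hom_matrix[OF \<delta>]) (rule that)
    then show "\<exists>A. A \<in> pmat d (b i) \<and> (\<forall>v\<in>pvec d (b (Suc i)). \<delta> i (prv v) = prv (mv (b (Suc i)) A v))"
      by (intro exI[of _ A] conjI ballI)
  qed
  from choice[OF this] obtain A where "\<forall>i. A i \<in> pmat d (b i) \<and> (\<forall>v\<in>pvec d (b (Suc i)). \<delta> i (prv v) = prv (mv (b (Suc i)) (A i) v))" ..
  then have A: "A i \<in> pmat d (b i)" "v \<in> pvec d (b (Suc i)) \<Longrightarrow> \<delta> i (prv v) = prv (mv (b (Suc i)) (A i) v)" for i v
    by auto
  have img: "prv v \<in> \<delta> i ` carrier (F (b (Suc i))) \<longleftrightarrow> (\<exists>u\<in>pvec d (b (Suc i)). v - mv (b (Suc i)) (A i) u \<in> ordv t)"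
    if v: "v \<in> pvec d (b i)" for i v
  proof
    assume "prv v \<in> \<delta> i ` carrier (F (b (Suc i)))"
    then obtain c where c: "c \<in> carrier (F (b (Suc i)))" "prv v = \<delta> i c" by (rule imageE)
    obtain u where u: "u \<in> pvec d (b (Suc i))" "c = prv u" using c(1) by (rule F_carrierE)
    have "prv v = prv (mv (b (Suc i)) (A i) u)" using c(2) u A(2) by simp
    then have "v - mv (b (Suc i)) (A i) u \<in> ordv t" using prv_eq_iff[OF v pvec_mv[OF A(1) u(1)]] by simp
    then show "\<exists>u\<in>pvec d (b (Suc i)). v - mv (b (Suc i)) (A i) u \<in> ordv t"
      using u(1) by (intro bexI[where x = u])
  next
    assume "\<exists>u\<in>pvec d (b (Suc i)). v - mv (b (Suc i)) (A i) u \<in> ordv t"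
    then obtain u where u: "u \<in> pvec d (b (Suc i))" "v - mv (b (Suc i)) (A i) u \<in> ordv t" by (rule bexE)
    then have "prv v = \<delta> i (prv u)" using prv_eq_iff[OF v pvec_mv[OF A(1) u(1)]] A(2)[OF u(1)] by simp
    then show "prv v \<in> \<delta> i ` carrier (F (b (Suc i)))" by (rule image_eqI[OF _ prv_carrier[OF u(1)]])
  qed
  show ?thesis
  proof (rule that[OF A(1) A(2)])
    show "exact_mod t d (b (Suc i)) (A i) (b (Suc (Suc i))) (A (Suc i))" for i
      unfolding exact_mod_def
    proof
      fix v :: "nat \<Rightarrow> 'k mpoly" assume v: "v \<in> pvec d (b (Suc i))"
      have "mv (b (Suc i)) (A i) v \<in> ordv t \<longleftrightarrow> \<delta> i (prv v) = \<zero>\<^bsub>F (b i)\<^esub>"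
        unfolding A(2)[OF v] by (rule prv_eq_zero_iff[OF pvec_mv[OF A(1) v], symmetric])
      also have "\<dots> \<longleftrightarrow> prv v \<in> \<delta> (Suc i) ` carrier (F (b (Suc (Suc i))))"
        unfolding ks using prv_carrier[OF v] by (simp only: mem_Collect_eq simp_thms)
      also note img[OF v]
      finally show "mv (b (Suc i)) (A i) v \<in> ordv t \<longleftrightarrow> (\<exists>u\<in>pvec d (b (Suc (Suc i))). v - mv (b (Suc (Suc i))) (A (Suc i)) u \<in> ordv t)" .
    qed
    fix v :: "nat \<Rightarrow> 'k mpoly" assume v: "v \<in> pvec d (b 0)"
    have "\<epsilon> (prv v) = \<zero>\<^bsub>M\<^esub> \<longleftrightarrow> prv v \<in> \<delta> 0 ` carrier (F (b (Suc 0)))"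
      unfolding k0 using prv_carrier[OF v] by (simp only: mem_Collect_eq simp_thms)
    also note img[OF v]
    finally show "\<epsilon> (prv v) = \<zero>\<^bsub>M\<^esub> \<longleftrightarrow> (\<exists>u\<in>pvec d (b (Suc 0)). v - mv (b (Suc 0)) (A 0) u \<in> ordv t)" .
  qed
qed

end

section \<open>Vector spaces over the residue field\<close>

context trunc_ring
begin

lemma kt_add: "X \<in> carrier K \<Longrightarrow> Y \<in> carrier K \<Longrightarrow> kt (X \<oplus>\<^bsub>K\<^esub> Y) = kt X + kt Y"
proof -
  assume "X \<in> carrier K" "Y \<in> carrier K"
  then obtain a b where "X = rs (kc a)" "kt X = a" "Y = rs (kc b)" "kt Y = b" by (metis carrier_KE)
  then show ?thesis using ring_hom_add[OF rs_hom, of "kc a" "kc b", symmetric] by (simp add: ct_add)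
qed

lemma kt_mult: "X \<in> carrier K \<Longrightarrow> Y \<in> carrier K \<Longrightarrow> kt (X \<otimes>\<^bsub>K\<^esub> Y) = kt X * kt Y"
proof -
  assume "X \<in> carrier K" "Y \<in> carrier K"
  then obtain a b where "X = rs (kc a)" "kt X = a" "Y = rs (kc b)" "kt Y = b" by (metis carrier_KE)
  then show ?thesis using ring_hom_mult[OF rs_hom, of "kc a" "kc b", symmetric] by (simp add: ct_mult)
qed

lemma kt_one: "kt \<one>\<^bsub>K\<^esub> = 1"
  using ring_hom_one[OF rs_hom] kt_rs[of "\<one>\<^bsub>R\<^esub>"] by simp

lemma kt_zero: "kt \<zero>\<^bsub>K\<^esub> = 0"
  using ring_hom_zero[OF rs_hom R.ring_axioms cring.axioms(1)[OF fieldE(1)[OF field_K]]] kt_rs[of "\<zero>\<^bsub>R\<^esub>"] by simp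

lemma kt_inj: "X \<in> carrier K \<Longrightarrow> Y \<in> carrier K \<Longrightarrow> kt X = kt Y \<Longrightarrow> X = Y"
  by (metis carrier_KE)

lemma rs_kc_carrier: "rs (kc c) \<in> carrier K" by (simp add: carrier_K)

text \<open>Dimension over the residue field is computed in \<open>k\<^sup>m\<close>: a basis of a complement of \<open>Bs\<close> in \<open>Zs\<close> is
  transported along \<open>\<Psi>\<close>, with \<open>kt\<close> identifying the scalars.\<close>

lemma dim_of_presented_space:
  fixes V :: "('k mpoly set set, 'v) module" and \<Psi> :: "(nat \<Rightarrow> 'k) \<Rightarrow> 'v"
  assumes sub: "fv.subspace Bs" "fv.subspace Zs" "Bs \<subseteq> Zs" "Zs \<subseteq> kvec m"
    and V: "carrier V = \<Psi> ` Zs" "\<zero>\<^bsub>V\<^esub> = \<Psi> 0"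
      "\<And>a b. a \<in> Zs \<Longrightarrow> b \<in> Zs \<Longrightarrow> \<Psi> a \<oplus>\<^bsub>V\<^esub> \<Psi> b = \<Psi> (a + b)"
      "\<And>X a. X \<in> carrier K \<Longrightarrow> a \<in> Zs \<Longrightarrow> X \<odot>\<^bsub>V\<^esub> \<Psi> a = \<Psi> (\<lambda>j. kt X * a j)"
      "\<And>a b. a \<in> Zs \<Longrightarrow> b \<in> Zs \<Longrightarrow> \<Psi> a = \<Psi> b \<longleftrightarrow> a - b \<in> Bs"
  shows "vectorspace.dim K V + fv.dim Bs = fv.dim Zs"
proof -
  note add_Z = fv.subspace_add[OF sub(2)]
  note sc_Z = fv.subspace_scale[OF sub(2)]
  have mod: "Module.module K V"
  proof (rule moduleI)
    show "cring K" by (rule fieldE(1)[OF field_K])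
    show "abelian_group V"
    proof (rule abelian_groupI)
      show "\<zero>\<^bsub>V\<^esub> \<in> carrier V" unfolding V(1,2) using fv.subspace_0[OF sub(2)] by (rule imageI)
      fix x assume "x \<in> carrier V"
      then obtain a where a: "a \<in> Zs" "x = \<Psi> a" unfolding V(1) by (rule imageE)
      show "\<zero>\<^bsub>V\<^esub> \<oplus>\<^bsub>V\<^esub> x = x" unfolding V(2) a(2) V(3)[OF fv.subspace_0[OF sub(2)] a(1)] by simp
      have "\<Psi> (- a) \<oplus>\<^bsub>V\<^esub> x = \<zero>\<^bsub>V\<^esub>" unfolding V(2) a(2) V(3)[OF fv.subspace_neg[OF sub(2) a(1)] a(1)] by simp
      then show "\<exists>y\<in>carrier V. y \<oplus>\<^bsub>V\<^esub> x = \<zero>\<^bsub>V\<^esub>"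
        using imageI[OF fv.subspace_neg[OF sub(2) a(1)], of \<Psi>] unfolding V(1)[symmetric] by (rule bexI)
      fix y assume "y \<in> carrier V"
      then obtain b where b: "b \<in> Zs" "y = \<Psi> b" unfolding V(1) by (rule imageE)
      show "x \<oplus>\<^bsub>V\<^esub> y \<in> carrier V" unfolding a(2) b(2) V(1) V(3)[OF a(1) b(1)] using add_Z[OF a(1) b(1)] by (rule imageI)
      show "x \<oplus>\<^bsub>V\<^esub> y = y \<oplus>\<^bsub>V\<^esub> x" unfolding a(2) b(2) V(3)[OF a(1) b(1)] V(3)[OF b(1) a(1)] by (simp only: add.commute)
      fix z assume "z \<in> carrier V"
      then obtain c where c: "c \<in> Zs" "z = \<Psi> c" unfolding V(1) by (rule imageE)
      show "x \<oplus>\<^bsub>V\<^esub> y \<oplus>\<^bsub>V\<^esub> z = x \<oplus>\<^bsub>V\<^esub> (y \<oplus>\<^bsub>V\<^esub> z)"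
        unfolding a(2) b(2) c(2) V(3)[OF a(1) b(1)] V(3)[OF b(1) c(1)] V(3)[OF add_Z[OF a(1) b(1)] c(1)]
          V(3)[OF a(1) add_Z[OF b(1) c(1)]] by (simp only: add.assoc)
    qed
    interpret K: field K by (rule field_K)
    fix X x assume X: "X \<in> carrier K" and "x \<in> carrier V"
    then obtain a where a: "a \<in> Zs" "x = \<Psi> a" unfolding V(1) by blast
    show "X \<odot>\<^bsub>V\<^esub> x \<in> carrier V" unfolding a(2) V(4)[OF X a(1)] V(1) using sc_Z[OF a(1)] by (rule imageI)
    fix Y assume Y: "Y \<in> carrier K"
    show "(X \<oplus>\<^bsub>K\<^esub> Y) \<odot>\<^bsub>V\<^esub> x = X \<odot>\<^bsub>V\<^esub> x \<oplus>\<^bsub>V\<^esub> Y \<odot>\<^bsub>V\<^esub> x"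
      unfolding a(2) V(4)[OF X a(1)] V(4)[OF Y a(1)] V(4)[OF K.a_closed[OF X Y] a(1)] V(3)[OF sc_Z[OF a(1)] sc_Z[OF a(1)]]
      by (simp only: kt_add[OF X Y] distrib_right plus_fun_def)
    show "(X \<otimes>\<^bsub>K\<^esub> Y) \<odot>\<^bsub>V\<^esub> x = X \<odot>\<^bsub>V\<^esub> (Y \<odot>\<^bsub>V\<^esub> x)"
      unfolding a(2) V(4)[OF Y a(1)] V(4)[OF K.m_closed[OF X Y] a(1)] V(4)[OF X sc_Z[OF a(1)]]
      by (simp only: kt_mult[OF X Y] mult.assoc)
  next
    interpret K: field K by (rule field_K)
    fix x assume "x \<in> carrier V"
    then obtain a where a: "a \<in> Zs" "x = \<Psi> a" unfolding V(1) by (rule imageE)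
    show "\<one>\<^bsub>K\<^esub> \<odot>\<^bsub>V\<^esub> x = x" unfolding a(2) V(4)[OF K.one_closed a(1)] kt_one by (simp only: mult_1)
  next
    fix X x y assume X: "X \<in> carrier K" and "x \<in> carrier V" "y \<in> carrier V"
    then obtain a b where a: "a \<in> Zs" "x = \<Psi> a" and b: "b \<in> Zs" "y = \<Psi> b" unfolding V(1) by blast
    show "X \<odot>\<^bsub>V\<^esub> (x \<oplus>\<^bsub>V\<^esub> y) = X \<odot>\<^bsub>V\<^esub> x \<oplus>\<^bsub>V\<^esub> X \<odot>\<^bsub>V\<^esub> y"
      unfolding a(2) b(2) V(3)[OF a(1) b(1)] V(4)[OF X a(1)] V(4)[OF X b(1)] V(4)[OF X add_Z[OF a(1) b(1)]]
        V(3)[OF sc_Z[OF a(1)] sc_Z[OF b(1)]]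
      by (simp only: distrib_left plus_fun_def)
  qed
  interpret V: vectorspace K V
    by (intro vectorspace.intro mod field_K)
  obtain W B where W: "finite W" "W \<subseteq> Zs" "card W + fv.dim Bs = fv.dim Zs" "finite B" "B \<subseteq> Bs" "fv.span B = Bs"
      "B \<inter> W = {}" "fv.independent (B \<union> W)" "fv.span (B \<union> W) = Zs"
    by (rule fv.dim_eq_dim_plus_complement[OF sub(1-3) subset_trans[OF sub(4) kvec_subset_span] finite_imageI[OF finite_lessThan]])
      (rule that)
  have ind: "\<forall>w\<in>W. c w = 0" if "(\<Sum>w\<in>W. (\<lambda>j. c w * w j)) \<in> Bs" for c
    using fv.independent_modulo_span[OF W(8,7,4,1)] that unfolding W(6) .
  have inj: "inj_on \<Psi> W"
  proof (rule inj_onI, rule ccontr)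
    fix v w assume vw: "v \<in> W" "w \<in> W" "\<Psi> v = \<Psi> w" "v \<noteq> w"
    let ?c = "\<lambda>u. if u = v then 1 else if u = w then - 1 else (0::'k)"
    have "v - w \<in> Bs" using V(5)[of v w] vw W(2) by blast
    also have "v - w = (\<Sum>u\<in>W. (\<lambda>j. ?c u * u j))"
    proof
      fix j
      have "(\<Sum>u\<in>W. (\<lambda>j. ?c u * u j)) j = (\<Sum>u\<in>W. (if u = v then v j else 0) - (if u = w then w j else 0))"
        unfolding sum_fun_apply using vw by (intro sum.cong) auto
      then show "(v - w) j = (\<Sum>u\<in>W. (\<lambda>j. ?c u * u j)) j" using vw W(1) by (simp add: sum_subtractf)
    qed
    finally have "?c v = 0" using ind[of ?c] vw(1) by blast
    then show False by simp
  qed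
  have WV: "\<Psi> ` W \<subseteq> carrier V" unfolding V(1) using W(2) by (rule image_mono)
  have lc: "V.lincomb c (\<Psi> ` W') = \<Psi> (\<Sum>w\<in>W'. (\<lambda>j. kt (c (\<Psi> w)) * w j)) \<and> (\<Sum>w\<in>W'. (\<lambda>j. kt (c (\<Psi> w)) * w j)) \<in> Zs"
    if "W' \<subseteq> W" "c \<in> \<Psi> ` W' \<rightarrow> carrier K" for c W'
    using finite_subset[OF that(1) W(1)] that
  proof (induction W' rule: finite_induct)
    case empty
    show ?case unfolding V.lincomb_def image_empty V.finsum_empty sum.empty V(2)
      by (intro conjI refl fv.subspace_0[OF sub(2)])
  next
    case (insert w W')
    let ?s = "\<Sum>w\<in>W'. (\<lambda>j. kt (c (\<Psi> w)) * w j)"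
    have IH: "V.lincomb c (\<Psi> ` W') = \<Psi> ?s" "?s \<in> Zs" using insert by simp_all
    have w: "w \<in> Zs" "c (\<Psi> w) \<in> carrier K" using insert W(2) by auto
    have notin: "\<Psi> w \<notin> \<Psi> ` W'" using insert inj by (auto dest: inj_onD)
    have cW': "c \<in> \<Psi> ` W' \<rightarrow> carrier K" using insert by auto
    have W'V: "\<Psi> ` W' \<subseteq> carrier V" using insert.prems(1) WV by blast
    have "V.lincomb c (\<Psi> ` insert w W') = c (\<Psi> w) \<odot>\<^bsub>V\<^esub> \<Psi> w \<oplus>\<^bsub>V\<^esub> V.lincomb c (\<Psi> ` W')"
      unfolding V.lincomb_def image_insert
    proof (rule V.finsum_insert)
      show "(\<lambda>v. c v \<odot>\<^bsub>V\<^esub> v) \<in> \<Psi> ` W' \<rightarrow> carrier V" using cW' W'V by (intro Pi_I V.smult_closed) auto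
      show "c (\<Psi> w) \<odot>\<^bsub>V\<^esub> \<Psi> w \<in> carrier V" using w by (intro V.smult_closed) (auto simp: V(1))
    qed (use insert notin in auto)
    also have "\<dots> = \<Psi> ((\<lambda>j. kt (c (\<Psi> w)) * w j) + ?s)"
      unfolding IH(1) V(4)[OF w(2,1)] by (rule V(3)[OF sc_Z[OF w(1)] IH(2)])
    finally show ?case unfolding sum.insert[OF insert.hyps] using add_Z[OF sc_Z[OF w(1)] IH(2)] by (intro conjI)
  qed
  have "V.basis (\<Psi> ` W)" unfolding V.basis_def
  proof (intro conjI WV)
    show "\<not> V.lin_dep (\<Psi> ` W)"
    proof
      assume "V.lin_dep (\<Psi> ` W)"
      then obtain a v where a: "a \<in> \<Psi> ` W \<rightarrow> carrier K" "V.lincomb a (\<Psi> ` W) = \<zero>\<^bsub>V\<^esub>" "v \<in> \<Psi> ` W" "a v \<noteq> \<zero>\<^bsub>K\<^esub>"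
        using V.finite_lin_dep[OF finite_imageI[OF W(1)] _ WV] by blast
      let ?s = "\<Sum>w\<in>W. (\<lambda>j. kt (a (\<Psi> w)) * w j)"
      have s: "\<Psi> ?s = \<Psi> 0" "?s \<in> Zs" using lc[OF subset_refl a(1)] a(2) V(2) by auto
      then have "?s \<in> Bs" using V(5)[OF s(2) fv.subspace_0[OF sub(2)]] by (simp only: diff_zero simp_thms)
      from ind[OF this] have "\<forall>w\<in>W. kt (a (\<Psi> w)) = 0" .
      then have "kt (a v) = 0" using a(3) by blast
      moreover have "a v \<in> carrier K" using a(1,3) by blast
      ultimately have "a v = \<zero>\<^bsub>K\<^esub>" using kt_inj[of "a v" "\<zero>\<^bsub>K\<^esub>"] kt_zero cring.cring_simprules(2)[OF fieldE(1)[OF field_K]] by simp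
      then show False using a(4) by simp
    qed
    show "V.span (\<Psi> ` W) = carrier V"
    proof (intro equalityI subsetI)
      fix x assume "x \<in> V.span (\<Psi> ` W)"
      then show "x \<in> carrier V" using V.span_is_subset2[OF WV] by blast
    next
      fix x assume "x \<in> carrier V"
      then obtain z where z: "z \<in> Zs" "x = \<Psi> z" unfolding V(1) by (rule imageE)
      have "z \<in> fv.span (B \<union> W)" using z(1) W(9) by simp
      then obtain f where f: "z = (\<Sum>w\<in>B \<union> W. (\<lambda>j. f w * w j))"
        using fv.span_finite[of "B \<union> W"] W(1,4) by auto
      define c where "c v = rs (kc (f (the_inv_into W \<Psi> v)))" for v
      have c: "c \<in> \<Psi> ` W \<rightarrow> carrier K" by (simp add: c_def rs_kc_carrier)
      have "kt (c (\<Psi> w)) = f w" if "w \<in> W" for w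
        using the_inv_into_f_f[OF inj that] by (simp add: c_def)
      then have e: "(\<Sum>w\<in>W. (\<lambda>j. kt (c (\<Psi> w)) * w j)) = (\<Sum>w\<in>W. (\<lambda>j. f w * w j))"
        by (intro sum.cong refl) simp
      have "z - (\<Sum>w\<in>W. (\<lambda>j. f w * w j)) = (\<Sum>w\<in>B. (\<lambda>j. f w * w j))"
        unfolding f sum.union_disjoint[OF W(4,1,7)] by simp
      also have "\<dots> \<in> Bs" using W(5) by (intro fv.subspace_sum[OF sub(1)] fv.subspace_scale[OF sub(1)]) auto
      finally have "z - (\<Sum>w\<in>W. (\<lambda>j. f w * w j)) \<in> Bs" .
      then have "x = V.lincomb c (\<Psi> ` W)"
        using lc[OF subset_refl c] V(5)[OF z(1), of "\<Sum>w\<in>W. (\<lambda>j. f w * w j)"] z(2) unfolding e by simp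
      then show "x \<in> V.span (\<Psi> ` W)" unfolding V.span_def using c W(1) by blast
    qed
  qed
  then have "V.dim = card (\<Psi> ` W)" by (rule V.dim_basis[OF finite_imageI[OF W(1)]])
  then show ?thesis using W(3) card_image[OF inj] by simp
qed

end

declare free_mod_on_simps(1) [simp del]

context trunc_ring
begin

section \<open>The tensor product \<open>k \<otimes> R\<^sup>b\<close>\<close>

abbreviation kmod :: "('k mpoly set, 'k mpoly set set) module" where "kmod \<equiv> residue_module R"

lemma kmod_simps [simp]:
  "carrier kmod = carrier K" "x \<oplus>\<^bsub>kmod\<^esub> y = x \<oplus>\<^bsub>K\<^esub> y" "\<zero>\<^bsub>kmod\<^esub> = \<zero>\<^bsub>K\<^esub>" "r \<odot>\<^bsub>kmod\<^esub> x = rs r \<otimes>\<^bsub>K\<^esub> x"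
  by (simp_all add: residue_module_def rs_def local_max_ideal_eq)

lemma K_closed: "x \<in> carrier K \<Longrightarrow> y \<in> carrier K \<Longrightarrow> x \<oplus>\<^bsub>K\<^esub> y \<in> carrier K"
  "x \<in> carrier K \<Longrightarrow> y \<in> carrier K \<Longrightarrow> x \<otimes>\<^bsub>K\<^esub> y \<in> carrier K" "\<one>\<^bsub>K\<^esub> \<in> carrier K" "\<zero>\<^bsub>K\<^esub> \<in> carrier K"
  using cring.cring_simprules(1,2,5,6)[OF fieldE(1)[OF field_K]] by simp_all

lemma rs_carrier: "r \<in> carrier R \<Longrightarrow> rs r \<in> carrier K" by (simp add: carrier_K)

abbreviation (input) pairs :: "nat \<Rightarrow> ('k mpoly set set \<times> (nat \<Rightarrow> 'k mpoly set)) set" where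
  "pairs b \<equiv> carrier kmod \<times> carrier (F b)"

abbreviation TF :: "nat \<Rightarrow> ('k mpoly set, 'k mpoly set set \<times> (nat \<Rightarrow> 'k mpoly set) \<Rightarrow> 'k mpoly set) module" where
  "TF b \<equiv> free_mod_on R (pairs b)"

text \<open>The coordinates of the tensor that a formal combination of pairs represents: under
  \<open>k \<otimes> R\<^sup>b = k\<^sup>b\<close> the pair \<open>(a, y)\<close> becomes \<open>a\<close> times the vector of constant terms of \<open>y\<close>.\<close>

definition tau :: "('k mpoly set set \<times> (nat \<Rightarrow> 'k mpoly set) \<Rightarrow> 'k mpoly set) \<Rightarrow> nat \<Rightarrow> 'k" where
  "tau c = (\<lambda>j. \<Sum>s\<in>{s. c s \<noteq> \<zero>\<^bsub>R\<^esub>}. ct (c s) * kt (fst s) * ct (snd s j))"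

lemma tau_superset: "finite S \<Longrightarrow> {s. c s \<noteq> \<zero>\<^bsub>R\<^esub>} \<subseteq> S \<Longrightarrow>
    tau c = (\<lambda>j. \<Sum>s\<in>S. ct (c s) * kt (fst s) * ct (snd s j))"
  unfolding tau_def by (intro ext sum.mono_neutral_left) auto

lemma TF_finite: "c \<in> carrier (TF b) \<Longrightarrow> finite {s. c s \<noteq> \<zero>\<^bsub>R\<^esub>}"
  by (rule free_mod_on_finite)

lemma TF_value: "c \<in> carrier (TF b) \<Longrightarrow> c s \<in> carrier R" by (rule R.free_mod_on_value)

lemma TF_support: "c \<in> carrier (TF b) \<Longrightarrow> c s \<noteq> \<zero>\<^bsub>R\<^esub> \<Longrightarrow> fst s \<in> carrier K \<and> snd s \<in> carrier (F b)"
proof -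
  assume c: "c \<in> carrier (TF b)" "c s \<noteq> \<zero>\<^bsub>R\<^esub>"
  have "s \<in> pairs b"
  proof (rule ccontr)
    assume "s \<notin> pairs b"
    then have "c s = \<zero>\<^bsub>R\<^esub>" by (rule free_mod_on_outside[OF c(1)])
    with c(2) show False by (rule notE)
  qed
  then show ?thesis by (simp only: mem_Times_iff kmod_simps simp_thms)
qed

lemma tau_add: "c \<in> carrier (TF b) \<Longrightarrow> c' \<in> carrier (TF b) \<Longrightarrow> tau (c \<oplus>\<^bsub>TF b\<^esub> c') = tau c + tau c'"
proof -
  assume c: "c \<in> carrier (TF b)" and c': "c' \<in> carrier (TF b)"
  let ?S = "{s. c s \<noteq> \<zero>\<^bsub>R\<^esub>} \<union> {s. c' s \<noteq> \<zero>\<^bsub>R\<^esub>}"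
  have f: "finite ?S" using TF_finite[OF c] TF_finite[OF c'] by (rule finite_UnI)
  have "{s. c s \<oplus>\<^bsub>R\<^esub> c' s \<noteq> \<zero>\<^bsub>R\<^esub>} \<subseteq> ?S"
  proof
    fix s assume s: "s \<in> {s. c s \<oplus>\<^bsub>R\<^esub> c' s \<noteq> \<zero>\<^bsub>R\<^esub>}"
    have "\<not> (c s = \<zero>\<^bsub>R\<^esub> \<and> c' s = \<zero>\<^bsub>R\<^esub>)"
    proof
      assume "c s = \<zero>\<^bsub>R\<^esub> \<and> c' s = \<zero>\<^bsub>R\<^esub>"
      then have "c s \<oplus>\<^bsub>R\<^esub> c' s = \<zero>\<^bsub>R\<^esub>" by simp
      with s show False by simp
    qed
    then show "s \<in> ?S" by blast
  qed
  from tau_superset[OF f this] have "tau (c \<oplus>\<^bsub>TF b\<^esub> c') = (\<lambda>j. \<Sum>s\<in>?S. ct (c s \<oplus>\<^bsub>R\<^esub> c' s) * kt (fst s) * ct (snd s j))"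
    by (simp only: free_mod_on_simps)
  also have "\<dots> = (\<lambda>j. \<Sum>s\<in>?S. ct (c s) * kt (fst s) * ct (snd s j)) + (\<lambda>j. \<Sum>s\<in>?S. ct (c' s) * kt (fst s) * ct (snd s j))"
    by (simp only: ct_add[OF TF_value[OF c] TF_value[OF c']] distrib_right sum.distrib plus_fun_def)
  also have "\<dots> = tau c + tau c'"
    unfolding tau_superset[OF f Un_upper1] tau_superset[OF f Un_upper2] ..
  finally show ?thesis .
qed

lemma tau_smult: "r \<in> carrier R \<Longrightarrow> c \<in> carrier (TF b) \<Longrightarrow> tau (r \<odot>\<^bsub>TF b\<^esub> c) = (\<lambda>j. ct r * tau c j)"
proof -
  assume r: "r \<in> carrier R" and c: "c \<in> carrier (TF b)"
  have "{s. r \<otimes>\<^bsub>R\<^esub> c s \<noteq> \<zero>\<^bsub>R\<^esub>} \<subseteq> {s. c s \<noteq> \<zero>\<^bsub>R\<^esub>}"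
  proof (intro subsetI CollectI notI)
    fix s assume "s \<in> {s. r \<otimes>\<^bsub>R\<^esub> c s \<noteq> \<zero>\<^bsub>R\<^esub>}" "c s = \<zero>\<^bsub>R\<^esub>"
    then show False by (simp only: mem_Collect_eq R.r_null[OF r] not_True_eq_False simp_thms)
  qed
  from tau_superset[OF TF_finite[OF c] this]
  have "tau (r \<odot>\<^bsub>TF b\<^esub> c) = (\<lambda>j. \<Sum>s\<in>{s. c s \<noteq> \<zero>\<^bsub>R\<^esub>}. ct (r \<otimes>\<^bsub>R\<^esub> c s) * kt (fst s) * ct (snd s j))"
    by (simp only: free_mod_on_simps)
  then show ?thesis by (simp only: ct_mult[OF r TF_value[OF c]] mult.assoc sum_distrib_left[symmetric] tau_def)
qed

lemma tau_zero: "tau \<zero>\<^bsub>TF b\<^esub> = 0" by (simp add: tau_def zero_fun_def)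

lemma basis_elt_TF: "x \<in> carrier K \<Longrightarrow> y \<in> carrier (F b) \<Longrightarrow> basis_elt R (x, y) \<in> carrier (TF b)"
proof -
  assume xy: "x \<in> carrier K" "y \<in> carrier (F b)"
  have "finite {s. basis_elt R (x, y) s \<noteq> \<zero>\<^bsub>R\<^esub>}"
    by (rule finite_subset[of _ "{(x, y)}"]) (auto simp: basis_elt_def)
  moreover have "(x, y) \<in> pairs b" using xy by (simp only: kmod_simps mem_Sigma_iff simp_thms)
  moreover have "basis_elt R (x, y) s \<in> carrier R" for s by (simp add: basis_elt_def)
  moreover have "basis_elt R (x, y) s = \<zero>\<^bsub>R\<^esub>" if "s \<notin> pairs b" for s
    using that \<open>(x, y) \<in> pairs b\<close> unfolding basis_elt_def by metis
  ultimately show ?thesis by (intro free_mod_on_memI)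
qed

lemma tau_basis_elt: "tau (basis_elt R (x, y)) = (\<lambda>j. kt x * ct (y j))"
proof -
  have "{s. basis_elt R (x, y) s \<noteq> \<zero>\<^bsub>R\<^esub>} \<subseteq> {(x, y)}" by (auto simp: basis_elt_def)
  from tau_superset[OF _ this] show ?thesis by (simp add: basis_elt_def)
qed

lemma tau_kvec: "c \<in> carrier (TF b) \<Longrightarrow> tau c \<in> kvec b"
proof -
  assume c: "c \<in> carrier (TF b)"
  have "tau c j = 0" if "b \<le> j" for j unfolding tau_def
  proof (rule sum.neutral, rule ballI)
    fix s assume "s \<in> {s. c s \<noteq> \<zero>\<^bsub>R\<^esub>}"
    then have "snd s \<in> carrier (F b)" using TF_support[OF c] by simp
    then have "snd s j = \<zero>\<^bsub>R\<^esub>" using that unfolding F_carrier_iff by blast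
    then show "ct (c s) * kt (fst s) * ct (snd s j) = 0" by simp
  qed
  then show ?thesis by (simp add: kvec_def)
qed

lemma F_induct [consumes 1, case_names zero add smult unit]:
  assumes y: "y \<in> carrier (F b)" and "P \<zero>\<^bsub>F b\<^esub>"
    and add: "\<And>x y. x \<in> carrier (F b) \<Longrightarrow> y \<in> carrier (F b) \<Longrightarrow> P x \<Longrightarrow> P y \<Longrightarrow> P (x \<oplus>\<^bsub>F b\<^esub> y)"
    and sm: "\<And>r x. r \<in> carrier R \<Longrightarrow> x \<in> carrier (F b) \<Longrightarrow> P x \<Longrightarrow> P (r \<odot>\<^bsub>F b\<^esub> x)"
    and un: "\<And>l. l < b \<Longrightarrow> P (prv (unitv l))"
  shows "P y"
proof -
  obtain v where v: "v \<in> pvec d b" "y = prv v" using y by (rule F_carrierE)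
  have "P (prv (\<Sum>l\<in>S. pscale (v l) (unitv l))) \<and> (\<Sum>l\<in>S. pscale (v l) (unitv l)) \<in> pvec d b" if "S \<subseteq> {..<b}" for S
    using finite_subset[OF that finite_lessThan] that
  proof (induction S rule: finite_induct)
    case empty
    show ?case unfolding sum.empty prv_zero[of b] by (intro conjI assms(2) zero_pvec)
  next
    case (insert l S)
    have vl: "v l \<in> polys d" using v(1) by (rule pvecD)
    have l: "l < b" using insert.prems by simp
    have up: "unitv l \<in> pvec d b" using l by (rule unitv_pvec)
    have sp: "pscale (v l) (unitv l) \<in> pvec d b" using vl up by (rule pvec_pscale)
    have 1: "P (prv (pscale (v l) (unitv l)))"
      unfolding prv_scale[OF vl up] by (intro sm un pr_carrier prv_carrier vl up l)
    have IH: "P (prv (\<Sum>l\<in>S. pscale (v l) (unitv l)))" "(\<Sum>l\<in>S. pscale (v l) (unitv l)) \<in> pvec d b"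
      using insert by (blast, blast)
    show ?case unfolding sum.insert[OF insert.hyps] prv_add[OF sp IH(2)]
      by (intro conjI add prv_carrier pvec_add sp IH 1)
  qed
  from this[of "{..<b}"] show ?thesis unfolding v(2) using pvec_eq_sum_unitv[OF v(1)] by simp
qed

abbreviation TU :: "nat \<Rightarrow> ('k mpoly set set \<times> (nat \<Rightarrow> 'k mpoly set) \<Rightarrow> 'k mpoly set) set" where
  "TU b \<equiv> tensor_null R kmod (F b)"

context
  fixes b :: nat
begin

interpretation C: Module.module R "TF b" by (rule R.free_mod_on_module)
interpretation Fb: Module.module R "F b" by (rule module_F)

abbreviation e :: "'k mpoly set set \<Rightarrow> (nat \<Rightarrow> 'k mpoly set) \<Rightarrow> 'k mpoly set set \<times> (nat \<Rightarrow> 'k mpoly set) \<Rightarrow> 'k mpoly set" where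
  "e x y \<equiv> basis_elt R (x, y)"

lemma tau_minus: "c \<in> carrier (TF b) \<Longrightarrow> c' \<in> carrier (TF b) \<Longrightarrow> tau (c \<ominus>\<^bsub>TF b\<^esub> c') = tau c - tau c'"
proof -
  assume c: "c \<in> carrier (TF b)" and c': "c' \<in> carrier (TF b)"
  have "tau ((c \<ominus>\<^bsub>TF b\<^esub> c') \<oplus>\<^bsub>TF b\<^esub> c') = tau (c \<ominus>\<^bsub>TF b\<^esub> c') + tau c'"
    by (rule tau_add[OF C.minus_closed[OF c c'] c'])
  moreover have "(c \<ominus>\<^bsub>TF b\<^esub> c') \<oplus>\<^bsub>TF b\<^esub> c' = c"
    unfolding C.minus_eq by (simp only: C.a_assoc[OF c C.a_inv_closed[OF c'] c'] C.l_neg[OF c'] C.r_zero[OF c])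
  ultimately show ?thesis by simp
qed

lemma tensor_rels_subset: "tensor_rels R kmod (F b) \<subseteq> carrier (TF b)"
  unfolding tensor_rels_def Let_def
  by (intro Un_least subsetI; clarify; intro C.minus_closed C.a_closed C.smult_closed basis_elt_TF)
    (simp_all only: kmod_simps K_closed rs_carrier Fb.a_closed Fb.smult_closed)

lemma rel_mem:
  assumes "x \<in> carrier K" "x' \<in> carrier K" "y \<in> carrier (F b)" "y' \<in> carrier (F b)" "r \<in> carrier R"
  shows "e x (y \<oplus>\<^bsub>F b\<^esub> y') \<ominus>\<^bsub>TF b\<^esub> (e x y \<oplus>\<^bsub>TF b\<^esub> e x y') \<in> TU b"
    "e (rs r \<otimes>\<^bsub>K\<^esub> x) y \<ominus>\<^bsub>TF b\<^esub> r \<odot>\<^bsub>TF b\<^esub> e x y \<in> TU b"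
    "e x (r \<odot>\<^bsub>F b\<^esub> y) \<ominus>\<^bsub>TF b\<^esub> r \<odot>\<^bsub>TF b\<^esub> e x y \<in> TU b"
proof -
  have sub: "tensor_rels R kmod (F b) \<subseteq> TU b"
    unfolding tensor_null_def using C.in_own_span[OF tensor_rels_subset] .
  have "e x (y \<oplus>\<^bsub>F b\<^esub> y') \<ominus>\<^bsub>TF b\<^esub> (e x y \<oplus>\<^bsub>TF b\<^esub> e x y') \<in> tensor_rels R kmod (F b)"
    unfolding tensor_rels_def Let_def using assms unfolding kmod_simps(1) by blast
  then show "e x (y \<oplus>\<^bsub>F b\<^esub> y') \<ominus>\<^bsub>TF b\<^esub> (e x y \<oplus>\<^bsub>TF b\<^esub> e x y') \<in> TU b" using sub by (rule rev_subsetD)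
  have "e (r \<odot>\<^bsub>kmod\<^esub> x) y \<ominus>\<^bsub>TF b\<^esub> r \<odot>\<^bsub>TF b\<^esub> e x y \<in> tensor_rels R kmod (F b)"
    unfolding tensor_rels_def Let_def using assms unfolding kmod_simps(1) by blast
  then have "e (r \<odot>\<^bsub>kmod\<^esub> x) y \<ominus>\<^bsub>TF b\<^esub> r \<odot>\<^bsub>TF b\<^esub> e x y \<in> TU b" using sub by (rule rev_subsetD)
  then show "e (rs r \<otimes>\<^bsub>K\<^esub> x) y \<ominus>\<^bsub>TF b\<^esub> r \<odot>\<^bsub>TF b\<^esub> e x y \<in> TU b" unfolding kmod_simps .
  have "e x (r \<odot>\<^bsub>F b\<^esub> y) \<ominus>\<^bsub>TF b\<^esub> r \<odot>\<^bsub>TF b\<^esub> e x y \<in> tensor_rels R kmod (F b)"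
    unfolding tensor_rels_def Let_def using assms unfolding kmod_simps(1) by blast
  then show "e x (r \<odot>\<^bsub>F b\<^esub> y) \<ominus>\<^bsub>TF b\<^esub> r \<odot>\<^bsub>TF b\<^esub> e x y \<in> TU b" using sub by (rule rev_subsetD)
qed

lemma TU_closed:
  shows "c \<in> TU b \<Longrightarrow> c \<in> carrier (TF b)" "\<zero>\<^bsub>TF b\<^esub> \<in> TU b"
    "c \<in> TU b \<Longrightarrow> c' \<in> TU b \<Longrightarrow> c \<oplus>\<^bsub>TF b\<^esub> c' \<in> TU b"
    "r \<in> carrier R \<Longrightarrow> c \<in> TU b \<Longrightarrow> r \<odot>\<^bsub>TF b\<^esub> c \<in> TU b"
proof -
  have s: "LinearCombinations.submodule R (TU b) (TF b)"
    unfolding tensor_null_def by (rule C.span_is_submodule[OF tensor_rels_subset])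
  show "c \<in> TU b \<Longrightarrow> c \<in> carrier (TF b)" by (rule subsetD[OF LinearCombinations.submodule.subset[OF s]])
  show "\<zero>\<^bsub>TF b\<^esub> \<in> TU b" by (rule LinearCombinations.submodule.zero_closed[OF s])
  show "c \<in> TU b \<Longrightarrow> c' \<in> TU b \<Longrightarrow> c \<oplus>\<^bsub>TF b\<^esub> c' \<in> TU b" by (rule LinearCombinations.submodule.m_closed[OF s])
  show "r \<in> carrier R \<Longrightarrow> c \<in> TU b \<Longrightarrow> r \<odot>\<^bsub>TF b\<^esub> c \<in> TU b" by (rule LinearCombinations.submodule.smult_closed[OF s])
qed

abbreviation (input) eqv where "eqv c c' \<equiv> c \<ominus>\<^bsub>TF b\<^esub> c' \<in> TU b"

lemma eqv_refl: "c \<in> carrier (TF b) \<Longrightarrow> eqv c c"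
  unfolding C.minus_eq by (simp only: C.r_neg TU_closed(2))

lemma eqv_trans:
  assumes c: "c \<in> carrier (TF b)" "c' \<in> carrier (TF b)" "c'' \<in> carrier (TF b)" and "eqv c c'" "eqv c' c''"
  shows "eqv c c''"
proof -
  have "(c \<ominus>\<^bsub>TF b\<^esub> c') \<oplus>\<^bsub>TF b\<^esub> (c' \<ominus>\<^bsub>TF b\<^esub> c'') = c \<ominus>\<^bsub>TF b\<^esub> c''"
    using c unfolding C.minus_eq
    by (simp only: C.a_assoc C.a_inv_closed C.a_closed C.r_neg2 C.r_neg1)
  then show ?thesis using TU_closed(3)[OF assms(4,5)] by (simp only:)
qed

lemma eqv_add:
  assumes c: "c \<in> carrier (TF b)" "c' \<in> carrier (TF b)" "a \<in> carrier (TF b)" "a' \<in> carrier (TF b)" and "eqv c c'" "eqv a a'"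
  shows "eqv (c \<oplus>\<^bsub>TF b\<^esub> a) (c' \<oplus>\<^bsub>TF b\<^esub> a')"
proof -
  have "(c \<ominus>\<^bsub>TF b\<^esub> c') \<oplus>\<^bsub>TF b\<^esub> (a \<ominus>\<^bsub>TF b\<^esub> a') = (c \<oplus>\<^bsub>TF b\<^esub> a) \<ominus>\<^bsub>TF b\<^esub> (c' \<oplus>\<^bsub>TF b\<^esub> a')"
    using c unfolding C.minus_eq by (simp only: C.minus_add C.a_ac C.a_inv_closed C.a_closed)
  then show ?thesis using TU_closed(3)[OF assms(5,6)] by (simp only:)
qed

lemma eqv_smult:
  assumes c: "c \<in> carrier (TF b)" "c' \<in> carrier (TF b)" "r \<in> carrier R" and "eqv c c'"
  shows "eqv (r \<odot>\<^bsub>TF b\<^esub> c) (r \<odot>\<^bsub>TF b\<^esub> c')"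
proof -
  have "r \<odot>\<^bsub>TF b\<^esub> (c \<ominus>\<^bsub>TF b\<^esub> c') = (r \<odot>\<^bsub>TF b\<^esub> c) \<ominus>\<^bsub>TF b\<^esub> (r \<odot>\<^bsub>TF b\<^esub> c')"
    using c unfolding C.minus_eq by (simp only: C.smult_r_distr C.smult_r_minus C.a_inv_closed)
  then show ?thesis using TU_closed(4)[OF assms(3,4)] by (simp only:)
qed

text \<open>The combination \<open>\<Sum> r\<^sub>j (1, \<epsilon>\<^sub>j)\<close> over \<open>j < n\<close> with unit vectors \<open>\<epsilon>\<^sub>j\<close>; up to the tensor relations every
  combination has this form (\<open>eqv_emb\<close>).\<close>

primrec emb where
  "emb 0 r = \<zero>\<^bsub>TF b\<^esub>"
| "emb (Suc n) r = emb n r \<oplus>\<^bsub>TF b\<^esub> r n \<odot>\<^bsub>TF b\<^esub> e \<one>\<^bsub>K\<^esub> (prv (unitv n))"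

lemma unit_TF: "n < b \<Longrightarrow> x \<in> carrier K \<Longrightarrow> e x (prv (unitv n)) \<in> carrier (TF b)"
  by (intro basis_elt_TF K_closed prv_carrier unitv_pvec)

lemma emb_carrier: "n \<le> b \<Longrightarrow> r \<in> carrier (F b) \<Longrightarrow> emb n r \<in> carrier (TF b)"
proof (induction n)
  case (Suc n)
  then show ?case unfolding emb.simps
    by (intro C.a_closed C.smult_closed unit_TF K_closed R.free_mod_on_value[OF Suc.prems(2)]) simp_all
qed (simp only: emb.simps C.zero_closed)

lemma emb_add: "n \<le> b \<Longrightarrow> r \<in> carrier (F b) \<Longrightarrow> r' \<in> carrier (F b) \<Longrightarrow> emb n (r \<oplus>\<^bsub>F b\<^esub> r') = emb n r \<oplus>\<^bsub>TF b\<^esub> emb n r'"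
proof (induction n)
  case 0
  show ?case unfolding emb.simps by (rule C.l_zero[OF C.zero_closed, symmetric])
next
  case (Suc n)
  have n: "n < b" "n \<le> b" using Suc.prems(1) by simp_all
  have v: "r n \<in> carrier R" "r' n \<in> carrier R" by (rule R.free_mod_on_value[OF Suc.prems(2)], rule R.free_mod_on_value[OF Suc.prems(3)])
  have u: "e \<one>\<^bsub>K\<^esub> (prv (unitv n)) \<in> carrier (TF b)" using n(1) by (intro unit_TF K_closed)
  have IH: "emb n (r \<oplus>\<^bsub>F b\<^esub> r') = emb n r \<oplus>\<^bsub>TF b\<^esub> emb n r'" using Suc.IH[OF n(2) Suc.prems(2,3)] .
  have s: "(r \<oplus>\<^bsub>F b\<^esub> r') n = r n \<oplus>\<^bsub>R\<^esub> r' n" by (simp only: free_mod_on_simps(3))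
  show ?case unfolding emb.simps IH s C.smult_l_distr[OF v u]
    using emb_carrier[OF n(2) Suc.prems(2)] emb_carrier[OF n(2) Suc.prems(3)] C.smult_closed[OF v(1) u] C.smult_closed[OF v(2) u]
    by (simp only: C.a_ac C.a_closed)
qed

lemma emb_smult: "n \<le> b \<Longrightarrow> a \<in> carrier R \<Longrightarrow> r \<in> carrier (F b) \<Longrightarrow> emb n (a \<odot>\<^bsub>F b\<^esub> r) = a \<odot>\<^bsub>TF b\<^esub> emb n r"
proof (induction n)
  case 0
  show ?case unfolding emb.simps by (rule C.smult_r_null[OF 0(2), symmetric])
next
  case (Suc n)
  have n: "n < b" "n \<le> b" using Suc.prems(1) by simp_all
  have v: "r n \<in> carrier R" using Suc.prems(3) by (rule R.free_mod_on_value)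
  have u: "e \<one>\<^bsub>K\<^esub> (prv (unitv n)) \<in> carrier (TF b)" using n(1) by (intro unit_TF K_closed)
  have IH: "emb n (a \<odot>\<^bsub>F b\<^esub> r) = a \<odot>\<^bsub>TF b\<^esub> emb n r" using Suc.IH[OF n(2) Suc.prems(2,3)] .
  have s: "(a \<odot>\<^bsub>F b\<^esub> r) n = a \<otimes>\<^bsub>R\<^esub> r n" by (simp only: free_mod_on_simps(4))
  show ?case unfolding emb.simps IH s C.smult_assoc1[OF Suc.prems(2) v u]
    by (rule C.smult_r_distr[OF Suc.prems(2) emb_carrier[OF n(2) Suc.prems(3)] C.smult_closed[OF v u], symmetric])
qed

lemma emb_unit: "n \<le> b \<Longrightarrow> l < b \<Longrightarrow> a \<in> carrier R \<Longrightarrow>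
    emb n (\<lambda>j. if j = l then a else \<zero>\<^bsub>R\<^esub>) = (if l < n then a \<odot>\<^bsub>TF b\<^esub> e \<one>\<^bsub>K\<^esub> (prv (unitv l)) else \<zero>\<^bsub>TF b\<^esub>)"
proof (induction n)
  case (Suc n)
  have n: "n < b" "n \<le> b" using Suc.prems(1) by simp_all
  have u: "i < b \<Longrightarrow> e \<one>\<^bsub>K\<^esub> (prv (unitv i)) \<in> carrier (TF b)" for i by (intro unit_TF K_closed)
  have IH: "emb n (\<lambda>j. if j = l then a else \<zero>\<^bsub>R\<^esub>) = (if l < n then a \<odot>\<^bsub>TF b\<^esub> e \<one>\<^bsub>K\<^esub> (prv (unitv l)) else \<zero>\<^bsub>TF b\<^esub>)"
    using Suc.IH[OF n(2) Suc.prems(2,3)] .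
  consider "l < n" | "l = n" | "n < l" by linarith
  then show ?case
  proof cases
    case 1
    then have "n \<noteq> l" "l < Suc n" by simp_all
    then show ?thesis unfolding emb.simps IH using 1
      by (simp only: simp_thms if_True if_False C.smult_l_null[OF u[OF n(1)]] C.r_zero[OF C.smult_closed[OF Suc.prems(3) u[OF Suc.prems(2)]]])
  next
    case 2
    then have "\<not> l < n" "l < Suc n" by simp_all
    then show ?thesis unfolding emb.simps IH using 2
      by (simp only: simp_thms if_True if_False C.l_zero[OF C.smult_closed[OF Suc.prems(3) u[OF n(1)]]])
  next
    case 3
    then have "n \<noteq> l" "\<not> l < Suc n" "\<not> l < n" by simp_all
    then show ?thesis unfolding emb.simps IH
      by (simp only: simp_thms if_True if_False C.smult_l_null[OF u[OF n(1)]] C.r_zero[OF C.zero_closed])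
  qed
qed (simp only: emb.simps not_less_zero if_False)

lemma tau_emb: "n \<le> b \<Longrightarrow> r \<in> carrier (F b) \<Longrightarrow> tau (emb n r) = (\<lambda>j. if j < n then ct (r j) else 0)"
proof (induction n)
  case 0
  show ?case unfolding emb.simps tau_zero by (simp add: zero_fun_def)
next
  case (Suc n)
  have n: "n < b" "n \<le> b" using Suc.prems(1) by simp_all
  have v: "r n \<in> carrier R" using Suc.prems(2) by (rule R.free_mod_on_value)
  have u: "e \<one>\<^bsub>K\<^esub> (prv (unitv n)) \<in> carrier (TF b)" using n(1) by (intro unit_TF K_closed)
  have IH: "tau (emb n r) = (\<lambda>j. if j < n then ct (r j) else 0)" using Suc.IH[OF n(2) Suc.prems(2)] .
  have "ct (prv (unitv n) j) = (if j = n then 1 else 0)" for j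
    by (simp add: prv_def unitv_def pr_one pr_zero)
  then show ?case unfolding emb.simps tau_add[OF emb_carrier[OF n(2) Suc.prems(2)] C.smult_closed[OF v u]] tau_smult[OF v u] tau_basis_elt IH kt_one
    by (auto simp: fun_eq_iff less_Suc_eq)
qed

lemma zero_pair: "y \<in> carrier (F b) \<Longrightarrow> e \<zero>\<^bsub>K\<^esub> y \<in> TU b"
proof -
  assume y: "y \<in> carrier (F b)"
  have z: "rs \<zero>\<^bsub>R\<^esub> \<otimes>\<^bsub>K\<^esub> \<zero>\<^bsub>K\<^esub> = \<zero>\<^bsub>K\<^esub>"
    by (rule kt_inj) (simp_all add: K_closed rs_carrier kt_mult kt_zero)
  have "e (rs \<zero>\<^bsub>R\<^esub> \<otimes>\<^bsub>K\<^esub> \<zero>\<^bsub>K\<^esub>) y \<ominus>\<^bsub>TF b\<^esub> \<zero>\<^bsub>R\<^esub> \<odot>\<^bsub>TF b\<^esub> e \<zero>\<^bsub>K\<^esub> y \<in> TU b"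
    by (rule rel_mem(2)[OF K_closed(4) K_closed(4) y y R.zero_closed])
  then have h: "e \<zero>\<^bsub>K\<^esub> y \<ominus>\<^bsub>TF b\<^esub> \<zero>\<^bsub>R\<^esub> \<odot>\<^bsub>TF b\<^esub> e \<zero>\<^bsub>K\<^esub> y \<in> TU b" unfolding z .
  have c: "e \<zero>\<^bsub>K\<^esub> y \<in> carrier (TF b)" using y by (intro basis_elt_TF K_closed)
  show ?thesis using h unfolding C.smult_l_null[OF c] C.minus_eq C.minus_equality[OF C.l_zero[OF C.zero_closed] C.zero_closed C.zero_closed] C.r_zero[OF c] .
qed

lemma maximal_times_unit: "n < b \<Longrightarrow> m \<in> carrier R \<Longrightarrow> ct m = 0 \<Longrightarrow> m \<odot>\<^bsub>TF b\<^esub> e \<one>\<^bsub>K\<^esub> (prv (unitv n)) \<in> TU b"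
proof -
  assume n: "n < b" and m: "m \<in> carrier R" "ct m = 0"
  have y: "prv (unitv n) \<in> carrier (F b)" using n by (intro prv_carrier unitv_pvec)
  have z: "rs m \<otimes>\<^bsub>K\<^esub> \<one>\<^bsub>K\<^esub> = \<zero>\<^bsub>K\<^esub>"
    by (rule kt_inj) (simp_all add: K_closed rs_carrier kt_mult kt_zero m)
  let ?u = "m \<odot>\<^bsub>TF b\<^esub> e \<one>\<^bsub>K\<^esub> (prv (unitv n))"
  have u: "?u \<in> carrier (TF b)" using n m(1) by (intro C.smult_closed unit_TF K_closed)
  have 1: "e \<zero>\<^bsub>K\<^esub> (prv (unitv n)) \<ominus>\<^bsub>TF b\<^esub> ?u \<in> TU b"
    using rel_mem(2)[OF K_closed(3) K_closed(3) y y m(1)] unfolding z .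
  let ?z = "e \<zero>\<^bsub>K\<^esub> (prv (unitv n))"
  have zc: "?z \<in> carrier (TF b)" using zero_pair[OF y] by (rule TU_closed(1))
  have "\<ominus>\<^bsub>R\<^esub> \<one>\<^bsub>R\<^esub> \<odot>\<^bsub>TF b\<^esub> (?z \<ominus>\<^bsub>TF b\<^esub> ?u) = \<ominus>\<^bsub>TF b\<^esub> (?z \<ominus>\<^bsub>TF b\<^esub> ?u)"
    using C.smult_l_minus[OF R.one_closed C.minus_closed[OF zc u]] C.smult_one[OF C.minus_closed[OF zc u]] by (simp only:)
  then have "\<ominus>\<^bsub>TF b\<^esub> (?z \<ominus>\<^bsub>TF b\<^esub> ?u) \<in> TU b" using TU_closed(4)[OF R.a_inv_closed[OF R.one_closed] 1] by (simp only:)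
  from TU_closed(3)[OF zero_pair[OF y] this] have "?z \<oplus>\<^bsub>TF b\<^esub> \<ominus>\<^bsub>TF b\<^esub> (?z \<ominus>\<^bsub>TF b\<^esub> ?u) \<in> TU b" .
  also have "?z \<oplus>\<^bsub>TF b\<^esub> \<ominus>\<^bsub>TF b\<^esub> (?z \<ominus>\<^bsub>TF b\<^esub> ?u) = ?u"
    unfolding C.minus_eq using zc u
    by (simp only: C.minus_add C.minus_minus C.a_inv_closed C.r_neg2)
  finally show ?thesis .
qed

lemma emb_maximal: "n \<le> b \<Longrightarrow> r \<in> carrier (F b) \<Longrightarrow> (\<And>j. j < b \<Longrightarrow> ct (r j) = 0) \<Longrightarrow> emb n r \<in> TU b"
proof (induction n)
  case (Suc n)
  show ?case unfolding emb.simps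
    using Suc by (intro TU_closed(3) maximal_times_unit R.free_mod_on_value[OF Suc.prems(2)]) simp_all
qed (simp only: emb.simps TU_closed(2))

lemma eqv_emb_basis_elt:
  assumes x: "x \<in> carrier K" and y: "y \<in> carrier (F b)"
  shows "\<exists>r\<in>carrier (F b). eqv (e x y) (emb b r)"
  using y
proof (induction rule: F_induct)
  case zero
  have c: "e x \<zero>\<^bsub>F b\<^esub> \<in> carrier (TF b)" by (intro basis_elt_TF x Fb.zero_closed)
  have "e x (\<zero>\<^bsub>R\<^esub> \<odot>\<^bsub>F b\<^esub> \<zero>\<^bsub>F b\<^esub>) \<ominus>\<^bsub>TF b\<^esub> \<zero>\<^bsub>R\<^esub> \<odot>\<^bsub>TF b\<^esub> e x \<zero>\<^bsub>F b\<^esub> \<in> TU b"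
    by (rule rel_mem(3)[OF x x Fb.zero_closed Fb.zero_closed R.zero_closed])
  then have "eqv (e x \<zero>\<^bsub>F b\<^esub>) \<zero>\<^bsub>TF b\<^esub>" unfolding C.smult_l_null[OF c] Fb.smult_l_null[OF Fb.zero_closed] .
  moreover have "emb b (\<zero>\<^bsub>R\<^esub> \<odot>\<^bsub>F b\<^esub> \<zero>\<^bsub>F b\<^esub>) = \<zero>\<^bsub>TF b\<^esub>"
    unfolding emb_smult[OF order_refl R.zero_closed Fb.zero_closed] by (rule C.smult_l_null[OF emb_carrier[OF order_refl Fb.zero_closed]])
  ultimately have "eqv (e x \<zero>\<^bsub>F b\<^esub>) (emb b \<zero>\<^bsub>F b\<^esub>)" unfolding Fb.smult_l_null[OF Fb.zero_closed] by (simp only:)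
  then show ?case by (intro bexI[OF _ Fb.zero_closed])
next
  case (add y z)
  then obtain r r' where r: "r \<in> carrier (F b)" "eqv (e x y) (emb b r)" "r' \<in> carrier (F b)" "eqv (e x z) (emb b r')" by (elim bexE)
  have c: "e x y \<in> carrier (TF b)" "e x z \<in> carrier (TF b)" "e x (y \<oplus>\<^bsub>F b\<^esub> z) \<in> carrier (TF b)"
    by (rule basis_elt_TF[OF x add(1)], rule basis_elt_TF[OF x add(2)], rule basis_elt_TF[OF x Fb.a_closed[OF add(1,2)]])
  have E: "emb b r \<in> carrier (TF b)" "emb b r' \<in> carrier (TF b)" by (rule emb_carrier[OF order_refl r(1)], rule emb_carrier[OF order_refl r(3)])
  have "eqv (e x (y \<oplus>\<^bsub>F b\<^esub> z)) (emb b r \<oplus>\<^bsub>TF b\<^esub> emb b r')"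
    by (rule eqv_trans[OF c(3) C.a_closed[OF c(1,2)] C.a_closed[OF E] rel_mem(1)[OF x x add(1,2) R.zero_closed] eqv_add[OF c(1) E(1) c(2) E(2) r(2,4)]])
  then show ?case unfolding emb_add[OF order_refl r(1,3), symmetric] by (intro bexI[OF _ Fb.a_closed[OF r(1,3)]])
next
  case (smult a y)
  then obtain r where r: "r \<in> carrier (F b)" "eqv (e x y) (emb b r)" by (elim bexE)
  have c: "e x y \<in> carrier (TF b)" "e x (a \<odot>\<^bsub>F b\<^esub> y) \<in> carrier (TF b)"
    by (rule basis_elt_TF[OF x smult(2)], rule basis_elt_TF[OF x Fb.smult_closed[OF smult(1,2)]])
  have E: "emb b r \<in> carrier (TF b)" by (rule emb_carrier[OF order_refl r(1)])
  have "eqv (e x (a \<odot>\<^bsub>F b\<^esub> y)) (a \<odot>\<^bsub>TF b\<^esub> emb b r)"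
    by (rule eqv_trans[OF c(2) C.smult_closed[OF smult(1) c(1)] C.smult_closed[OF smult(1) E] rel_mem(3)[OF x x smult(2,2,1)] eqv_smult[OF c(1) E smult(1) r(2)]])
  then show ?case unfolding emb_smult[OF order_refl smult(1) r(1), symmetric] by (intro bexI[OF _ Fb.smult_closed[OF smult(1) r(1)]])
next
  case (unit l)
  have y: "prv (unitv l) \<in> carrier (F b)" using unit by (intro prv_carrier unitv_pvec)
  have xe: "rs (kc (kt x)) \<otimes>\<^bsub>K\<^esub> \<one>\<^bsub>K\<^esub> = x"
    by (rule kt_inj) (simp_all add: K_closed rs_carrier kt_mult kt_one x)
  have "eqv (e (rs (kc (kt x)) \<otimes>\<^bsub>K\<^esub> \<one>\<^bsub>K\<^esub>) (prv (unitv l))) (kc (kt x) \<odot>\<^bsub>TF b\<^esub> e \<one>\<^bsub>K\<^esub> (prv (unitv l)))"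
    by (rule rel_mem(2)[OF K_closed(3) K_closed(3) y y kc_carrier])
  then have "eqv (e x (prv (unitv l))) (emb b (\<lambda>j. if j = l then kc (kt x) else \<zero>\<^bsub>R\<^esub>))"
    unfolding xe emb_unit[OF order_refl unit kc_carrier] using unit by (simp only: if_True)
  moreover have "(\<lambda>j. if j = l then kc (kt x) else \<zero>\<^bsub>R\<^esub>) \<in> carrier (F b)"
    unfolding F_carrier_iff using unit by auto
  ultimately show ?case by (rule bexI)
qed

lemma eqv_emb:
  assumes "c \<in> carrier (TF b)"
  shows "\<exists>r\<in>carrier (F b). eqv c (emb b r)"
proof -
  have "\<exists>r\<in>carrier (F b). eqv c (emb b r)" if "finite S" "c \<in> carrier (TF b)" "{s. c s \<noteq> \<zero>\<^bsub>R\<^esub>} \<subseteq> S" for S c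
    using that
  proof (induction S arbitrary: c rule: finite_induct)
    case empty
    then have "c = (\<lambda>s. \<zero>\<^bsub>R\<^esub>)" by auto
    then have c: "c = \<zero>\<^bsub>TF b\<^esub>" by (simp only: free_mod_on_simps(2))
    have "emb b (\<zero>\<^bsub>R\<^esub> \<odot>\<^bsub>F b\<^esub> \<zero>\<^bsub>F b\<^esub>) = \<zero>\<^bsub>TF b\<^esub>"
      unfolding emb_smult[OF order_refl R.zero_closed Fb.zero_closed] by (rule C.smult_l_null[OF emb_carrier[OF order_refl Fb.zero_closed]])
    then have "eqv c (emb b \<zero>\<^bsub>F b\<^esub>)" unfolding c Fb.smult_l_null[OF Fb.zero_closed] using eqv_refl[OF C.zero_closed] by (simp only:)
    then show ?case by (intro bexI[OF _ Fb.zero_closed])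
  next
    case (insert s S)
    show ?case
    proof (cases "c s = \<zero>\<^bsub>R\<^esub>")
      case True
      then show ?thesis using insert by (intro insert.IH) auto
    next
      case False
      obtain x y where s: "s = (x, y)" by (cases s)
      have xy: "x \<in> carrier K" "y \<in> carrier (F b)" using TF_support[OF insert.prems(1) False] s by simp_all
      define c' where "c' = c(s := \<zero>\<^bsub>R\<^esub>)"
      have c': "c' \<in> carrier (TF b)"
      proof (rule free_mod_on_memI)
        show "c' u \<in> carrier R" for u using TF_value[OF insert.prems(1)] by (simp add: c'_def)
        show "c' u = \<zero>\<^bsub>R\<^esub>" if "u \<notin> pairs b" for u using free_mod_on_outside[OF insert.prems(1) that] by (simp add: c'_def)
        show "finite {u. c' u \<noteq> \<zero>\<^bsub>R\<^esub>}" by (rule finite_subset[OF _ TF_finite[OF insert.prems(1)]]) (auto simp: c'_def)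
      qed
      have sub: "{u. c' u \<noteq> \<zero>\<^bsub>R\<^esub>} \<subseteq> S" using insert.prems(2) by (auto simp: c'_def)
      obtain r where r: "r \<in> carrier (F b)" "eqv c' (emb b r)" using insert.IH[OF c' sub] by (elim bexE)
      obtain r' where r': "r' \<in> carrier (F b)" "eqv (e x y) (emb b r')" using eqv_emb_basis_elt[OF xy] by (elim bexE)
      have v: "c s \<in> carrier R" by (rule TF_value[OF insert.prems(1)])
      have ec: "e x y \<in> carrier (TF b)" by (rule basis_elt_TF[OF xy])
      have E: "emb b r \<in> carrier (TF b)" "emb b r' \<in> carrier (TF b)" by (rule emb_carrier[OF order_refl r(1)], rule emb_carrier[OF order_refl r'(1)])
      have c_eq: "c = c' \<oplus>\<^bsub>TF b\<^esub> c s \<odot>\<^bsub>TF b\<^esub> e x y"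
      proof
        fix u
        have "c u \<in> carrier R" by (rule TF_value[OF insert.prems(1)])
        then show "c u = (c' \<oplus>\<^bsub>TF b\<^esub> c s \<odot>\<^bsub>TF b\<^esub> e x y) u"
          using v unfolding free_mod_on_simps(3,4) by (simp add: c'_def s[symmetric] basis_elt_def)
      qed
      have "eqv c (emb b r \<oplus>\<^bsub>TF b\<^esub> c s \<odot>\<^bsub>TF b\<^esub> emb b r')"
        by (subst (1) c_eq) (rule eqv_add[OF c' E(1) C.smult_closed[OF v ec] C.smult_closed[OF v E(2)] r(2) eqv_smult[OF ec E(2) v r'(2)]])
      then show ?thesis unfolding emb_smult[OF order_refl v r'(1), symmetric] emb_add[OF order_refl r(1) Fb.smult_closed[OF v r'(1)], symmetric]
        by (intro bexI[OF _ Fb.a_closed[OF r(1) Fb.smult_closed[OF v r'(1)]]])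
    qed
  qed
  from this[OF TF_finite[OF assms] assms subset_refl] show ?thesis .
qed

text \<open>The coordinates respect the defining relations. Conversely, a combination is equivalent to
  some \<open>\<Sum> r\<^sub>j (1, \<epsilon>\<^sub>j)\<close>; if its coordinates vanish, the \<open>r\<^sub>j\<close> lie in the maximal ideal, which kills
  the factor \<open>1\<close>.\<close>

lemma tensor_null_eq: "TU b = {c \<in> carrier (TF b). tau c = 0}"
proof
  have "LinearCombinations.submodule R {c \<in> carrier (TF b). tau c = 0} (TF b)"
  proof (rule LinearCombinations.submodule.intro)
    show "Module.module R (TF b)" by (rule C.module_axioms)
    show "{c \<in> carrier (TF b). tau c = 0} \<subseteq> carrier (TF b)" by blast
    show "v \<oplus>\<^bsub>TF b\<^esub> w \<in> {c \<in> carrier (TF b). tau c = 0}" if "v \<in> {c \<in> carrier (TF b). tau c = 0}" "w \<in> {c \<in> carrier (TF b). tau c = 0}" for v w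
    proof -
      have vw: "v \<in> carrier (TF b)" "tau v = 0" "w \<in> carrier (TF b)" "tau w = 0" using that by simp_all
      show ?thesis using C.a_closed[OF vw(1,3)] tau_add[OF vw(1,3)] unfolding vw(2,4) by simp
    qed
    show "\<zero>\<^bsub>TF b\<^esub> \<in> {c \<in> carrier (TF b). tau c = 0}" by (intro CollectI conjI C.zero_closed tau_zero)
    show "a \<odot>\<^bsub>TF b\<^esub> v \<in> {c \<in> carrier (TF b). tau c = 0}" if "a \<in> carrier R" "v \<in> {c \<in> carrier (TF b). tau c = 0}" for a v
    proof -
      have v: "v \<in> carrier (TF b)" "tau v = 0" using that by simp_all
      show ?thesis using C.smult_closed[OF that(1) v(1)] tau_smult[OF that(1) v(1)] unfolding v(2) by (simp add: zero_fun_def)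
    qed
  qed
  moreover have "tensor_rels R kmod (F b) \<subseteq> {c \<in> carrier (TF b). tau c = 0}"
  proof
    fix c assume c: "c \<in> tensor_rels R kmod (F b)"
    have cc: "c \<in> carrier (TF b)" using c tensor_rels_subset by (rule rev_subsetD)
    from c consider
      (1) x x' y where "c = e (x \<oplus>\<^bsub>K\<^esub> x') y \<ominus>\<^bsub>TF b\<^esub> (e x y \<oplus>\<^bsub>TF b\<^esub> e x' y)" "x \<in> carrier K" "x' \<in> carrier K" "y \<in> carrier (F b)"
    | (2) x y y' where "c = e x (y \<oplus>\<^bsub>F b\<^esub> y') \<ominus>\<^bsub>TF b\<^esub> (e x y \<oplus>\<^bsub>TF b\<^esub> e x y')" "x \<in> carrier K" "y \<in> carrier (F b)" "y' \<in> carrier (F b)"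
    | (3) r x y where "c = e (rs r \<otimes>\<^bsub>K\<^esub> x) y \<ominus>\<^bsub>TF b\<^esub> r \<odot>\<^bsub>TF b\<^esub> e x y" "r \<in> carrier R" "x \<in> carrier K" "y \<in> carrier (F b)"
    | (4) r x y where "c = e x (r \<odot>\<^bsub>F b\<^esub> y) \<ominus>\<^bsub>TF b\<^esub> r \<odot>\<^bsub>TF b\<^esub> e x y" "r \<in> carrier R" "x \<in> carrier K" "y \<in> carrier (F b)"
      unfolding tensor_rels_def Let_def kmod_simps by (elim UnE CollectE exE conjE) (assumption | rule that)+
    then have "tau c = 0"
    proof cases
      case 1
      show ?thesis unfolding 1(1) using 1(2-4)
        by (simp add: tau_minus tau_add tau_basis_elt basis_elt_TF K_closed C.a_closed kt_add fun_eq_iff distrib_right del: free_mod_on_simps kmod_simps)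
    next
      case 2
      have v: "y j \<in> carrier R" "y' j \<in> carrier R" for j by (rule R.free_mod_on_value[OF 2(3)], rule R.free_mod_on_value[OF 2(4)])
      have "ct ((y \<oplus>\<^bsub>F b\<^esub> y') j) = ct (y j) + ct (y' j)" for j unfolding free_mod_on_simps(3) by (rule ct_add[OF v])
      then show ?thesis unfolding 2(1) using 2(2-4)
        by (simp add: tau_minus tau_add tau_basis_elt basis_elt_TF C.a_closed Fb.a_closed fun_eq_iff distrib_left del: free_mod_on_simps kmod_simps)
    next
      case 3
      note closed = basis_elt_TF[OF K_closed(2)[OF rs_carrier[OF 3(2)] 3(3)] 3(4)] basis_elt_TF[OF 3(3,4)]
      show ?thesis unfolding 3(1) tau_minus[OF closed(1) C.smult_closed[OF 3(2) closed(2)]] tau_smult[OF 3(2) closed(2)]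
          tau_basis_elt kt_mult[OF rs_carrier[OF 3(2)] 3(3)] kt_rs[OF 3(2)]
        by (simp only: mult.assoc diff_self)
    next
      case 4
      have v: "y j \<in> carrier R" for j using 4(4) by (rule R.free_mod_on_value)
      have "ct ((r \<odot>\<^bsub>F b\<^esub> y) j) = ct r * ct (y j)" for j unfolding free_mod_on_simps(4) by (rule ct_mult[OF 4(2) v])
      note ct_eq = this
      note closed = basis_elt_TF[OF 4(3) Fb.smult_closed[OF 4(2,4)]] basis_elt_TF[OF 4(3,4)]
      show ?thesis unfolding 4(1) tau_minus[OF closed(1) C.smult_closed[OF 4(2) closed(2)]] tau_smult[OF 4(2) closed(2)] tau_basis_elt ct_eq
        by (simp only: mult.left_commute diff_self)
    qed
    with cc show "c \<in> {c \<in> carrier (TF b). tau c = 0}" by simp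
  qed
  ultimately show "TU b \<subseteq> {c \<in> carrier (TF b). tau c = 0}"
    unfolding tensor_null_def by (intro C.span_is_subset)
  show "{c \<in> carrier (TF b). tau c = 0} \<subseteq> TU b"
  proof
    fix c assume "c \<in> {c \<in> carrier (TF b). tau c = 0}"
    then have c: "c \<in> carrier (TF b)" "tau c = 0" by simp_all
    obtain r where r: "r \<in> carrier (F b)" "eqv c (emb b r)" using eqv_emb[OF c(1)] by (elim bexE)
    have E: "emb b r \<in> carrier (TF b)" by (rule emb_carrier[OF order_refl r(1)])
    have "tau (c \<ominus>\<^bsub>TF b\<^esub> emb b r) = 0" using \<open>TU b \<subseteq> _\<close> r(2) by blast
    then have "tau (emb b r) = 0" unfolding tau_minus[OF c(1) E] c(2) by simp
    then have "ct (r j) = 0" if "j < b" for j using that unfolding tau_emb[OF order_refl r(1)] by (auto simp: fun_eq_iff dest: spec[of _ j])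
    then have "emb b r \<in> TU b" by (intro emb_maximal order_refl r(1))
    with r(2) have "(c \<ominus>\<^bsub>TF b\<^esub> emb b r) \<oplus>\<^bsub>TF b\<^esub> emb b r \<in> TU b" by (rule TU_closed(3))
    moreover have "(c \<ominus>\<^bsub>TF b\<^esub> emb b r) \<oplus>\<^bsub>TF b\<^esub> emb b r = c"
      unfolding C.minus_eq by (simp only: C.a_assoc[OF c(1) C.a_inv_closed[OF E] E] C.l_neg[OF E] C.r_zero[OF c(1)])
    ultimately show "c \<in> TU b" by simp
  qed
qed

lemma tau_surj:
  assumes "a \<in> kvec b"
  obtains c where "c \<in> carrier (TF b)" "tau c = a"
proof
  let ?r = "\<lambda>j. if j < b then kc (a j) else \<zero>\<^bsub>R\<^esub>"
  have r: "?r \<in> carrier (F b)" unfolding F_carrier_iff by auto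
  show "emb b ?r \<in> carrier (TF b)" by (rule emb_carrier[OF order_refl r])
  show "tau (emb b ?r) = a" unfolding tau_emb[OF order_refl r] using assms by (auto simp: kvec_def fun_eq_iff)
qed

end


section \<open>Homology of \<open>k \<otimes> F\<close>\<close>

text \<open>The cosets of the tensor relations are the fibres of the coordinate map.\<close>

definition fibre :: "nat \<Rightarrow> (nat \<Rightarrow> 'k) \<Rightarrow> ('k mpoly set set \<times> (nat \<Rightarrow> 'k mpoly set) \<Rightarrow> 'k mpoly set) set" where
  "fibre b a = {c \<in> carrier (TF b). tau c = a}"

lemma fibre_memI: "c \<in> carrier (TF b) \<Longrightarrow> tau c = a \<Longrightarrow> c \<in> fibre b a"
  unfolding fibre_def by (intro CollectI conjI)

lemma fibre_memD: "c \<in> fibre b a \<Longrightarrow> c \<in> carrier (TF b)" "c \<in> fibre b a \<Longrightarrow> tau c = a"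
  unfolding fibre_def by (erule CollectE, erule conjunct1) (erule CollectE, erule conjunct2)

lemma fibre_nonempty:
  assumes "a \<in> kvec b" obtains c where "c \<in> fibre b a"
proof -
  obtain c where "c \<in> carrier (TF b)" "tau c = a" using assms by (rule tau_surj)
  then show ?thesis by (intro that fibre_memI)
qed

lemma fibre_inj: "a \<in> kvec b \<Longrightarrow> fibre b a = fibre b a' \<Longrightarrow> a = a'"
proof -
  assume a: "a \<in> kvec b" and e: "fibre b a = fibre b a'"
  obtain c where c: "c \<in> fibre b a" using a by (rule fibre_nonempty)
  then have "c \<in> fibre b a'" unfolding e .
  with c show ?thesis using fibre_memD(2)[OF c] fibre_memD(2)[of c b a'] by (simp only:)
qed

lemma TU_fibre: "TU b = fibre b 0"
  unfolding fibre_def by (rule tensor_null_eq)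

lemma TF_diff_add:
  assumes c: "c \<in> carrier (TF b)" "c' \<in> carrier (TF b)"
  shows "(c \<ominus>\<^bsub>TF b\<^esub> c') \<oplus>\<^bsub>TF b\<^esub> c' = c" "c \<ominus>\<^bsub>TF b\<^esub> c' \<in> carrier (TF b)"
proof -
  interpret C: Module.module R "TF b" by (rule R.free_mod_on_module)
  show "(c \<ominus>\<^bsub>TF b\<^esub> c') \<oplus>\<^bsub>TF b\<^esub> c' = c"
    unfolding C.minus_eq by (simp only: C.a_assoc[OF c(1) C.a_inv_closed[OF c(2)] c(2)] C.l_neg[OF c(2)] C.r_zero[OF c(1)])
  show "c \<ominus>\<^bsub>TF b\<^esub> c' \<in> carrier (TF b)" by (rule C.minus_closed[OF c])
qed

lemma fibre_add:
  assumes a': "a' \<in> kvec b"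
  shows "fibre b a <+>\<^bsub>TF b\<^esub> fibre b a' = fibre b (a + a')"
proof (intro equalityI subsetI)
  interpret C: Module.module R "TF b" by (rule R.free_mod_on_module)
  fix x assume "x \<in> fibre b a <+>\<^bsub>TF b\<^esub> fibre b a'"
  then obtain c c' where c: "c \<in> fibre b a" "c' \<in> fibre b a'" "x = c \<oplus>\<^bsub>TF b\<^esub> c'"
    unfolding set_add_def' by (elim UN_E singletonE)
  show "x \<in> fibre b (a + a')"
    unfolding c(3) using fibre_memD[OF c(1)] fibre_memD[OF c(2)]
    by (intro fibre_memI C.a_closed) (simp_all only: tau_add)
next
  fix x assume x: "x \<in> fibre b (a + a')"
  obtain c' where c': "c' \<in> fibre b a'" using a' by (rule fibre_nonempty)
  note xc = fibre_memD(1)[OF x] fibre_memD(1)[OF c']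
  have "x \<ominus>\<^bsub>TF b\<^esub> c' \<in> fibre b a"
    by (rule fibre_memI[OF TF_diff_add(2)[OF xc]])
      (simp only: tau_minus[OF xc] fibre_memD(2)[OF x] fibre_memD(2)[OF c'] add_diff_cancel_right')
  then have "(x \<ominus>\<^bsub>TF b\<^esub> c') \<oplus>\<^bsub>TF b\<^esub> c' \<in> fibre b a <+>\<^bsub>TF b\<^esub> fibre b a'"
    unfolding set_add_def' by (rule UN_I) (rule UN_I[OF c' singletonI])
  then show "x \<in> fibre b a <+>\<^bsub>TF b\<^esub> fibre b a'" unfolding TF_diff_add(1)[OF xc] .
qed

lemma coset_fibre: "c \<in> carrier (TF b) \<Longrightarrow> TU b +>\<^bsub>TF b\<^esub> c = fibre b (tau c)"
proof (intro equalityI subsetI)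
  interpret C: Module.module R "TF b" by (rule R.free_mod_on_module)
  assume c: "c \<in> carrier (TF b)"
  {
    fix x assume "x \<in> TU b +>\<^bsub>TF b\<^esub> c"
    then obtain u where u: "u \<in> fibre b 0" "x = u \<oplus>\<^bsub>TF b\<^esub> c" unfolding a_r_coset_def' TU_fibre by (elim UN_E singletonE)
    show "x \<in> fibre b (tau c)" unfolding u(2)
      by (rule fibre_memI[OF C.a_closed[OF fibre_memD(1)[OF u(1)] c]])
        (simp only: tau_add[OF fibre_memD(1)[OF u(1)] c] fibre_memD(2)[OF u(1)] add_0)
  }
  fix x assume x: "x \<in> fibre b (tau c)"
  note xc = fibre_memD(1)[OF x] c
  have "x \<ominus>\<^bsub>TF b\<^esub> c \<in> fibre b 0"
    by (rule fibre_memI[OF TF_diff_add(2)[OF xc]]) (simp only: tau_minus[OF xc] fibre_memD(2)[OF x] diff_self)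
  then show "x \<in> TU b +>\<^bsub>TF b\<^esub> c" unfolding a_r_coset_def' TU_fibre
    by (rule UN_I) (simp only: TF_diff_add(1)[OF xc] singleton_iff)
qed

abbreviation TM :: "nat \<Rightarrow> ('k mpoly set, ('k mpoly set set \<times> (nat \<Rightarrow> 'k mpoly set) \<Rightarrow> 'k mpoly set) set) module" where
  "TM b \<equiv> tensor_module R kmod (F b)"

lemma TM_carrier: "carrier (TM b) = fibre b ` kvec b"
proof (intro equalityI subsetI)
  have car: "carrier (TM b) = (\<Union>a\<in>carrier (TF b). {TU b +>\<^bsub>TF b\<^esub> a})"
    unfolding tensor_module_def quot_module_def A_RCOSETS_def' by simp
  {
    fix X assume "X \<in> carrier (TM b)"
    then obtain c where c: "c \<in> carrier (TF b)" "X = TU b +>\<^bsub>TF b\<^esub> c" unfolding car by (elim UN_E singletonE)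
    show "X \<in> fibre b ` kvec b" unfolding c(2) coset_fibre[OF c(1)] by (rule imageI[OF tau_kvec[OF c(1)]])
  }
  fix X assume "X \<in> fibre b ` kvec b"
  then obtain a where a: "X = fibre b a" "a \<in> kvec b" by (rule imageE)
  obtain c where c: "c \<in> fibre b a" using a(2) by (rule fibre_nonempty)
  show "X \<in> carrier (TM b)" unfolding car
    by (rule UN_I[OF fibre_memD(1)[OF c]]) (simp only: a(1) coset_fibre[OF fibre_memD(1)[OF c]] fibre_memD(2)[OF c] singleton_iff)
qed

lemma TM_zero: "\<zero>\<^bsub>TM b\<^esub> = fibre b 0"
  unfolding TU_fibre[symmetric] by (simp add: tensor_module_def quot_module_def)

lemma TM_add: "a' \<in> kvec b \<Longrightarrow> fibre b a \<oplus>\<^bsub>TM b\<^esub> fibre b a' = fibre b (a + a')"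
  using fibre_add[of a' b a] by (simp add: tensor_module_def quot_module_def del: kmod_simps free_mod_on_simps)

lemma UN_const: "x \<in> A \<Longrightarrow> (\<And>y. y \<in> A \<Longrightarrow> f y = B) \<Longrightarrow> (\<Union>y\<in>A. f y) = B" by auto

lemma TM_smult:
  assumes a: "a \<in> kvec b" and r: "r \<in> carrier R"
  shows "r \<odot>\<^bsub>TM b\<^esub> fibre b a = fibre b (\<lambda>j. ct r * a j)"
proof -
  interpret C: Module.module R "TF b" by (rule R.free_mod_on_module)
  obtain c where c: "c \<in> fibre b a" using a by (rule fibre_nonempty)
  have "r \<odot>\<^bsub>TM b\<^esub> fibre b a = (\<Union>c\<in>fibre b a. TU b +>\<^bsub>TF b\<^esub> (r \<odot>\<^bsub>TF b\<^esub> c))"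
    by (simp add: tensor_module_def quot_module_def)
  also have "\<dots> = fibre b (\<lambda>j. ct r * a j)"
  proof (rule UN_const[OF c])
    fix c assume c: "c \<in> fibre b a"
    note cc = fibre_memD(1)[OF c]
    show "TU b +>\<^bsub>TF b\<^esub> (r \<odot>\<^bsub>TF b\<^esub> c) = fibre b (\<lambda>j. ct r * a j)"
      unfolding coset_fibre[OF C.smult_closed[OF r cc]] tau_smult[OF r cc] fibre_memD(2)[OF c] ..
  qed
  finally show ?thesis .
qed

lemma tau_finsum:
  assumes "finite S" "\<And>s. s \<in> S \<Longrightarrow> f s \<in> carrier (TF b)"
  shows "tau (\<Oplus>\<^bsub>TF b\<^esub> s\<in>S. f s) = (\<Sum>s\<in>S. tau (f s)) \<and> (\<Oplus>\<^bsub>TF b\<^esub> s\<in>S. f s) \<in> carrier (TF b)"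
proof -
  interpret C: Module.module R "TF b" by (rule R.free_mod_on_module)
  show ?thesis using assms
  proof (induction S rule: finite_induct)
    case empty
    show ?case unfolding C.finsum_empty tau_zero sum.empty by (intro conjI refl C.zero_closed)
  next
    case (insert s S)
    have fS: "\<And>s. s \<in> S \<Longrightarrow> f s \<in> carrier (TF b)" by (rule insert.prems[OF insertI2])
    have f: "f \<in> S \<rightarrow> carrier (TF b)" "f s \<in> carrier (TF b)"
      by (rule Pi_I, erule fS) (rule insert.prems[OF insertI1])
    have "tau (\<Oplus>\<^bsub>TF b\<^esub> s\<in>S. f s) = (\<Sum>s\<in>S. tau (f s)) \<and> (\<Oplus>\<^bsub>TF b\<^esub> s\<in>S. f s) \<in> carrier (TF b)"
      by (rule insert.IH) (rule fS)
    note IH = this[THEN conjunct1] this[THEN conjunct2]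
    show ?case unfolding C.finsum_insert[OF insert.hyps f] tau_add[OF f(2) IH(2)] IH(1) sum.insert[OF insert.hyps]
      by (intro conjI refl C.a_closed f(2) IH(2))
  qed
qed

lemma tensor_map_fibre:
  assumes \<delta>: "\<And>y. y \<in> carrier (F m) \<Longrightarrow> \<delta> y \<in> carrier (F b)"
    and ct\<delta>: "\<And>y j. y \<in> carrier (F m) \<Longrightarrow> ct (\<delta> y j) = (\<Sum>l<m. B j l * ct (y l))"
    and a: "a \<in> kvec m"
  shows "tensor_map R kmod (F b) \<delta> (fibre m a) = fibre b (mv m B a)"
proof -
  interpret C: Module.module R "TF b" by (rule R.free_mod_on_module)
  obtain c where c: "c \<in> fibre m a" using a by (rule fibre_nonempty)
  have "tensor_map R kmod (F b) \<delta> (fibre m a) = (\<Union>c\<in>fibre m a. TU b +>\<^bsub>TF b\<^esub>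
      (\<Oplus>\<^bsub>TF b\<^esub> s\<in>{s. c s \<noteq> \<zero>\<^bsub>R\<^esub>}. c s \<odot>\<^bsub>TF b\<^esub> basis_elt R (fst s, \<delta> (snd s))))"
    unfolding tensor_map_def Let_def ..
  also have "\<dots> = fibre b (mv m B a)"
  proof (rule UN_const[OF c])
    fix c assume c: "c \<in> fibre m a"
    note cc = fibre_memD(1)[OF c]
    let ?S = "{s. c s \<noteq> \<zero>\<^bsub>R\<^esub>}"
    let ?f = "\<lambda>s. c s \<odot>\<^bsub>TF b\<^esub> basis_elt R (fst s, \<delta> (snd s))"
    have s: "fst s \<in> carrier K" "snd s \<in> carrier (F m)" if "s \<in> ?S" for s
      using TF_support[OF cc that[THEN CollectD]] by (rule conjunct1) (rule TF_support[OF cc that[THEN CollectD], THEN conjunct2])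
    have bc: "basis_elt R (fst s, \<delta> (snd s)) \<in> carrier (TF b)" if "s \<in> ?S" for s
      by (rule basis_elt_TF[OF s(1)[OF that] \<delta>[OF s(2)[OF that]]])
    have fc: "?f s \<in> carrier (TF b)" if "s \<in> ?S" for s
      by (rule C.smult_closed[OF TF_value[OF cc] bc[OF that]])
    have fs: "tau (\<Oplus>\<^bsub>TF b\<^esub> s\<in>?S. ?f s) = (\<Sum>s\<in>?S. tau (?f s)) \<and> (\<Oplus>\<^bsub>TF b\<^esub> s\<in>?S. ?f s) \<in> carrier (TF b)"
      by (rule tau_finsum[OF TF_finite[OF cc]]) (rule fc)
    have tf: "tau (?f s) = (\<lambda>j. \<Sum>l<m. B j l * (ct (c s) * kt (fst s) * ct (snd s l)))" if "s \<in> ?S" for s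
      unfolding tau_smult[OF TF_value[OF cc] bc[OF that]] tau_basis_elt ct\<delta>[OF s(2)[OF that]] sum_distrib_left
      by (intro ext sum.cong refl) (simp only: ac_simps)
    have "(\<Sum>s\<in>?S. tau (?f s)) = mv m B (tau c)"
    proof
      fix j
      have "(\<Sum>s\<in>?S. tau (?f s)) j = (\<Sum>s\<in>?S. \<Sum>l<m. B j l * (ct (c s) * kt (fst s) * ct (snd s l)))"
        unfolding sum_fun_apply using tf by (intro sum.cong refl) (simp only:)
      also have "\<dots> = (\<Sum>l<m. B j l * (\<Sum>s\<in>?S. ct (c s) * kt (fst s) * ct (snd s l)))"
        by (subst sum.swap) (simp only: sum_distrib_left)
      finally show "(\<Sum>s\<in>?S. tau (?f s)) j = mv m B (tau c) j" unfolding mv_def tau_def .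
    qed
    then show "TU b +>\<^bsub>TF b\<^esub> (\<Oplus>\<^bsub>TF b\<^esub> s\<in>?S. ?f s) = fibre b (mv m B a)"
      unfolding coset_fibre[OF fs[THEN conjunct2]] fs[THEN conjunct1] fibre_memD(2)[OF c] by (simp only:)
  qed
  finally show ?thesis .
qed


text \<open>A homology class is the set of cosets \<open>fibre (w + a)\<close> for \<open>w\<close> in the image, so the homology module
  is presented by the kernel and the image of constant matrices.\<close>

lemma tensor_homology_dim:
  assumes D: "\<And>i a. a \<in> kvec (b (Suc i)) \<Longrightarrow> D i (fibre (b (Suc i)) a) = fibre (b i) (mv (b (Suc i)) (cmat (A i)) a)"
    and A: "\<And>i. A i \<in> pmat d (b i)"
    and complex: "im_k (b (Suc (Suc i))) (A (Suc i)) \<subseteq> ker_k (b (Suc i)) (A i)"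
  shows "vectorspace.dim K (residue_space (homology_module (\<lambda>j. TM (b j)) D (Suc i)))
      + fv.dim (im_k (b (Suc (Suc i))) (A (Suc i))) = fv.dim (ker_k (b (Suc i)) (A i))"
proof -
  let ?m = "b (Suc i)"
  let ?Z = "ker_k ?m (A i)" and ?B = "im_k (b (Suc (Suc i))) (A (Suc i))"
  let ?C = "\<lambda>j. TM (b j)"
  define \<Psi> where "\<Psi> a = (\<lambda>w. fibre ?m (w + a)) ` ?B" for a
  note addk = fv.subspace_add[OF subspace_kvec[of ?m]]
  note addB = fv.subspace_add[OF subspace_im_k[of "b (Suc (Suc i))" "A (Suc i)"]]
  note scB = fv.subspace_scale[OF subspace_im_k[of "b (Suc (Suc i))" "A (Suc i)"]]
  have Zk: "a \<in> kvec ?m" if "a \<in> ?Z" for a using that unfolding ker_k_def by blast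
  have Bk: "w \<in> kvec ?m" if "w \<in> ?B" for w using that complex Zk by blast
  have cyc: "cycles ?C D (Suc i) = fibre ?m ` ?Z"
  proof (intro equalityI subsetI)
    fix x assume "x \<in> cycles ?C D (Suc i)"
    then have "x \<in> fibre ?m ` kvec ?m \<and> D i x = fibre (b i) 0"
      unfolding cycles_def nat.case TM_carrier TM_zero by (rule CollectD)
    note x = this[THEN conjunct1] this[THEN conjunct2]
    obtain a where a: "x = fibre ?m a" "a \<in> kvec ?m" using x(1) by (rule imageE)
    have "fibre (b i) (mv ?m (cmat (A i)) a) = fibre (b i) 0" using x(2) unfolding a(1) D[OF a(2)] .
    then have "mv ?m (cmat (A i)) a = 0" by (rule fibre_inj[OF kvec_mv[OF A]])
    then have "a \<in> ?Z" unfolding ker_k_def using a(2) by blast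
    then show "x \<in> fibre ?m ` ?Z" unfolding a(1) by (rule imageI)
  next
    fix x assume "x \<in> fibre ?m ` ?Z"
    then obtain a where a: "x = fibre ?m a" "a \<in> ?Z" by (rule imageE)
    have "mv ?m (cmat (A i)) a = 0" using a(2) unfolding ker_k_def by blast
    then show "x \<in> cycles ?C D (Suc i)" unfolding cycles_def nat.case TM_carrier TM_zero
      by (intro CollectI conjI) (simp_all only: a(1) imageI[OF Zk[OF a(2)]] D[OF Zk[OF a(2)]])
  qed
  have bd: "boundaries ?C D (Suc i) = fibre ?m ` ?B"
    unfolding boundaries_def TM_carrier im_k_def image_image using D by (intro image_cong refl)
  let ?G = "(TM ?m)\<lparr>carrier := fibre ?m ` ?Z\<rparr>"
  have V: "homology_module ?C D (Suc i) = quot_module ?G (fibre ?m ` ?B)" (is "?V = _")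
    unfolding homology_module_def cyc bd ..
  have add_G: "x \<oplus>\<^bsub>?G\<^esub> y = x \<oplus>\<^bsub>TM ?m\<^esub> y" "r \<odot>\<^bsub>?G\<^esub> x = r \<odot>\<^bsub>TM ?m\<^esub> x" for x y r by simp_all
  have coset: "(fibre ?m ` ?B) +>\<^bsub>?G\<^esub> fibre ?m a = \<Psi> a" if "a \<in> kvec ?m" for a
    unfolding a_r_coset_def' add_G(1) \<Psi>_def UNION_singleton_eq_range image_image using TM_add[OF that]
    by (intro image_cong refl)
  have \<Psi>_eq: "\<Psi> a = \<Psi> a' \<longleftrightarrow> a - a' \<in> ?B" if a: "a \<in> kvec ?m" and a': "a' \<in> kvec ?m" for a a'
  proof
    assume e: "\<Psi> a = \<Psi> a'"
    have "fibre ?m (0 + a) \<in> \<Psi> a" unfolding \<Psi>_def by (rule imageI[OF fv.subspace_0[OF subspace_im_k]])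
    then have "fibre ?m (0 + a) \<in> \<Psi> a'" unfolding e .
    then obtain w where w: "fibre ?m (0 + a) = fibre ?m (w + a')" "w \<in> ?B" unfolding \<Psi>_def by (rule imageE)
    have "0 + a = w + a'" using w(1) by (rule fibre_inj[rotated]) (simp only: add_0 a)
    then have "a - a' = w" by (simp add: algebra_simps)
    with w(2) show "a - a' \<in> ?B" by simp
  next
    assume s: "a - a' \<in> ?B"
    show "\<Psi> a = \<Psi> a'" unfolding \<Psi>_def
    proof (intro equalityI image_subsetI)
      fix w assume w: "w \<in> ?B"
      have "fibre ?m ((w + (a - a')) + a') \<in> (\<lambda>w. fibre ?m (w + a')) ` ?B" by (rule imageI[OF addB[OF w s]])
      then show "fibre ?m (w + a) \<in> (\<lambda>w. fibre ?m (w + a')) ` ?B" by (simp add: algebra_simps)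
      have "fibre ?m ((w - (a - a')) + a) \<in> (\<lambda>w. fibre ?m (w + a)) ` ?B"
        by (rule imageI[OF fv.subspace_diff[OF subspace_im_k w s]])
      then show "fibre ?m (w + a') \<in> (\<lambda>w. fibre ?m (w + a)) ` ?B" by (simp add: algebra_simps)
    qed
  qed
  let ?W = "residue_space ?V"
  show ?thesis
  proof (rule dim_of_presented_space[where \<Psi> = \<Psi> and m = ?m])
    show "fv.subspace ?B" by (rule subspace_im_k)
    show "fv.subspace ?Z" by (rule subspace_ker_k)
    show "?B \<subseteq> ?Z" by (rule complex)
    show "?Z \<subseteq> kvec ?m" by (rule subsetI) (rule Zk)
    have "carrier ?W = (\<Union>x\<in>fibre ?m ` ?Z. {(fibre ?m ` ?B) +>\<^bsub>?G\<^esub> x})"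
      unfolding V residue_space_def quot_module_def A_RCOSETS_def' by simp
    also have "\<dots> = \<Psi> ` ?Z"
      unfolding UNION_singleton_eq_range image_image using coset[OF Zk] by (intro image_cong refl)
    finally show "carrier ?W = \<Psi> ` ?Z" .
    have "\<zero>\<^bsub>?W\<^esub> = fibre ?m ` ?B" unfolding V residue_space_def quot_module_def by simp
    then show "\<zero>\<^bsub>?W\<^esub> = \<Psi> 0" unfolding \<Psi>_def add_0_right .
  next
    fix a a' assume a: "a \<in> ?Z" "a' \<in> ?Z"
    note ak = Zk[OF a(1)] Zk[OF a(2)]
    show "\<Psi> a = \<Psi> a' \<longleftrightarrow> a - a' \<in> ?B" by (rule \<Psi>_eq[OF ak])
    have "\<Psi> a \<oplus>\<^bsub>?W\<^esub> \<Psi> a' = \<Psi> a <+>\<^bsub>?G\<^esub> \<Psi> a'" unfolding V residue_space_def quot_module_def by simp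
    also have "\<dots> = (\<Union>w\<in>?B. \<Union>w'\<in>?B. {fibre ?m (w + a) \<oplus>\<^bsub>TM ?m\<^esub> fibre ?m (w' + a')})"
      unfolding set_add_def' add_G(1) \<Psi>_def by (simp only: image_UN UN_simps)
    also have "\<dots> = (\<Union>w\<in>?B. \<Union>w'\<in>?B. {fibre ?m ((w + w') + (a + a'))})"
      by (intro SUP_cong refl) (simp only: TM_add[OF addk[OF Bk ak(2)]] ac_simps)
    also have "\<dots> = \<Psi> (a + a')"
    proof (intro equalityI subsetI)
      fix x assume "x \<in> (\<Union>w\<in>?B. \<Union>w'\<in>?B. {fibre ?m ((w + w') + (a + a'))})"
      then obtain w w' where w: "w \<in> ?B" "w' \<in> ?B" "x = fibre ?m ((w + w') + (a + a'))" by (elim UN_E singletonE)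
      show "x \<in> \<Psi> (a + a')" unfolding \<Psi>_def w(3) by (rule imageI[OF addB[OF w(1,2)]])
    next
      fix x assume "x \<in> \<Psi> (a + a')"
      then obtain w where w: "x = fibre ?m (w + (a + a'))" "w \<in> ?B" unfolding \<Psi>_def by (rule imageE)
      show "x \<in> (\<Union>w\<in>?B. \<Union>w'\<in>?B. {fibre ?m ((w + w') + (a + a'))})"
        by (rule UN_I[OF w(2)], rule UN_I[OF fv.subspace_0[OF subspace_im_k]]) (simp only: w(1) add_0_right singleton_iff)
    qed
    finally show "\<Psi> a \<oplus>\<^bsub>?W\<^esub> \<Psi> a' = \<Psi> (a + a')" .
  next
    fix X a assume X: "X \<in> carrier K" and a: "a \<in> ?Z"
    obtain Y where Y: "Y \<in> carrier R" "X = rs Y" using X unfolding carrier_K by (rule imageE)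
    define r where "r = (SOME r. r \<in> X)"
    have r: "r \<in> carrier R" "ct r = kt X" unfolding r_def Y(2) kt_rs[OF Y(1)] using some_rs[OF Y(1)] by simp_all
    note ak = Zk[OF a]
    have "X \<odot>\<^bsub>?W\<^esub> \<Psi> a = (\<Union>x\<in>\<Psi> a. (fibre ?m ` ?B) +>\<^bsub>?G\<^esub> (r \<odot>\<^bsub>TM ?m\<^esub> x))"
      unfolding V residue_space_def quot_module_def r_def by simp
    also have "\<dots> = \<Psi> (\<lambda>j. ct r * a j)"
    proof (rule UN_const)
      show "fibre ?m (0 + a) \<in> \<Psi> a" unfolding \<Psi>_def by (rule imageI[OF fv.subspace_0[OF subspace_im_k]])
      fix x assume "x \<in> \<Psi> a"
      then obtain w where w: "x = fibre ?m (w + a)" "w \<in> ?B" unfolding \<Psi>_def by (rule imageE)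
      note wk = addk[OF Bk[OF w(2)] ak]
      have e: "(\<lambda>j. ct r * (w + a) j) - (\<lambda>j. ct r * a j) = (\<lambda>j. ct r * w j)" by (auto simp: fun_eq_iff algebra_simps)
      note sk = fv.subspace_scale[OF subspace_kvec]
      have "\<Psi> (\<lambda>j. ct r * (w + a) j) = \<Psi> (\<lambda>j. ct r * a j)"
        unfolding \<Psi>_eq[OF sk[OF wk] sk[OF ak]] e by (rule scB[OF w(2)])
      then show "(fibre ?m ` ?B) +>\<^bsub>?G\<^esub> (r \<odot>\<^bsub>TM ?m\<^esub> x) = \<Psi> (\<lambda>j. ct r * a j)"
        unfolding w(1) TM_smult[OF wk r(1)] coset[OF sk[OF wk]] .
    qed
    finally show "X \<odot>\<^bsub>?W\<^esub> \<Psi> a = \<Psi> (\<lambda>j. kt X * a j)" unfolding r(2) .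
  qed
qed

lemma ct_prv: "v \<in> pvec d b \<Longrightarrow> ct (prv v j) = cf 0 v j"
  unfolding prv_def cf_def by (rule ct_pr[OF pvecD])

lemma tensor_map_matrix:
  assumes A: "A \<in> pmat d b" and \<delta>: "\<And>v. v \<in> pvec d m \<Longrightarrow> \<delta> (prv v) = prv (mv m A v)"
    and a: "a \<in> kvec m"
  shows "tensor_map R kmod (F b) \<delta> (fibre m a) = fibre b (mv m (cmat A) a)"
proof (rule tensor_map_fibre[OF _ _ a])
  fix y assume "y \<in> carrier (F m)"
  then obtain v where v: "v \<in> pvec d m" "y = prv v" by (rule F_carrierE)
  have mvv: "mv m A v \<in> pvec d b" by (rule pvec_mv[OF A v(1)])
  show "\<delta> y \<in> carrier (F b)" unfolding v(2) \<delta>[OF v(1)] by (rule prv_carrier[OF mvv])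
  fix j
  have "ct (\<delta> y j) = cf 0 (mv m A v) j" unfolding v(2) \<delta>[OF v(1)] by (rule ct_prv[OF mvv])
  also have "\<dots> = (\<Sum>l<m. cmat A j l * cf 0 v l)" unfolding cf0_mv by (simp only: mv_def)
  also have "\<dots> = (\<Sum>l<m. cmat A j l * ct (y l))"
    unfolding v(2) ct_prv[OF v(1)] ..
  finally show "ct (\<delta> y j) = (\<Sum>l<m. cmat A j l * ct (y l))" .
qed

lemma betti_from_matrices:
  fixes M :: "('k mpoly set, 'b) module"
  assumes "fin_gen_module R M"
  obtains b A \<epsilon> where "\<And>i. A i \<in> pmat d (b i)"
    "\<And>i. exact_mod t d (b (Suc i)) (A i) (b (Suc (Suc i))) (A (Suc i))"
    "\<And>i. betti R M (Suc i) = fv.dim (ker_k (b (Suc i)) (A i)) - fv.dim (im_k (b (Suc (Suc i))) (A (Suc i)))"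
    "\<epsilon> \<in> LinearCombinations.module_hom R (F (b 0)) M" "\<epsilon> ` carrier (F (b 0)) = carrier M"
    "\<And>v. v \<in> pvec d (b 0) \<Longrightarrow> \<epsilon> (prv v) = \<zero>\<^bsub>M\<^esub> \<longleftrightarrow> (\<exists>u\<in>pvec d (b (Suc 0)). v - mv (b (Suc 0)) (A 0) u \<in> ordv t)"
proof -
  obtain b \<delta> \<epsilon> where s: "(SOME G. free_resolution R M G) = (b, \<delta>, \<epsilon>)"
    by (cases "SOME G. free_resolution R M G") (rule that)
  have res: "free_resolution R M (b, \<delta>, \<epsilon>)"
    unfolding s[symmetric] using exists_free_resolution[OF assms] by (rule someI_ex)
  obtain A where A: "\<And>i. A i \<in> pmat d (b i)"
    "\<And>i v. v \<in> pvec d (b (Suc i)) \<Longrightarrow> \<delta> i (prv v) = prv (mv (b (Suc i)) (A i) v)"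
    "\<And>i. exact_mod t d (b (Suc i)) (A i) (b (Suc (Suc i))) (A (Suc i))"
    "\<And>v. v \<in> pvec d (b 0) \<Longrightarrow> \<epsilon> (prv v) = \<zero>\<^bsub>M\<^esub> \<longleftrightarrow> (\<exists>u\<in>pvec d (b (Suc 0)). v - mv (b (Suc 0)) (A 0) u \<in> ordv t)"
    by (rule free_resolution_matrices[OF res]) (rule that)
  have "betti R M (Suc i) + fv.dim (im_k (b (Suc (Suc i))) (A (Suc i))) = fv.dim (ker_k (b (Suc i)) (A i))" for i
    unfolding betti_def Tor_module_def s case_prod_conv Let_def
  proof (rule tensor_homology_dim)
    show "tensor_map R kmod (F (b j)) (\<delta> j) (fibre (b (Suc j)) a) = fibre (b j) (mv (b (Suc j)) (cmat (A j)) a)"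
      if "a \<in> kvec (b (Suc j))" for j a
      by (rule tensor_map_matrix[OF A(1) A(2) that])
    show "im_k (b (Suc (Suc i))) (A (Suc i)) \<subseteq> ker_k (b (Suc i)) (A i)"
      by (rule im_k_subset_ker_k[OF A(3) A(1) t_pos])
  qed (rule A(1))
  note sum_eq = this
  have diff: "x = z - y" if "x + y = z" for x y z :: nat using that by simp
  have "betti R M (Suc i) = fv.dim (ker_k (b (Suc i)) (A i)) - fv.dim (im_k (b (Suc (Suc i))) (A (Suc i)))" for i
    by (rule diff) (rule sum_eq)
  note betti_eq = this
  note r = res[unfolded free_resolution_def case_prod_conv Let_def]
  show ?thesis
    by (rule that[OF A(1) A(3) betti_eq r[THEN conjunct2, THEN conjunct1] r[THEN conjunct2, THEN conjunct2, THEN conjunct1] A(4)])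
qed


section \<open>Freeness when the first Betti number vanishes\<close>

text \<open>The images of the unit vectors in \<open>J\<close> form a basis: \<open>cover\<close> shows that they generate, \<open>inter\<close> that
  they are independent. Independence is tested on an injective selection of indices, which avoids a separate
  proof that these images are distinct.\<close>

lemma free_module_of_split_cover:
  fixes M :: "('k mpoly set, 'b) module"
  assumes M: "Module.module R M" and \<epsilon>: "\<epsilon> \<in> LinearCombinations.module_hom R (F b) M" "\<epsilon> ` carrier (F b) = carrier M"
    and J: "J \<subseteq> {..<b}"
    and kernel: "\<And>v. v \<in> pvec d b \<Longrightarrow> \<epsilon> (prv v) = \<zero>\<^bsub>M\<^esub> \<longleftrightarrow> prv v \<in> N"
    and cover: "\<And>v. v \<in> pvec d b \<Longrightarrow> \<exists>w. w \<in> pvec d b \<and> (\<forall>j. j \<notin> J \<longrightarrow> w j = 0) \<and> prv (v - w) \<in> N"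
    and inter: "\<And>w. \<lbrakk>w \<in> pvec d b; \<forall>j. j \<notin> J \<longrightarrow> w j = 0; prv w \<in> N\<rbrakk> \<Longrightarrow> w \<in> ordv t"
  shows "free_module R M"
proof -
  interpret M: Module.module R M by (rule M)
  interpret Fb: Module.module R "F b" by (rule module_F)
  note \<epsilon>_add = LinearCombinations.module_hom_add[OF \<epsilon>(1)]
  note \<epsilon>_smult = LinearCombinations.module_hom_smult[OF \<epsilon>(1)]
  have \<epsilon>_carrier: "\<epsilon> x \<in> carrier M" if "x \<in> carrier (F b)" for x
    unfolding \<epsilon>(2)[symmetric] using that by (rule imageI)
  have \<epsilon>_zero: "\<epsilon> (prv 0) = \<zero>\<^bsub>M\<^esub>"
    unfolding prv_zero[of b] by (rule Fb.hom_zero[OF \<epsilon>(1) M])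
  define u where "u j = \<epsilon> (prv (unitv j))" for j
  have u: "u j \<in> carrier M" if "j \<in> J" for j
    unfolding u_def using subsetD[OF J that] by (intro \<epsilon>_carrier prv_carrier unitv_pvec) (simp only: lessThan_iff)
  define res :: "nat set \<Rightarrow> (nat \<Rightarrow> 'k mpoly) \<Rightarrow> nat \<Rightarrow> 'k mpoly" where "res S v = (\<lambda>j. if j \<in> S then v j else 0)" for S v
  have res_pvec: "res S v \<in> pvec d b" if "S \<subseteq> J" "\<And>j. v j \<in> polys d" for S v
    using that J unfolding res_def pvec_def by auto
  have res_empty: "res {} v = 0" for v by (auto simp: res_def fun_eq_iff)
  have step: "\<epsilon> (prv (res (insert l S) v)) = pr (v l) \<odot>\<^bsub>M\<^esub> u l \<oplus>\<^bsub>M\<^esub> \<epsilon> (prv (res S v))"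
    if S: "S \<subseteq> J" "l \<in> J" "l \<notin> S" and v: "\<And>j. v j \<in> polys d" for S l v
  proof -
    have ul: "unitv l \<in> pvec d b" using subsetD[OF J S(2)] by (intro unitv_pvec) (simp only: lessThan_iff)
    note sp = pvec_pscale[OF v ul]
    have e: "res (insert l S) v = pscale (v l) (unitv l) + res S v"
      using S(3) by (auto simp: res_def unitv_def fun_eq_iff)
    have "\<epsilon> (prv (res (insert l S) v)) = \<epsilon> (prv (pscale (v l) (unitv l))) \<oplus>\<^bsub>M\<^esub> \<epsilon> (prv (res S v))"
      unfolding e prv_add[OF sp res_pvec[OF S(1) v]]
      by (rule \<epsilon>_add[OF prv_carrier[OF sp] prv_carrier[OF res_pvec[OF S(1) v]]])
    also have "\<epsilon> (prv (pscale (v l) (unitv l))) = pr (v l) \<odot>\<^bsub>M\<^esub> u l"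
      unfolding prv_scale[OF v ul] u_def by (rule \<epsilon>_smult[OF pr_carrier[OF v] prv_carrier[OF ul]])
    finally show ?thesis .
  qed
  have comb: "\<epsilon> (prv (res S v)) = (\<Oplus>\<^bsub>M\<^esub> j\<in>S. pr (v j) \<odot>\<^bsub>M\<^esub> u j)" if "finite S" "S \<subseteq> J" and v: "\<And>j. v j \<in> polys d" for S v
    using that(1,2)
  proof (induction S rule: finite_induct)
    case empty
    show ?case unfolding res_empty \<epsilon>_zero by (rule M.finsum_empty[symmetric])
  next
    case (insert l S)
    have S: "S \<subseteq> J" "l \<in> J" using insert.prems by (blast, blast)
    have f: "(\<lambda>j. pr (v j) \<odot>\<^bsub>M\<^esub> u j) \<in> S \<rightarrow> carrier M"
      by (rule Pi_I, rule M.smult_closed[OF pr_carrier[OF v] u]) (rule subsetD[OF S(1)])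
    show ?case
      unfolding step[OF S insert.hyps(2) v] insert.IH[OF S(1)]
      by (rule M.finsum_insert[OF insert.hyps f M.smult_closed[OF pr_carrier[OF v] u[OF S(2)]], symmetric])
  qed
  have uJ: "u ` J \<subseteq> carrier M" by (rule image_subsetI) (rule u)
  have "\<not> M.lin_dep (u ` J)"
  proof
    assume "M.lin_dep (u ` J)"
    then obtain A a x where A: "finite A" "A \<subseteq> u ` J" "a \<in> A \<rightarrow> carrier R" "M.lincomb a A = \<zero>\<^bsub>M\<^esub>" "x \<in> A" "a x \<noteq> \<zero>\<^bsub>R\<^esub>"
      unfolding M.lin_dep_def by (elim exE conjE)
    obtain S where S: "S \<subseteq> J" "inj_on u S" "A = u ` S" using A(2) unfolding subset_image_inj by (elim exE conjE)
    have fin: "finite S" using A(1) S(2) unfolding S(3) by (rule finite_imageD)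
    define v where "v j = (if j \<in> S then lift (a (u j)) else 0)" for j
    have aS: "a (u j) \<in> carrier R" if "j \<in> S" for j using A(3) that unfolding S(3) by auto
    have vp: "v j \<in> polys d" for j using lift[OF aS] by (auto simp: v_def)
    have pv: "pr (v j) = a (u j)" if "j \<in> S" for j using lift[OF aS[OF that]] that by (simp add: v_def)
    have "\<epsilon> (prv (res S v)) = (\<Oplus>\<^bsub>M\<^esub> j\<in>S. pr (v j) \<odot>\<^bsub>M\<^esub> u j)" by (rule comb[OF fin S(1) vp])
    also have "\<dots> = (\<Oplus>\<^bsub>M\<^esub> j\<in>S. a (u j) \<odot>\<^bsub>M\<^esub> u j)"
    proof (rule M.finsum_cong'[OF refl])
      show "(\<lambda>j. a (u j) \<odot>\<^bsub>M\<^esub> u j) \<in> S \<rightarrow> carrier M"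
        by (rule Pi_I, rule M.smult_closed[OF aS u[OF subsetD[OF S(1)]]])
      show "pr (v j) \<odot>\<^bsub>M\<^esub> u j = a (u j) \<odot>\<^bsub>M\<^esub> u j" if "j \<in> S" for j unfolding pv[OF that] ..
    qed
    also have "\<dots> = M.lincomb a A" unfolding M.lincomb_def S(3)
    proof (rule M.finsum_reindex[OF _ S(2), symmetric])
      show "(\<lambda>x. a x \<odot>\<^bsub>M\<^esub> x) \<in> u ` S \<rightarrow> carrier M"
        by (rule Pi_I, erule imageE, simp only:) (rule M.smult_closed[OF aS u[OF subsetD[OF S(1)]]])
    qed
    finally have "prv (res S v) \<in> N" unfolding A(4) kernel[OF res_pvec[OF S(1) vp]] .
    then have "res S v \<in> ordv t"
      using S(1) by (intro inter res_pvec vp) (auto simp: res_def)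
    moreover obtain l where l: "l \<in> S" "x = u l" using A(5) unfolding S(3) by blast
    ultimately have "v l \<in> ord_ge t" unfolding ordv_def res_def by (auto dest: spec[of _ l])
    then have "pr (v l) = \<zero>\<^bsub>R\<^esub>" unfolding pr_eq_zero_iff[OF vp] .
    then show False using A(6) unfolding l(2) pv[OF l(1)] by (rule notE[rotated])
  qed
  moreover have "M.span (u ` J) = carrier M"
  proof (intro equalityI subsetI)
    fix x assume "x \<in> M.span (u ` J)"
    then show "x \<in> carrier M" using M.span_is_subset2[OF uJ] by (rule subsetD[rotated])
  next
    fix x assume "x \<in> carrier M"
    then have "x \<in> \<epsilon> ` carrier (F b)" unfolding \<epsilon>(2) .
    then obtain y where y: "x = \<epsilon> y" "y \<in> carrier (F b)" by (rule imageE)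
    obtain v where v: "v \<in> pvec d b" "y = prv v" using y(2) by (rule F_carrierE)
    obtain w where w: "w \<in> pvec d b" "\<forall>j. j \<notin> J \<longrightarrow> w j = 0" "prv (v - w) \<in> N"
      using cover[OF v(1)] by (elim exE conjE)
    have vw: "v - w \<in> pvec d b" using v(1) w(1) by (rule pvec_diff)
    have "\<epsilon> (prv (v - w)) = \<zero>\<^bsub>M\<^esub>" using w(3) unfolding kernel[OF vw] .
    moreover have "\<epsilon> (prv (v - w + w)) = \<epsilon> (prv (v - w)) \<oplus>\<^bsub>M\<^esub> \<epsilon> (prv w)"
      unfolding prv_add[OF vw w(1)] by (rule \<epsilon>_add[OF prv_carrier[OF vw] prv_carrier[OF w(1)]])
    ultimately have "x = \<epsilon> (prv w)"
      using M.l_zero[OF \<epsilon>_carrier[OF prv_carrier[OF w(1)]]] unfolding y(1) v(2) diff_add_cancel by (simp only:)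
    also have "w = res J w" using w(2) by (auto simp: res_def fun_eq_iff)
    finally have x: "x = \<epsilon> (prv (res J w))" .
    have wp: "w j \<in> polys d" for j using w(1) by (rule pvecD)
    note sub = M.span_is_submodule[OF uJ]
    have "\<epsilon> (prv (res S w)) \<in> M.span (u ` J)" if "finite S" "S \<subseteq> J" for S
      using that
    proof (induction S rule: finite_induct)
      case empty
      show ?case unfolding res_empty \<epsilon>_zero by (rule LinearCombinations.submodule.zero_closed[OF sub])
    next
      case (insert l S)
      have S: "S \<subseteq> J" "l \<in> J" using insert.prems by (blast, blast)
      have "u l \<in> M.span (u ` J)" by (rule subsetD[OF M.in_own_span[OF uJ] imageI[OF S(2)]])
      then show ?case unfolding step[OF S insert.hyps(2) wp]
        by (intro LinearCombinations.submodule.m_closed[OF sub] LinearCombinations.submodule.smult_closed[OF sub]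
            pr_carrier wp insert.IH S(1))
    qed
    then show "x \<in> M.span (u ` J)" unfolding x using finite_subset[OF J finite_lessThan] subset_refl .
  qed
  ultimately show ?thesis unfolding free_module_def using M uJ by (intro conjI exI[of _ "u ` J"])
qed

lemma free_of_betti_1_zero:
  fixes M :: "('k mpoly set, 'b) module" and A :: "nat \<Rightarrow> nat \<Rightarrow> nat \<Rightarrow> 'k mpoly"
  assumes M: "Module.module R M" and \<epsilon>: "\<epsilon> \<in> LinearCombinations.module_hom R (F b) M" "\<epsilon> ` carrier (F b) = carrier M"
    and A: "A 0 \<in> pmat d b" "A 1 \<in> pmat d m" and ex: "exact_mod t d m (A 0) n (A 1)"
    and kernel: "\<And>v. v \<in> pvec d b \<Longrightarrow> \<epsilon> (prv v) = \<zero>\<^bsub>M\<^esub> \<longleftrightarrow> (\<exists>u\<in>pvec d m. v - mv m (A 0) u \<in> ordv t)"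
    and dims: "fv.dim (ker_k m (A 0)) \<le> fv.dim (im_k n (A 1))"
  shows "free_module R M"
proof -
  note sub = im_k_subset_ker_k[OF ex A(2) t_pos]
  obtain W B where W: "finite W" "W \<subseteq> ker_k m (A 0)" "card W + fv.dim (im_k n (A 1)) = fv.dim (ker_k m (A 0))" "finite B"
      "B \<subseteq> im_k n (A 1)" "fv.span B = im_k n (A 1)" "B \<inter> W = {}" "fv.independent (B \<union> W)" "fv.span (B \<union> W) = ker_k m (A 0)"
    by (rule fv.dim_eq_dim_plus_complement[OF subspace_im_k subspace_ker_k sub ker_k_span finite_imageI[OF finite_lessThan]])
      (rule that)
  have "card W = 0" using W(3) dims by linarith
  then have "W = {}" using W(1) by simp
  then have "ker_k m (A 0) \<subseteq> im_k n (A 1)" unfolding W(6)[symmetric] W(9)[symmetric] by simp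
  then have ki: "ker_k m (A 0) \<subseteq> im_k n (A 1)" .
  obtain J where J: "J \<subseteq> {..<b}"
    "\<And>v. v \<in> pvec d b \<Longrightarrow> \<exists>y w. y \<in> pvec d m \<and> w \<in> pvec d b \<and> (\<forall>j. j \<notin> J \<longrightarrow> w j = 0) \<and> v - mv m (A 0) y - w \<in> ordv t"
    "\<And>w y. \<lbrakk>w \<in> pvec d b; \<forall>j. j \<notin> J \<longrightarrow> w j = 0; y \<in> pvec d m; w - mv m (A 0) y \<in> ordv t\<rbrakk> \<Longrightarrow> w \<in> ordv t"
    by (rule split_of_ker_subset_im[OF A ex t_pos ki]) (rule that)
  show ?thesis
  proof (rule free_module_of_split_cover[OF M \<epsilon> J(1), where N = "(\<lambda>y. prv (mv m (A 0) y)) ` pvec d m"])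
    have img: "prv v \<in> (\<lambda>y. prv (mv m (A 0) y)) ` pvec d m \<longleftrightarrow> (\<exists>u\<in>pvec d m. v - mv m (A 0) u \<in> ordv t)" if "v \<in> pvec d b" for v
      unfolding image_iff using prv_eq_iff[OF that pvec_mv[OF A(1)]] by (intro bex_cong refl) 
    show "\<epsilon> (prv v) = \<zero>\<^bsub>M\<^esub> \<longleftrightarrow> prv v \<in> (\<lambda>y. prv (mv m (A 0) y)) ` pvec d m" if "v \<in> pvec d b" for v
      unfolding img[OF that] by (rule kernel[OF that])
    show "\<exists>w. w \<in> pvec d b \<and> (\<forall>j. j \<notin> J \<longrightarrow> w j = 0) \<and> prv (v - w) \<in> (\<lambda>y. prv (mv m (A 0) y)) ` pvec d m" if v: "v \<in> pvec d b" for v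
    proof -
      obtain y w where yw: "y \<in> pvec d m" "w \<in> pvec d b" "\<forall>j. j \<notin> J \<longrightarrow> w j = 0" "v - mv m (A 0) y - w \<in> ordv t"
        using J(2)[OF v] by (elim exE conjE)
      have "prv (v - w) \<in> (\<lambda>y. prv (mv m (A 0) y)) ` pvec d m"
        unfolding img[OF pvec_diff[OF v yw(2)]] using yw(1)
      proof (rule rev_bexI)
        show "v - w - mv m (A 0) y \<in> ordv t" using yw(4) unfolding diff_diff_eq add.commute[of w] .
      qed
      then show ?thesis by (intro exI[of _ w] conjI yw)
    qed
    show "w \<in> ordv t" if w: "w \<in> pvec d b" "\<forall>j. j \<notin> J \<longrightarrow> w j = 0" "prv w \<in> (\<lambda>y. prv (mv m (A 0) y)) ` pvec d m" for w
    proof -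
      obtain y where "y \<in> pvec d m" "w - mv m (A 0) y \<in> ordv t" using w(3) unfolding img[OF w(1)] by (elim bexE)
      then show ?thesis by (rule J(3)[OF w(1,2)])
    qed
  qed
qed

end

theorem mainTheorem2:
  fixes d n :: nat
    and M :: "(((nat \<Rightarrow>\<^sub>0 nat) \<Rightarrow>\<^sub>0 'k::field) set, 'b) module"
  assumes "d > 1" and "n > 1"
    and "fin_gen_module (trunc_poly_ring d n) M"
    and "\<not> free_module (trunc_poly_ring d n) M"
  shows "\<forall>i\<ge>2. int (betti (trunc_poly_ring d n) M (i + 1)) - int (betti (trunc_poly_ring d n) M i)
           \<ge> int d - 1"
proof -
  define R where "R = (trunc_poly_ring d n :: 'k mpoly set ring)"
  interpret trunc_ring d n R by unfold_locales (use assms(2) in \<open>simp_all add: R_def\<close>)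
  have fg: "fin_gen_module R M" using assms(3) unfolding R_def .
  obtain b A \<epsilon> where r: "\<And>i. A i \<in> pmat d (b i)"
    "\<And>i. exact_mod n d (b (Suc i)) (A i) (b (Suc (Suc i))) (A (Suc i))"
    "\<And>i. betti R M (Suc i) = fv.dim (ker_k (b (Suc i)) (A i)) - fv.dim (im_k (b (Suc (Suc i))) (A (Suc i)))"
    "\<epsilon> \<in> LinearCombinations.module_hom R (F (b 0)) M" "\<epsilon> ` carrier (F (b 0)) = carrier M"
    "\<And>v. v \<in> pvec d (b 0) \<Longrightarrow> \<epsilon> (prv v) = \<zero>\<^bsub>M\<^esub> \<longleftrightarrow> (\<exists>u\<in>pvec d (b (Suc 0)). v - mv (b (Suc 0)) (A 0) u \<in> ordv n)"
    by (rule betti_from_matrices[OF fg]) (rule that)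
  define \<beta> where "\<beta> i = fv.dim (ker_k (b i) (A (i - 1))) - fv.dim (im_k (b (Suc i)) (A i))" for i
  have betti: "betti R M (Suc i) = \<beta> (Suc i)" for i unfolding \<beta>_def diff_Suc_1 by (rule r(3))
  have "\<beta> 1 \<noteq> 0"
  proof
    assume "\<beta> 1 = 0"
    then have "fv.dim (ker_k (b (Suc 0)) (A 0)) \<le> fv.dim (im_k (b (Suc (Suc 0))) (A 1))" unfolding \<beta>_def by simp
    then have "free_module R M"
      using fg[unfolded fin_gen_module_def, THEN conjunct1] r(1)[of 0] r(1)[of 1] r(2)[of 0] r(4-6)
      by (intro free_of_betti_1_zero[where \<epsilon> = \<epsilon> and b = "b 0" and m = "b (Suc 0)" and n = "b (Suc (Suc 0))" and A = A]) simp_all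
    then show False using assms(4) unfolding R_def by (rule notE[rotated])
  qed
  show ?thesis
  proof (intro allI impI)
    fix i :: nat assume i: "i \<ge> 2"
    then obtain j where j: "i = Suc j" by (cases i) auto
    have "\<beta> i + (d - 1) \<le> \<beta> (Suc i)"
      unfolding \<beta>_def by (rule betti_sequence_growth[OF r(1,2) t_pos assms(1) \<open>\<beta> 1 \<noteq> 0\<close>[unfolded \<beta>_def] i])
    then show "int (betti (trunc_poly_ring d n) M (i + 1)) - int (betti (trunc_poly_ring d n) M i) \<ge> int d - 1"
      unfolding R_def[symmetric] j Suc_eq_plus1[symmetric] betti using assms(1) by simp
  qed
qed

end
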